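(* Suppose the real input sequence $\{x_i\}_{i\ge 0}$ satisfies (A1) or (A2) or (A3). Let $\widetilde{T}_n=S_n\odot T_n$ be the $n\times n$ skew-symmetric Toeplitz matrix, where $T_n=((x_{|i-j|}))_{1\le i,j\le n}$. Then the LSD of $n^{-1/2}\widetilde{T}_n$ exists and equals $\mathcal{L}_T$, the LSD of the symmetric Toeplitz matrices $n^{-1/2}T_n$.
   Context: Assumptions on the real input random variables: (A1) they are independent and uniformly bounded with mean $0$ and variance $1$; (A2) they are i.i.d. with mean $0$ and variance $1$; (A3) they are independent with mean $0$ and variance $1$, and with uniformly bounded moments of all orders. $S_n=((s_{ij}))_{1\le i,j\le n}$ is the skew-symmetric sign matrix with $s_{ij}=1$ if $i<j$, $s_{ii}=0$, $s_{ij}=-1$ if $i>j$. The symbol $\odot$ denotes the entrywise (Schur–Hadamard) product. For a real symmetric $n\times n$ matrix $A$ with eigenvalues $\lambda_1,\dots,\lambda_n$, the empirical spectral distribution is $F^A(x)=\frac1n\#\{j:\lambda_j\le x\}$. For a real skew-symmetric $n\times n$ matrix $A$ with (purely imaginary) eigenvalues $\lambda_1,\dots,\lambda_n$, it is the distribution function on $\mathbb{R}$ given by $F^A(x)=\frac1n\#\{j: \mathrm{i}\lambda_j\le x\}$, where $\mathrm{i}=\sqrt{-1}$. A non-random distribution function $F$ is the limiting spectral distribution (LSD) of a sequence $A_n$ if, outside a null set, $F^{A_n}(x)\to F(x)$ as $n\to\infty$ at all continuity points $x$ of $F$. It is known that, under any of (A1), (A2), (A3), the LSD of $n^{-1/2}T_n$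 exists and does not depend on the distribution of the input sequence; this common limit is denoted $\mathcal{L}_T$. *)

theory Defs
  imports "HOL-Probability.Probability" "Jordan_Normal_Form.Char_Poly"
begin

section \<open>Input sequences\<close>

text \<open>The Bochner integral of a non-integrable function is 0, so integrability of the first two
  powers is part of having mean 0 and variance 1.\<close>

definition mean0_var1 :: "'a measure \<Rightarrow> ('a \<Rightarrow> real) \<Rightarrow> bool" where
  "mean0_var1 M X \<longleftrightarrow>
     integrable M X \<and> integrable M (\<lambda>\<omega>. (X \<omega>)\<^sup>2) \<and>
     prob_space.expectation M X = 0 \<and> prob_space.variance M X = 1"

definition input_A1 :: "'a measure \<Rightarrow> (nat \<Rightarrow> 'a \<Rightarrow> real) \<Rightarrow> bool" where
  "input_A1 M x \<longleftrightarrow>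
     prob_space.indep_vars M (\<lambda>_. borel) x UNIV \<and>
     (\<exists>C. \<forall>i. AE \<omega> in M. \<bar>x i \<omega>\<bar> \<le> C) \<and>
     (\<forall>i. mean0_var1 M (x i))"

definition input_A2 :: "'a measure \<Rightarrow> (nat \<Rightarrow> 'a \<Rightarrow> real) \<Rightarrow> bool" where
  "input_A2 M x \<longleftrightarrow>
     prob_space.indep_vars M (\<lambda>_. borel) x UNIV \<and>
     (\<forall>i j. distr M borel (x i) = distr M borel (x j)) \<and>
     (\<forall>i. mean0_var1 M (x i))"

definition input_A3 :: "'a measure \<Rightarrow> (nat \<Rightarrow> 'a \<Rightarrow> real) \<Rightarrow> bool" where
  "input_A3 M x \<longleftrightarrow>
     prob_space.indep_vars M (\<lambda>_. borel) x UNIV \<and>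
     (\<forall>i. mean0_var1 M (x i)) \<and>
     (\<forall>k. \<exists>C. \<forall>i. integrable M (\<lambda>\<omega>. \<bar>x i \<omega>\<bar> ^ k) \<and>
                  prob_space.expectation M (\<lambda>\<omega>. \<bar>x i \<omega>\<bar> ^ k) \<le> C)"


section \<open>Matrices\<close>

text \<open>Matrix indices run from 0 to \<open>n - 1\<close>; the entries below depend only on \<open>\<bar>i - j\<bar>\<close> and on the
  order of \<open>i\<close> and \<open>j\<close>, so this agrees with indexing from 1 to \<open>n\<close>.\<close>

definition toeplitz_mat :: "(nat \<Rightarrow> real) \<Rightarrow> nat \<Rightarrow> real mat" where
  "toeplitz_mat a n = Matrix.mat n n (\<lambda>(i, j). a (nat \<bar>int i - int j\<bar>))"

definition skew_sign_mat :: "nat \<Rightarrow> real mat" where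
  "skew_sign_mat n = Matrix.mat n n (\<lambda>(i, j). if i < j then 1 else if i = j then 0 else - 1)"

definition schur_prod :: "real mat \<Rightarrow> real mat \<Rightarrow> real mat" (infixl "\<odot>" 70) where
  "A \<odot> B = Matrix.mat (dim_row A) (dim_col A) (\<lambda>(i, j). A $$ (i, j) * B $$ (i, j))"

definition skew_toeplitz_mat :: "(nat \<Rightarrow> real) \<Rightarrow> nat \<Rightarrow> real mat" where
  "skew_toeplitz_mat a n = skew_sign_mat n \<odot> toeplitz_mat a n"


section \<open>Spectral distributions\<close>

text \<open>The eigenvalues, with multiplicity, are the roots of the characteristic polynomial. For a
  symmetric real matrix all of its complex roots are real, so the real roots suffice.\<close>

definition esd_symmetric :: "real mat \<Rightarrow> real \<Rightarrow> real" where
  "esd_symmetric A x =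
     real (size {#l \<in># proots (char_poly A). l \<le> x#}) / real (dim_row A)"

text \<open>For a skew-symmetric real matrix, \<open>\<i> * l\<close> is real for every eigenvalue \<open>l\<close>; \<open>Re\<close> only
  converts its type.\<close>

definition esd_skew :: "real mat \<Rightarrow> real \<Rightarrow> real" where
  "esd_skew A x =
     real (size {#l \<in># proots (char_poly (map_mat complex_of_real A)). Re (\<i> * l) \<le> x#})
       / real (dim_row A)"

definition distribution_function :: "(real \<Rightarrow> real) \<Rightarrow> bool" where
  "distribution_function F \<longleftrightarrow> (\<exists>\<mu>. real_distribution \<mu> \<and> F = cdf \<mu>)"

text \<open>\<open>G n \<omega>\<close> is the empirical spectral distribution function of the \<open>n\<close>-th random matrix at \<open>\<omega>\<close>.
  Recall that \<^const>\<open>weak_conv\<close> is pointwise convergence at the continuity points of the limit.\<close>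

definition is_LSD :: "'a measure \<Rightarrow> (nat \<Rightarrow> 'a \<Rightarrow> real \<Rightarrow> real) \<Rightarrow> (real \<Rightarrow> real) \<Rightarrow> bool" where
  "is_LSD M G F \<longleftrightarrow>
     distribution_function F \<and> (AE \<omega> in M. weak_conv (\<lambda>n. G n \<omega>) F)"

definition toeplitz_esd :: "(nat \<Rightarrow> 'a \<Rightarrow> real) \<Rightarrow> nat \<Rightarrow> 'a \<Rightarrow> real \<Rightarrow> real" where
  "toeplitz_esd x n \<omega> =
     esd_symmetric ((1 / sqrt (real n)) \<cdot>\<^sub>m toeplitz_mat (\<lambda>i. x i \<omega>) n)"

definition skew_toeplitz_esd :: "(nat \<Rightarrow> 'a \<Rightarrow> real) \<Rightarrow> nat \<Rightarrow> 'a \<Rightarrow> real \<Rightarrow> real" where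
  "skew_toeplitz_esd x n \<omega> =
     esd_skew ((1 / sqrt (real n)) \<cdot>\<^sub>m skew_toeplitz_mat (\<lambda>i. x i \<omega>) n)"

text \<open>The common limiting spectral distribution of the scaled symmetric Toeplitz matrices over all
  admissible inputs. Fixing the type of the sample points to \<^typ>\<open>nat \<Rightarrow> real\<close> loses no
  generality, since any real input sequence can be replaced by the coordinate sequence under its
  joint law.\<close>

definition L_T :: "real \<Rightarrow> real" where
  "L_T = (THE F. \<forall>(M :: (nat \<Rightarrow> real) measure) x.
            prob_space M \<longrightarrow> input_A1 M x \<or> input_A2 M x \<or> input_A3 M x \<longrightarrow>
            is_LSD M (toeplitz_esd x) F)"

end

theory Submission
  imports Defs "Jordan_Normal_Form.Spectral_Radius"
begin

text \<open>Write \<open>c(l - i) a(\<bar>l - i\<bar>) / \<surd>n\<close> for the entries of a Hermitian matrix, where \<open>c(- s) = cnj (c s)\<close> and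
  \<open>\<bar>c s\<bar> = 1\<close> for \<open>s \<noteq> 0\<close>. The choice \<open>c = 1\<close> gives the symmetric Toeplitz matrix, \<open>c s = \<i> sgn s\<close> gives \<open>\<i>\<close> times
  the skew-symmetric one. The \<open>k\<close>-th spectral moment is a sum over closed walks of \<open>k\<close> steps, weighted by
  \<open>\<Prod>c(s\<^sub>j)\<close>. To leading order only walks whose steps cancel in opposite pairs contribute to its expectation,
  and on these the weight is 1 because \<open>c(s) c(- s) = 1\<close>. The limits of the moments are thus volumes of
  polytopes which depend neither on \<open>c\<close> nor on the input, and they grow slowly enough to determine a
  characteristic function.

  The variance of a moment is of order \<open>1/n\<close>, which gives almost sure convergence along the squares. The
  characteristic function at a general \<open>n\<close> is compared with the one at the square below it by means of the
  Hilbert--Schmidt distance of the matrices. An i.i.d. input with finite variance is approximated in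
  square mean by bounded ones; a maximal inequality makes the approximation uniform in \<open>n\<close>.\<close>

text \<open>If two matched steps are equal instead of opposite, the condition that the walk closes
  becomes a nontrivial equation for their common value and one free parameter is lost. Hence the
  walks whose weight may differ from 1 are of lower order. The variance bound 1/n is not summable
  over all n, so moments are followed along squares only. The gaps cannot be filled by comparing
  moments, because powers are not Lipschitz; the functions exp(itx) are, and a coupling of two
  spectra bounds averages of Lipschitz functions by the Hilbert-Schmidt distance. This is why
  everything after the moments is phrased with characteristic functions. The padding is negligible
  because consecutive squares have ratio tending to 1, provided that the square sum of the input
  grows linearly. The limiting volumes are never computed. Their existence, the bound 2^d and a
  crude count of matchings give moments of order 2d at most 48^d d!, and (2d)! >= (d!)^2 makes the
  Taylor series converge. The limit function is thus known before any limit measure; tightness along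
  a single sample path supplies the measure.\<close>

unbundle no vec_syntax

section \<open>Spectral theorem for Hermitian kernels\<close>

text \<open>If all eigenvalues of a multiple \<open>C\<close> of \<open>b\<close> vanish, the powers of \<open>C\<close> stay bounded. But
  \<open>(C\<^bsup>2m\<^esup>)\<^sub>i\<^sub>i \<ge> \<bar>(C\<^bsup>m\<^esup>)\<^sub>i\<^sub>i\<bar>\<^sup>2\<close> for a Hermitian matrix, so they blow up if the multiple is large.\<close>

lemma hermitian_nonzero_eigenvalue:
  fixes b :: "nat \<Rightarrow> nat \<Rightarrow> complex"
  assumes herm: "\<And>i l. i < n \<Longrightarrow> l < n \<Longrightarrow> b l i = cnj (b i l)"
    and nz: "i0 < n" "l0 < n" "b i0 l0 \<noteq> 0"
  shows "\<exists>v \<mu>. \<mu> \<noteq> 0 \<and> (\<exists>i<n. v i \<noteq> 0) \<and> (\<forall>i<n. (\<Sum>l<n. b i l * v l) = \<mu> * v i)"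
proof (rule ccontr)
  assume contra: "\<not> ?thesis"
  \<comment> \<open>With this scale the entry of \<open>C\<close> at \<open>(i0, l0)\<close> has
    modulus 2, so the first squaring already gives a diagonal entry of modulus at least 4, and every
    further one squares it again.\<close>
  define t where "t = 2 / cmod (b i0 l0)"
  have t: "t > 0" using nz by (simp add: t_def)
  define C where "C = Matrix.mat n n (\<lambda>(i, l). of_real t * b i l)"
  have C: "C \<in> carrier_mat n n" by (simp add: C_def)
  have ev0: "e = 0" if e: "eigenvalue C e" for e
  proof (rule ccontr)
    assume "e \<noteq> 0"
    from e obtain v where v: "v \<in> carrier_vec n" "v \<noteq> 0\<^sub>v n" "C *\<^sub>v v = e \<cdot>\<^sub>v v"
      unfolding eigenvalue_def eigenvector_def using C by auto
    have "\<exists>i<n. v $ i \<noteq> 0"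
      using v(1,2) by (auto simp: Matrix.vec_eq_iff)
    moreover have "(\<Sum>l<n. b i l * v $ l) = (e / of_real t) * v $ i" if i: "i < n" for i
    proof -
      have "(C *\<^sub>v v) $ i = e * v $ i" using v i by simp
      moreover have "(C *\<^sub>v v) $ i = of_real t * (\<Sum>l<n. b i l * v $ l)"
        using i v(1) C by (simp add: C_def scalar_prod_def sum_distrib_left mult.assoc atLeast0LessThan)
      ultimately show ?thesis using t by (simp add: field_simps)
    qed
    moreover have "e / of_real t \<noteq> 0" using \<open>e \<noteq> 0\<close> t by simp
    ultimately show False using contra by metis
  qed
  have n0: "n > 0" using nz by auto
  obtain e where "spectral_radius C = cmod e" "eigenvalue C e"
    using spectral_radius_mem_max(1)[OF C n0] by (auto simp: spectrum_def)
  then have "spectral_radius C < 1" using ev0[of e] by simp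
  then obtain c where c: "\<And>k. norm_bound (C ^\<^sub>m k) c"
    using spectral_radius_jnf_norm_bound_less_1_upper_triangular[OF C] by blast
  have Ck: "C ^\<^sub>m k \<in> carrier_mat n n" for k using C by simp
  have pow2: "C ^\<^sub>m (2 ^ Suc m) = C ^\<^sub>m (2 ^ m) * C ^\<^sub>m (2 ^ m)" for m
  proof -
    have add: "C ^\<^sub>m (p + q) = C ^\<^sub>m p * C ^\<^sub>m q" for p q
      by (induction q) (use C Ck in \<open>auto simp: assoc_mult_mat[of _ n n _ n _ n]\<close>)
    show ?thesis using add[of "2^m" "2^m"] by (simp add: mult_2)
  qed
  have hermC: "(C ^\<^sub>m (2^m)) $$ (l, i) = cnj ((C ^\<^sub>m (2^m)) $$ (i, l))" if "i < n" "l < n" for i l m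
    using that
  proof (induction m arbitrary: i l)
    case 0
    then show ?case using C herm[of i l] by (simp add: C_def)
  next
    case (Suc m)
    have "(C ^\<^sub>m (2 ^ m) * C ^\<^sub>m (2 ^ m)) $$ (l, i) = (\<Sum>j<n. (C ^\<^sub>m (2 ^ m)) $$ (l,j) * (C ^\<^sub>m (2 ^ m)) $$ (j,i))"
      using C Suc.prems by (simp add: scalar_prod_def atLeast0LessThan)
    moreover have "(C ^\<^sub>m (2 ^ m) * C ^\<^sub>m (2 ^ m)) $$ (i, l) = (\<Sum>j<n. (C ^\<^sub>m (2 ^ m)) $$ (i,j) * (C ^\<^sub>m (2 ^ m)) $$ (j,l))"
      using C Suc.prems by (simp add: scalar_prod_def atLeast0LessThan)
    moreover have "(\<Sum>j<n. (C ^\<^sub>m (2 ^ m)) $$ (l,j) * (C ^\<^sub>m (2 ^ m)) $$ (j,i))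
       = (\<Sum>j<n. cnj ((C ^\<^sub>m (2 ^ m)) $$ (j,l)) * cnj ((C ^\<^sub>m (2 ^ m)) $$ (i,j)))"
    proof (intro sum.cong refl)
      fix j assume "j \<in> {..<n}"
      then show "(C ^\<^sub>m (2 ^ m)) $$ (l,j) * (C ^\<^sub>m (2 ^ m)) $$ (j,i)
        = cnj ((C ^\<^sub>m (2 ^ m)) $$ (j,l)) * cnj ((C ^\<^sub>m (2 ^ m)) $$ (i,j))"
        using Suc.IH[of j l] Suc.IH[of i j] Suc.prems by simp
    qed
    ultimately show ?case unfolding pow2 by (simp add: mult.commute)
  qed
  have grow: "cmod ((C ^\<^sub>m (2 ^ Suc m)) $$ (i0, i0)) \<ge> (cmod ((C ^\<^sub>m (2 ^ m)) $$ (i0, j)))\<^sup>2" if "j < n" for m j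
  proof -
    have "(C ^\<^sub>m (2 ^ Suc m)) $$ (i0, i0) = (\<Sum>l<n. (C ^\<^sub>m (2 ^ m)) $$ (i0,l) * (C ^\<^sub>m (2 ^ m)) $$ (l,i0))"
      unfolding pow2 using C nz(1) by (simp add: scalar_prod_def atLeast0LessThan)
    also have "\<dots> = of_real (\<Sum>l<n. (cmod ((C ^\<^sub>m (2 ^ m)) $$ (i0,l)))\<^sup>2)"
      using nz(1) hermC[of i0 _ m] by (simp add: complex_norm_square[symmetric])
    finally have "cmod ((C ^\<^sub>m (2 ^ Suc m)) $$ (i0, i0)) = (\<Sum>l<n. (cmod ((C ^\<^sub>m (2 ^ m)) $$ (i0,l)))\<^sup>2)"
      by (simp only: norm_of_real) (simp add: sum_nonneg)
    moreover have "(cmod ((C ^\<^sub>m (2 ^ m)) $$ (i0, j)))\<^sup>2 \<le> (\<Sum>l<n. (cmod ((C ^\<^sub>m (2 ^ m)) $$ (i0,l)))\<^sup>2)"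
      using that by (intro member_le_sum) auto
    ultimately show ?thesis by simp
  qed
  have lower: "cmod ((C ^\<^sub>m (2 ^ Suc m)) $$ (i0, i0)) \<ge> 2 ^ (m + 2)" for m
  proof (induction m)
    case 0
    have "cmod (C $$ (i0, l0)) = 2" using nz t by (simp add: C_def norm_mult norm_divide t_def)
    then show ?case using grow[OF nz(2), of 0] C by simp
  next
    case (Suc m)
    have "(2::real) ^ (Suc m + 2) \<le> (2 ^ (m + 2))\<^sup>2"
      unfolding power_mult[symmetric] by (intro power_increasing) auto
    also have "\<dots> \<le> (cmod ((C ^\<^sub>m (2 ^ Suc m)) $$ (i0, i0)))\<^sup>2"
      using Suc.IH by (intro power_mono) auto
    also have "\<dots> \<le> cmod ((C ^\<^sub>m (2 ^ Suc (Suc m))) $$ (i0, i0))" by (rule grow[OF nz(1)])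
    finally show ?case .
  qed
  obtain m where "c < 2 ^ m" using real_arch_pow[of 2 c] by auto
  moreover have "cmod ((C ^\<^sub>m (2 ^ Suc m)) $$ (i0, i0)) \<le> c"
    using c[of "2 ^ Suc m"] nz(1) C unfolding norm_bound_def by auto
  moreover have "(2::real) ^ m \<le> 2 ^ (m + 2)" by simp
  ultimately show False using lower[of m] by linarith
qed

lemma hermitian_eigenvalue_real:
  fixes a :: "nat \<Rightarrow> nat \<Rightarrow> complex"
  assumes herm: "\<And>i l. i < n \<Longrightarrow> l < n \<Longrightarrow> a l i = cnj (a i l)"
    and ev: "\<And>i. i < n \<Longrightarrow> (\<Sum>l<n. a i l * v l) = \<mu> * v i"
    and v: "i < n" "v i \<noteq> 0"
  shows "\<mu> \<in> \<real>"
proof -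
  let ?N = "\<Sum>i<n. v i * cnj (v i)"
  have "\<mu> * ?N = (\<Sum>i<n. (\<Sum>l<n. a i l * v l) * cnj (v i))"
    using ev by (simp add: sum_distrib_left mult.assoc)
  also have "\<dots> = (\<Sum>i<n. \<Sum>l<n. v l * cnj (a l i * v i))"
    unfolding sum_distrib_right
  proof (intro sum.cong refl)
    fix i l assume "i \<in> {..<n}" "l \<in> {..<n}"
    then show "a i l * v l * cnj (v i) = v l * cnj (a l i * v i)" using herm[of l i] by simp
  qed
  also have "\<dots> = (\<Sum>l<n. \<Sum>i<n. v l * cnj (a l i * v i))" by (rule sum.swap)
  also have "\<dots> = (\<Sum>l<n. v l * cnj (\<mu> * v l))"
    using ev by (simp add: sum_distrib_left[symmetric] cnj_sum[symmetric] del: cnj_sum complex_cnj_mult)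
  also have "\<dots> = cnj \<mu> * ?N" by (simp add: sum_distrib_left algebra_simps)
  finally have "(\<mu> - cnj \<mu>) * ?N = 0" by (simp add: algebra_simps)
  moreover have "?N \<noteq> 0"
  proof -
    have "?N = of_real (\<Sum>i<n. (cmod (v i))\<^sup>2)" by (simp only: complex_norm_square of_real_sum)
    moreover have "(\<Sum>i<n. (cmod (v i))\<^sup>2) > 0"
      using v by (intro sum_pos2[of _ i]) auto
    ultimately show ?thesis by (metis of_real_eq_0_iff less_irrefl)
  qed
  ultimately show ?thesis by (simp add: Reals_cnj_iff)
qed

text \<open>Deflation: the part \<open>b\<close> left after subtracting the known spectral terms
  annihilates every \<open>u j\<close>, so an eigenvector of \<open>b\<close> with nonzero
  eigenvalue is orthogonal to them and is an eigenvector of \<open>a\<close> too. If nothing is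
  left, any nonzero vector orthogonal to the \<open>u j\<close> will do, with eigenvalue 0.\<close>

lemma hermitian_eigenvectors_extend:
  fixes a :: "nat \<Rightarrow> nat \<Rightarrow> complex" and lam :: "nat \<Rightarrow> real"
  assumes herm: "\<And>i l. i < n \<Longrightarrow> l < n \<Longrightarrow> a l i = cnj (a i l)"
    and "k < n"
    and orth: "\<And>j j'. j < k \<Longrightarrow> j' < k \<Longrightarrow> (\<Sum>i<n. u j i * cnj (u j' i)) = of_bool (j = j')"
    and ev: "\<And>i j. i < n \<Longrightarrow> j < k \<Longrightarrow> (\<Sum>l<n. a i l * u j l) = of_real (lam j) * u j i"
  shows "\<exists>v \<mu>. (\<exists>i<n. v i \<noteq> 0) \<and> (\<forall>i<n. (\<Sum>l<n. a i l * v l) = of_real \<mu> * v i)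
           \<and> (\<forall>j<k. (\<Sum>i<n. v i * cnj (u j i)) = 0)"
proof -
  define b where "b i l = a i l - (\<Sum>j<k. of_real (lam j) * u j i * cnj (u j l))" for i l
  have hermb: "b l i = cnj (b i l)" if "i < n" "l < n" for i l
    using herm[OF that] by (simp add: b_def algebra_simps)
  have bv: "(\<Sum>l<n. b i l * v l) = (\<Sum>l<n. a i l * v l) - (\<Sum>j<k. of_real (lam j) * u j i * (\<Sum>l<n. v l * cnj (u j l)))" for i v
  proof -
    have "(\<Sum>l<n. (\<Sum>j<k. of_real (lam j) * u j i * cnj (u j l)) * v l)
        = (\<Sum>j<k. of_real (lam j) * u j i * (\<Sum>l<n. v l * cnj (u j l)))"
      unfolding sum_distrib_left sum_distrib_right by (subst sum.swap) (simp add: mult_ac)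
    then show ?thesis by (simp add: b_def left_diff_distrib sum_subtractf)
  qed
  have bu: "(\<Sum>l<n. b i l * u j l) = 0" if "i < n" "j < k" for i j
  proof -
    have "(\<Sum>j'<k. of_real (lam j') * u j' i * (\<Sum>l<n. u j l * cnj (u j' l))) =
      (\<Sum>j'<k. if j' = j then of_real (lam j') * u j' i else 0)"
      using orth that by (intro sum.cong) auto
    then show ?thesis using that ev by (simp add: bv)
  qed
  show ?thesis
  proof (cases "\<exists>i<n. \<exists>l<n. b i l \<noteq> 0")
    case True
    then obtain i0 l0 where il0: "i0 < n" "l0 < n" "b i0 l0 \<noteq> 0" by blast
    obtain v \<mu> where v: "\<mu> \<noteq> 0" "\<exists>i<n. v i \<noteq> 0" "\<And>i. i < n \<Longrightarrow> (\<Sum>l<n. b i l * v l) = \<mu> * v i"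
      using hermitian_nonzero_eigenvalue[of n b i0 l0, OF hermb il0] by blast
    from v(2) obtain i1 where i1: "i1 < n" "v i1 \<noteq> 0" by blast
    have vu: "(\<Sum>i<n. v i * cnj (u j i)) = 0" if j: "j < k" for j
    proof -
      have "\<mu> * (\<Sum>i<n. v i * cnj (u j i)) = (\<Sum>i<n. (\<Sum>l<n. b i l * v l) * cnj (u j i))"
        using v(3) by (simp add: sum_distrib_left mult.assoc)
      also have "\<dots> = (\<Sum>i<n. \<Sum>l<n. v l * cnj (b l i * u j i))"
        unfolding sum_distrib_right
      proof (intro sum.cong refl)
        fix i l assume "i \<in> {..<n}" "l \<in> {..<n}"
        then show "b i l * v l * cnj (u j i) = v l * cnj (b l i * u j i)" using hermb[of l i] by simp
      qed
      also have "\<dots> = (\<Sum>l<n. \<Sum>i<n. v l * cnj (b l i * u j i))" by (rule sum.swap)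
      also have "\<dots> = 0"
        using bu[OF _ j] by (simp add: sum_distrib_left[symmetric] cnj_sum[symmetric] del: cnj_sum complex_cnj_mult)
      finally show ?thesis using v(1) by simp
    qed
    have "\<mu> \<in> \<real>" by (rule hermitian_eigenvalue_real[of n b v \<mu> i1, OF hermb v(3) i1])
    then obtain r where r: "\<mu> = of_real r" by (auto elim: Reals_cases)
    have "(\<Sum>l<n. a i l * v l) = of_real r * v i" if "i < n" for i
      using bv[of i v] v(3)[OF that] vu r by simp
    then show ?thesis using v(2) vu by (intro exI[of _ v] exI[of _ r]) blast
  next
    case False
    \<comment> \<open>The orthogonal projection onto the complement of the \<open>u j\<close>. Its
      trace \<open>n - k\<close> is positive, so some diagonal entry is nonzero, and the
      corresponding column is the vector sought.\<close>
    define P where "P i l = of_bool (i = l) - (\<Sum>j<k. u j i * cnj (u j l))" for i l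
    have "(\<Sum>i<n. P i i) = of_nat (n - k)"
    proof -
      have "(\<Sum>i<n. \<Sum>j<k. u j i * cnj (u j i)) = of_nat k"
        using orth by (subst sum.swap) simp
      then show ?thesis using \<open>k < n\<close> by (simp add: P_def sum_subtractf of_nat_diff)
    qed
    then have "(\<Sum>i<n. P i i) \<noteq> 0" using \<open>k < n\<close> by simp
    then obtain i0 where i0: "i0 < n" "P i0 i0 \<noteq> 0"
      using sum.neutral[of "{..<n}" "\<lambda>i. P i i"] by blast
    define v where "v i = P i i0" for i
    have vu: "(\<Sum>i<n. v i * cnj (u j i)) = 0" if j: "j < k" for j
    proof -
      have "(\<Sum>i<n. v i * cnj (u j i)) = cnj (u j i0) - (\<Sum>j'<k. cnj (u j' i0) * (\<Sum>i<n. u j' i * cnj (u j i)))"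
      proof -
        have "(\<Sum>i<n. (\<Sum>j'<k. u j' i * cnj (u j' i0)) * cnj (u j i))
          = (\<Sum>j'<k. cnj (u j' i0) * (\<Sum>i<n. u j' i * cnj (u j i)))"
          unfolding sum_distrib_left sum_distrib_right by (subst sum.swap) (simp add: mult_ac)
        moreover have "(\<Sum>i<n. of_bool (i = i0) * cnj (u j i)) = cnj (u j i0)"
        proof -
          have "(\<Sum>i<n. of_bool (i = i0) * cnj (u j i)) = (\<Sum>i<n. if i = i0 then cnj (u j i) else 0)"
            by (intro sum.cong) auto
          then show ?thesis using i0 by simp
        qed
        ultimately show ?thesis by (simp add: v_def P_def left_diff_distrib sum_subtractf)
      qed
      also have "(\<Sum>j'<k. cnj (u j' i0) * (\<Sum>i<n. u j' i * cnj (u j i))) = (\<Sum>j'<k. if j' = j then cnj (u j' i0) else 0)"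
        using orth j by (intro sum.cong) auto
      finally show ?thesis using j by simp
    qed
    have "(\<Sum>l<n. a i l * v l) = of_real 0 * v i" if "i < n" for i
      using bv[of i v] vu False that by simp
    then show ?thesis using vu i0 by (intro exI[of _ v] exI[of _ 0]) (auto simp: v_def)
  qed
qed

lemma hermitian_orthonormal_eigenvectors:
  fixes a :: "nat \<Rightarrow> nat \<Rightarrow> complex"
  assumes herm: "\<And>i l. i < n \<Longrightarrow> l < n \<Longrightarrow> a l i = cnj (a i l)" and "k \<le> n"
  shows "\<exists>u (lam :: nat \<Rightarrow> real). (\<forall>j<k. \<forall>j'<k. (\<Sum>i<n. u j i * cnj (u j' i)) = of_bool (j = j'))
    \<and> (\<forall>j<k. \<forall>i<n. (\<Sum>l<n. a i l * u j l) = of_real (lam j) * u j i)"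
  using \<open>k \<le> n\<close>
proof (induction k)
  case (Suc k)
  then obtain u and lam :: "nat \<Rightarrow> real" where IH: "\<forall>j<k. \<forall>j'<k. (\<Sum>i<n. u j i * cnj (u j' i)) = of_bool (j = j')"
    "\<forall>j<k. \<forall>i<n. (\<Sum>l<n. a i l * u j l) = of_real (lam j) * u j i"
    using Suc_leD by blast
  from IH have u: "\<And>j j'. j < k \<Longrightarrow> j' < k \<Longrightarrow> (\<Sum>i<n. u j i * cnj (u j' i)) = of_bool (j = j')"
    and ev: "\<And>j i. j < k \<Longrightarrow> i < n \<Longrightarrow> (\<Sum>l<n. a i l * u j l) = of_real (lam j) * u j i"
    by blast+
  obtain v \<mu> where v: "\<exists>i<n. v i \<noteq> 0" "\<And>i. i < n \<Longrightarrow> (\<Sum>l<n. a i l * v l) = of_real \<mu> * v i"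
    "\<And>j. j < k \<Longrightarrow> (\<Sum>i<n. v i * cnj (u j i)) = 0"
    using hermitian_eigenvectors_extend[of n a k u lam, OF herm _ u ev] Suc.prems by auto
  define s where "s = sqrt (\<Sum>i<n. (cmod (v i))\<^sup>2)"
  have s0: "(\<Sum>i<n. (cmod (v i))\<^sup>2) > 0"
    using v(1) by (auto intro!: sum_pos2)
  then have s: "s > 0" "s * s = (\<Sum>i<n. (cmod (v i))\<^sup>2)" by (simp_all add: s_def)
  define w where "w i = v i / of_real s" for i
  have ww: "(\<Sum>i<n. w i * cnj (w i)) = 1"
  proof -
    have "(\<Sum>i<n. w i * cnj (w i)) = (\<Sum>i<n. v i * cnj (v i)) / of_real (s * s)"
      by (simp add: w_def sum_divide_distrib)
    also have "(\<Sum>i<n. v i * cnj (v i)) = of_real (s * s)"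
      unfolding s(2) by (simp only: complex_norm_square of_real_sum)
    finally have "(\<Sum>i<n. w i * cnj (w i)) = of_real (s * s) / of_real (s * s)" .
    then show ?thesis using s(1) by simp
  qed
  have wu: "(\<Sum>i<n. w i * cnj (u j i)) = 0" if "j < k" for j
    using v(3)[OF that] by (simp add: w_def sum_divide_distrib[symmetric])
  have uw: "(\<Sum>i<n. u j i * cnj (w i)) = 0" if "j < k" for j
  proof -
    have "(\<Sum>i<n. u j i * cnj (w i)) = cnj (\<Sum>i<n. w i * cnj (u j i))" by (simp add: mult.commute)
    then show ?thesis using wu[OF that] by simp
  qed
  have aw: "(\<Sum>l<n. a i l * w l) = of_real \<mu> * w i" if "i < n" for i
    using v(2)[OF that] by (simp add: w_def sum_divide_distrib[symmetric])
  have "(\<Sum>i<n. (u(k := w)) j i * cnj ((u(k := w)) j' i)) = of_bool (j = j')"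
    if jj: "j < Suc k" "j' < Suc k" for j j'
  proof -
    consider "j < k" "j' < k" | "j < k" "j' = k" | "j = k" "j' < k" | "j = k" "j' = k"
      using jj by (auto simp: less_Suc_eq)
    then show ?thesis using u[of j j'] ww wu[of j'] uw[of j] by cases simp_all
  qed
  moreover have "(\<Sum>l<n. a i l * (u(k := w)) j l) = of_real ((lam(k := \<mu>)) j) * (u(k := w)) j i"
    if "j < Suc k" "i < n" for i j
    using ev[of j i] aw[of i] that by (cases "j = k") simp_all
  ultimately show ?case by blast
qed auto

text \<open>\<open>u j i\<close> is coordinate \<open>i\<close> of eigenvector \<open>j\<close>.
  Plain functions with the bound \<open>n\<close> replace matrices, so that sums can be exchanged
  without carrier conditions and kernels can be padded freely.\<close>

definition eigenbasis :: "nat \<Rightarrow> (nat \<Rightarrow> nat \<Rightarrow> complex) \<Rightarrow> (nat \<Rightarrow> nat \<Rightarrow> complex) \<Rightarrow> (nat \<Rightarrow> real) \<Rightarrow> bool" where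
  "eigenbasis n a u lam \<longleftrightarrow>
     (\<forall>j<n. \<forall>j'<n. (\<Sum>i<n. u j i * cnj (u j' i)) = of_bool (j = j')) \<and>
     (\<forall>i<n. \<forall>l<n. (\<Sum>j<n. u j i * cnj (u j l)) = of_bool (i = l)) \<and>
     (\<forall>i<n. \<forall>l<n. a i l = (\<Sum>j<n. of_real (lam j) * u j i * cnj (u j l)))"

theorem hermitian_spectral:
  fixes a :: "nat \<Rightarrow> nat \<Rightarrow> complex"
  assumes herm: "\<And>i l. i < n \<Longrightarrow> l < n \<Longrightarrow> a l i = cnj (a i l)"
  obtains u lam where "eigenbasis n a u lam"
proof -
  obtain u and lam :: "nat \<Rightarrow> real" where ul: "\<forall>j<n. \<forall>j'<n. (\<Sum>i<n. u j i * cnj (u j' i)) = of_bool (j = j')"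
    "\<forall>j<n. \<forall>i<n. (\<Sum>l<n. a i l * u j l) = of_real (lam j) * u j i"
    using hermitian_orthonormal_eigenvectors[of n a n, OF herm order_refl] by blast
  from ul have u: "\<And>j j'. j < n \<Longrightarrow> j' < n \<Longrightarrow> (\<Sum>i<n. u j i * cnj (u j' i)) = of_bool (j = j')"
    and ev: "\<And>j i. j < n \<Longrightarrow> i < n \<Longrightarrow> (\<Sum>l<n. a i l * u j l) = of_real (lam j) * u j i"
    by blast+
  define P where "P = Matrix.mat n n (\<lambda>(i, j). u j i)"
  define Q where "Q = Matrix.mat n n (\<lambda>(j, i). cnj (u j i))"
  have PQc: "P \<in> carrier_mat n n" "Q \<in> carrier_mat n n" by (auto simp: P_def Q_def)
  have "Q * P = 1\<^sub>m n"
    using u by (intro eq_matI) (auto simp: P_def Q_def scalar_prod_def atLeast0LessThan mult.commute)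
  \<comment> \<open>Orthonormality says that \<open>Q\<close> is a left inverse of \<open>P\<close>;
    for square matrices it is also a right inverse, and this is completeness.\<close>
  then have "P * Q = 1\<^sub>m n" using mat_mult_left_right_inverse PQc by blast
  then have c: "(\<Sum>j<n. u j i * cnj (u j l)) = of_bool (i = l)" if "i < n" "l < n" for i l
  proof -
    have "(P * Q) $$ (i, l) = (\<Sum>j<n. u j i * cnj (u j l))"
      using that by (simp add: P_def Q_def scalar_prod_def atLeast0LessThan)
    moreover have "(P * Q) $$ (i, l) = of_bool (i = l)"
      using \<open>P * Q = 1\<^sub>m n\<close> that by simp
    ultimately show ?thesis by simp
  qed
  have "a i l = (\<Sum>j<n. of_real (lam j) * u j i * cnj (u j l))" if il: "i < n" "l < n" for i l
  proof -
    have "(\<Sum>j<n. of_real (lam j) * u j i * cnj (u j l)) = (\<Sum>j<n. (\<Sum>m<n. a i m * u j m) * cnj (u j l))"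
      using ev il by simp
    also have "\<dots> = (\<Sum>m<n. a i m * (\<Sum>j<n. u j m * cnj (u j l)))"
      unfolding sum_distrib_left sum_distrib_right by (subst sum.swap) (simp add: mult_ac)
    also have "\<dots> = (\<Sum>m<n. if m = l then a i m else 0)"
      by (intro sum.cong refl) (simp add: c[OF _ il(2)])
    also have "\<dots> = a i l" using il by simp
    finally show ?thesis by simp
  qed
  with u c that[of u lam] show ?thesis by (simp add: eigenbasis_def)
qed

lemma eigenbasisD:
  assumes "eigenbasis n a u lam"
  shows eigenbasis_orth: "\<And>j j'. j < n \<Longrightarrow> j' < n \<Longrightarrow> (\<Sum>i<n. u j i * cnj (u j' i)) = of_bool (j = j')"
    and eigenbasis_complete: "\<And>i l. i < n \<Longrightarrow> l < n \<Longrightarrow> (\<Sum>j<n. u j i * cnj (u j l)) = of_bool (i = l)"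
    and eigenbasis_kernel: "\<And>i l. i < n \<Longrightarrow> l < n \<Longrightarrow> a i l = (\<Sum>j<n. of_real (lam j) * u j i * cnj (u j l))"
  using assms by (auto simp: eigenbasis_def)

lemma eigenbasis_right:
  assumes e: "eigenbasis n a u lam" and i: "i < n" and j: "j < n"
  shows "(\<Sum>l<n. a i l * u j l) = of_real (lam j) * u j i"
proof -
  have "(\<Sum>l<n. a i l * u j l) = (\<Sum>l<n. (\<Sum>j'<n. of_real (lam j') * u j' i * cnj (u j' l)) * u j l)"
    using eigenbasis_kernel[OF e i] by simp
  also have "\<dots> = (\<Sum>j'<n. of_real (lam j') * u j' i * (\<Sum>l<n. u j l * cnj (u j' l)))"
    unfolding sum_distrib_left sum_distrib_right by (subst sum.swap) (simp add: mult_ac)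
  also have "\<dots> = (\<Sum>j'<n. if j' = j then of_real (lam j') * u j' i else 0)"
    using eigenbasis_orth[OF e j] by (intro sum.cong) auto
  finally show ?thesis using j by simp
qed

lemma eigenbasis_left:
  assumes e: "eigenbasis n a u lam" and l: "l < n" and j: "j < n"
  shows "(\<Sum>i<n. cnj (u j i) * a i l) = of_real (lam j) * cnj (u j l)"
proof -
  have "(\<Sum>i<n. cnj (u j i) * a i l) = (\<Sum>i<n. cnj (u j i) * (\<Sum>j'<n. of_real (lam j') * u j' i * cnj (u j' l)))"
    using eigenbasis_kernel[OF e _ l] by simp
  also have "\<dots> = (\<Sum>j'<n. of_real (lam j') * cnj (u j' l) * (\<Sum>i<n. u j' i * cnj (u j i)))"
    unfolding sum_distrib_left sum_distrib_right by (subst sum.swap) (simp add: mult_ac)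
  also have "\<dots> = (\<Sum>j'<n. if j' = j then of_real (lam j') * cnj (u j' l) else 0)"
    using eigenbasis_orth[OF e _ j] by (intro sum.cong) auto
  finally show ?thesis using j by simp
qed

lemma parseval:
  fixes u :: "nat \<Rightarrow> nat \<Rightarrow> complex"
  assumes c: "\<And>i l. i < n \<Longrightarrow> l < n \<Longrightarrow> (\<Sum>j<n. u j i * cnj (u j l)) = of_bool (i = l)"
  shows "(\<Sum>j<n. (cmod (\<Sum>i<n. cnj (u j i) * x i))\<^sup>2) = (\<Sum>i<n. (cmod (x i))\<^sup>2)"
proof -
  have "complex_of_real (\<Sum>j<n. (cmod (\<Sum>i<n. cnj (u j i) * x i))\<^sup>2)
      = (\<Sum>j<n. (\<Sum>i<n. cnj (u j i) * x i) * (\<Sum>l<n. u j l * cnj (x l)))"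
    by (simp only: of_real_sum complex_norm_square) simp
  also have "\<dots> = (\<Sum>j<n. \<Sum>i<n. \<Sum>l<n. x i * cnj (x l) * (u j l * cnj (u j i)))"
    by (simp add: sum_product mult_ac)
  also have "\<dots> = (\<Sum>i<n. \<Sum>l<n. \<Sum>j<n. x i * cnj (x l) * (u j l * cnj (u j i)))"
    by (rule trans[OF sum.swap], rule sum.cong[OF refl], rule sum.swap)
  also have "\<dots> = (\<Sum>i<n. \<Sum>l<n. x i * cnj (x l) * of_bool (l = i))"
    using c by (simp add: sum_distrib_left[symmetric])
  also have "\<dots> = complex_of_real (\<Sum>i<n. (cmod (x i))\<^sup>2)"
    by (simp only: of_real_sum complex_norm_square) (simp add: of_bool_def if_distrib cong: if_cong)
  finally show ?thesis by (simp only: of_real_eq_iff)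
qed

text \<open>The overlaps \<open>\<bar>\<langle>u\<^sub>j, v\<^sub>k\<rangle>\<bar>\<^sup>2\<close> form a doubly stochastic matrix which couples the two spectra
  with total quadratic cost \<open>\<parallel>a - b\<parallel>\<^sup>2\<close>.\<close>

theorem spectral_sum_diff_le:
  fixes f :: "real \<Rightarrow> complex"
  assumes a: "eigenbasis n a u lam" and b: "eigenbasis n b v mu"
    and f: "\<And>x y. cmod (f x - f y) \<le> L * \<bar>x - y\<bar>" and L: "L \<ge> 0"
  shows "cmod ((\<Sum>j<n. f (lam j)) - (\<Sum>j<n. f (mu j)))
    \<le> L * sqrt (real n) * sqrt (\<Sum>i<n. \<Sum>l<n. (cmod (a i l - b i l))\<^sup>2)"
proof -
  define w where "w j k = (cmod (\<Sum>i<n. cnj (u j i) * v k i))\<^sup>2" for j k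
  have w0: "w j k \<ge> 0" for j k by (simp add: w_def)
  have vnorm: "(\<Sum>i<n. (cmod (v k i))\<^sup>2) = 1" if "k < n" for k
  proof -
    have "complex_of_real (\<Sum>i<n. (cmod (v k i))\<^sup>2) = 1"
      using eigenbasis_orth[OF b that that] by (simp only: of_real_sum complex_norm_square) simp
    then show ?thesis by (metis of_real_eq_1_iff)
  qed
  have unorm: "(\<Sum>i<n. (cmod (u k i))\<^sup>2) = 1" if "k < n" for k
  proof -
    have "complex_of_real (\<Sum>i<n. (cmod (u k i))\<^sup>2) = 1"
      using eigenbasis_orth[OF a that that] by (simp only: of_real_sum complex_norm_square) simp
    then show ?thesis by (metis of_real_eq_1_iff)
  qed
  have wcol: "(\<Sum>j<n. w j k) = 1" if "k < n" for k
    unfolding w_def using parseval[of n u "v k", OF eigenbasis_complete[OF a]] vnorm[OF that] by simp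
  have wrow: "(\<Sum>k<n. w j k) = 1" if "j < n" for j
  proof -
    have "w j k = (cmod (\<Sum>i<n. cnj (v k i) * u j i))\<^sup>2" for k
    proof -
      have "(\<Sum>i<n. cnj (u j i) * v k i) = cnj (\<Sum>i<n. cnj (v k i) * u j i)"
        by (simp add: mult.commute)
      then show ?thesis unfolding w_def by (metis complex_mod_cnj)
    qed
    then show ?thesis
      using parseval[of n v "u j", OF eigenbasis_complete[OF b]] unorm[OF that] by simp
  qed
  \<comment> \<open>Between the two bases the difference of the kernels acts as multiplication by
    the eigenvalue gap. Parseval in both indices then turns the weighted squared gaps into the
    Hilbert-Schmidt norm.\<close>
  have inner: "(\<Sum>i<n. cnj (u j i) * (\<Sum>l<n. (a i l - b i l) * v k l))
      = of_real (lam j - mu k) * (\<Sum>i<n. cnj (u j i) * v k i)" if "j < n" "k < n" for j k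
  proof -
    have "(\<Sum>i<n. cnj (u j i) * (\<Sum>l<n. a i l * v k l)) = (\<Sum>l<n. (\<Sum>i<n. cnj (u j i) * a i l) * v k l)"
      unfolding sum_distrib_left sum_distrib_right by (subst sum.swap) (simp add: mult_ac)
    also have "\<dots> = of_real (lam j) * (\<Sum>i<n. cnj (u j i) * v k i)"
      using eigenbasis_left[OF a _ that(1)] by (simp add: sum_distrib_left mult.assoc)
    finally have 1: "(\<Sum>i<n. cnj (u j i) * (\<Sum>l<n. a i l * v k l)) = of_real (lam j) * (\<Sum>i<n. cnj (u j i) * v k i)" .
    have 2: "(\<Sum>i<n. cnj (u j i) * (\<Sum>l<n. b i l * v k l)) = of_real (mu k) * (\<Sum>i<n. cnj (u j i) * v k i)"
      using eigenbasis_right[OF b _ that(2)] by (simp add: sum_distrib_left mult_ac)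
    show ?thesis
      using 1 2 by (simp add: left_diff_distrib right_diff_distrib sum_subtractf)
  qed
  have cost: "(\<Sum>k<n. \<Sum>j<n. w j k * (lam j - mu k)\<^sup>2) = (\<Sum>i<n. \<Sum>l<n. (cmod (a i l - b i l))\<^sup>2)"
  proof -
    have "(\<Sum>k<n. \<Sum>j<n. w j k * (lam j - mu k)\<^sup>2)
       = (\<Sum>k<n. \<Sum>j<n. (cmod (\<Sum>i<n. cnj (u j i) * (\<Sum>l<n. (a i l - b i l) * v k l)))\<^sup>2)"
    proof (intro sum.cong refl)
      fix k j assume "k \<in> {..<n}" "j \<in> {..<n}"
      then have *: "j < n" "k < n" by auto
      show "w j k * (lam j - mu k)\<^sup>2 = (cmod (\<Sum>i<n. cnj (u j i) * (\<Sum>l<n. (a i l - b i l) * v k l)))\<^sup>2"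
        unfolding inner[OF *] norm_mult power_mult_distrib w_def norm_of_real power2_abs by (rule mult.commute)
    qed
    also have "\<dots> = (\<Sum>k<n. \<Sum>i<n. (cmod (\<Sum>l<n. (a i l - b i l) * v k l))\<^sup>2)"
      by (intro sum.cong refl parseval eigenbasis_complete[OF a])
    also have "\<dots> = (\<Sum>i<n. \<Sum>k<n. (cmod (\<Sum>l<n. cnj (v k l) * cnj (a i l - b i l)))\<^sup>2)"
    proof (subst sum.swap, intro sum.cong refl)
      fix i k
      have "(\<Sum>l<n. (a i l - b i l) * v k l) = cnj (\<Sum>l<n. cnj (v k l) * cnj (a i l - b i l))"
        by (simp add: mult.commute)
      then show "(cmod (\<Sum>l<n. (a i l - b i l) * v k l))\<^sup>2 = (cmod (\<Sum>l<n. cnj (v k l) * cnj (a i l - b i l)))\<^sup>2"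
        by (metis complex_mod_cnj)
    qed
    also have "\<dots> = (\<Sum>i<n. \<Sum>l<n. (cmod (cnj (a i l - b i l)))\<^sup>2)"
      by (intro sum.cong refl parseval eigenbasis_complete[OF b])
    finally show ?thesis by (simp only: complex_mod_cnj)
  qed
  have "(\<Sum>j<n. f (lam j)) - (\<Sum>j<n. f (mu j)) = (\<Sum>k<n. \<Sum>j<n. of_real (w j k) * (f (lam j) - f (mu k)))"
  proof -
    have "(\<Sum>k<n. \<Sum>j<n. of_real (w j k) * f (lam j)) = (\<Sum>j<n. of_real (\<Sum>k<n. w j k) * f (lam j))"
      by (subst sum.swap) (simp add: sum_distrib_right)
    moreover have "(\<Sum>k<n. \<Sum>j<n. of_real (w j k) * f (mu k)) = (\<Sum>k<n. of_real (\<Sum>j<n. w j k) * f (mu k))"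
      by (simp add: sum_distrib_right)
    ultimately show ?thesis by (simp add: wrow wcol right_diff_distrib sum_subtractf del: of_real_sum)
  qed
  also have "cmod \<dots> \<le> (\<Sum>k<n. \<Sum>j<n. w j k * (L * \<bar>lam j - mu k\<bar>))"
    by (intro order.trans[OF norm_sum] sum_mono) (simp add: norm_mult w0 mult_left_mono f)
  \<comment> \<open>The weight is split into two square roots for Cauchy-Schwarz: one factor carries
    the total mass \<open>n\<close>, the other the quadratic cost.\<close>
  also have "\<dots> = (\<Sum>k<n. \<Sum>j<n. L * (sqrt (w j k) * (sqrt (w j k) * \<bar>lam j - mu k\<bar>)))"
  proof (intro sum.cong refl)
    fix j k
    have "w j k = sqrt (w j k) * sqrt (w j k)" using w0 by simp
    then show "w j k * (L * \<bar>lam j - mu k\<bar>) = L * (sqrt (w j k) * (sqrt (w j k) * \<bar>lam j - mu k\<bar>))"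
      by (metis mult.assoc mult.left_commute)
  qed
  also have "\<dots> = L * (\<Sum>p\<in>{..<n} \<times> {..<n}. sqrt (w (snd p) (fst p)) * (sqrt (w (snd p) (fst p)) * \<bar>lam (snd p) - mu (fst p)\<bar>))"
    by (simp only: sum.cartesian_product sum_distrib_left) (simp add: split_beta)
  also have "(\<Sum>p\<in>{..<n} \<times> {..<n}. sqrt (w (snd p) (fst p)) * (sqrt (w (snd p) (fst p)) * \<bar>lam (snd p) - mu (fst p)\<bar>))
     \<le> L2_set (\<lambda>p. sqrt (w (snd p) (fst p))) ({..<n} \<times> {..<n})
       * L2_set (\<lambda>p. sqrt (w (snd p) (fst p)) * \<bar>lam (snd p) - mu (fst p)\<bar>) ({..<n} \<times> {..<n})"
    using L2_set_mult_ineq[of "\<lambda>p. sqrt (w (snd p) (fst p))" "\<lambda>p. sqrt (w (snd p) (fst p)) * \<bar>lam (snd p) - mu (fst p)\<bar>"]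
    by (simp add: abs_mult w0)
  also have "L2_set (\<lambda>p. sqrt (w (snd p) (fst p))) ({..<n} \<times> {..<n}) = sqrt (\<Sum>k<n. \<Sum>j<n. w j k)"
    by (simp add: L2_set_def sum.cartesian_product split_beta w0)
  also have "(\<Sum>k<n. \<Sum>j<n. w j k) = real n" using wcol by simp
  also have "L2_set (\<lambda>p. sqrt (w (snd p) (fst p)) * \<bar>lam (snd p) - mu (fst p)\<bar>) ({..<n} \<times> {..<n})
     = sqrt (\<Sum>k<n. \<Sum>j<n. w j k * (lam j - mu k)\<^sup>2)"
    by (simp add: L2_set_def sum.cartesian_product split_beta w0 power_mult_distrib)
  finally show ?thesis using L by (simp add: cost mult.assoc mult_left_mono)
qed

text \<open>Unit vectors with eigenvalue 0 complete the basis of the zero-padded kernel. This makes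
  spectra of different sizes comparable within one dimension.\<close>

lemma eigenbasis_embed:
  assumes e: "eigenbasis m b v mu" and "m \<le> n"
  shows "eigenbasis n (\<lambda>i l. if i < m \<and> l < m then b i l else 0)
    (\<lambda>j i. if j < m \<and> i < m then v j i else of_bool (i = j)) (\<lambda>j. if j < m then mu j else 0)"
proof -
  let ?v = "\<lambda>j i. if j < m \<and> i < m then v j i else of_bool (i = j)"
  have split: "(\<Sum>i<n. g i) = (\<Sum>i<m. g i) + (\<Sum>i=m..<n. g i)" for g :: "nat \<Rightarrow> complex"
    using \<open>m \<le> n\<close> by (metis lessThan_atLeast0 sum.atLeastLessThan_concat zero_le)
  have 1: "(\<Sum>i<n. ?v j i * cnj (?v j' i)) = of_bool (j = j')" if "j < n" "j' < n" for j j'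
  proof -
    have "(\<Sum>i<m. ?v j i * cnj (?v j' i)) = (\<Sum>i<m. if j < m \<and> j' < m then v j i * cnj (v j' i) else 0)"
      by (intro sum.cong) auto
    also have "\<dots> = of_bool (j = j' \<and> j < m)" using eigenbasis_orth[OF e, of j j'] by (cases "j < m \<and> j' < m") auto
    moreover have "(\<Sum>i=m..<n. ?v j i * cnj (?v j' i)) = (\<Sum>i=m..<n. if i = j then of_bool (j = j') else 0)"
      by (intro sum.cong) auto
    ultimately show ?thesis using that by (auto simp: split)
  qed
  have 2: "(\<Sum>j<n. ?v j i * cnj (?v j l)) = of_bool (i = l)" if "i < n" "l < n" for i l
  proof -
    have "(\<Sum>j<m. ?v j i * cnj (?v j l)) = (\<Sum>j<m. if i < m \<and> l < m then v j i * cnj (v j l) else 0)"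
      by (intro sum.cong) auto
    also have "\<dots> = of_bool (i = l \<and> i < m)" using eigenbasis_complete[OF e, of i l] by (cases "i < m \<and> l < m") auto
    moreover have "(\<Sum>j=m..<n. ?v j i * cnj (?v j l)) = (\<Sum>j=m..<n. if j = i then of_bool (i = l) else 0)"
      by (intro sum.cong) auto
    ultimately show ?thesis using that by (auto simp: split)
  qed
  have 3: "(if i < m \<and> l < m then b i l else 0)
      = (\<Sum>j<n. of_real (if j < m then mu j else 0) * ?v j i * cnj (?v j l))" if "i < n" "l < n" for i l
  proof -
    have "(\<Sum>j<m. of_real (if j < m then mu j else 0) * ?v j i * cnj (?v j l))
      = (\<Sum>j<m. if i < m \<and> l < m then of_real (mu j) * v j i * cnj (v j l) else 0)"
      by (intro sum.cong) auto
    also have "\<dots> = (if i < m \<and> l < m then b i l else 0)" using eigenbasis_kernel[OF e, of i l] by (cases "i < m \<and> l < m") auto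
    moreover have "(\<Sum>j=m..<n. of_real (if j < m then mu j else 0) * ?v j i * cnj (?v j l)) = 0"
      by (intro sum.neutral) auto
    ultimately show ?thesis by (simp only: split) simp
  qed
  show ?thesis unfolding eigenbasis_def using 1 2 3 by blast
qed

section \<open>Spectral distributions\<close>

text \<open>The factor \<open>c\<close> serves two uses: 1 for a symmetric matrix, and
  \<open>- \<i>\<close> to return from the Hermitian kernel of \<open>\<i>\<close> times
  \<open>A\<close> to a skew-symmetric \<open>A\<close>.\<close>

lemma char_poly_eigenbasis:
  assumes e: "eigenbasis n a u lam"
  shows "char_poly (Matrix.mat n n (\<lambda>(i, l). c * a i l)) = (\<Prod>j\<leftarrow>[0..<n]. [:- (c * of_real (lam j)), 1:])"
proof -
  define P where "P = Matrix.mat n n (\<lambda>(i, j). u j i)"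
  define Q where "Q = Matrix.mat n n (\<lambda>(j, i). cnj (u j i))"
  define D where "D = Matrix.mat n n (\<lambda>(j, j'). if j = j' then c * of_real (lam j) else 0)"
  let ?A = "Matrix.mat n n (\<lambda>(i, l). c * a i l)"
  have carr: "P \<in> carrier_mat n n" "Q \<in> carrier_mat n n" "D \<in> carrier_mat n n" by (auto simp: P_def Q_def D_def)
  have PQ: "P * Q = 1\<^sub>m n"
    using eigenbasis_complete[OF e]
    by (intro eq_matI) (auto simp: P_def Q_def scalar_prod_def atLeast0LessThan)
  have QP: "Q * P = 1\<^sub>m n"
    using mat_mult_left_right_inverse[OF carr(1,2) PQ] .
  have PD: "(P * D) $$ (i, j) = c * of_real (lam j) * u j i" if "i < n" "j < n" for i j
    using that by (simp add: P_def D_def scalar_prod_def atLeast0LessThan if_distrib if_distribR cong: if_cong)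
  have "?A = P * D * Q"
  proof (rule eq_matI)
    fix i l assume "i < dim_row (P * D * Q)" "l < dim_col (P * D * Q)"
    then have il: "i < n" "l < n" using carr by auto
    have "(P * D * Q) $$ (i, l) = (\<Sum>j<n. (P * D) $$ (i, j) * Q $$ (j, l))"
      using il carr by (simp add: scalar_prod_def atLeast0LessThan del: assoc_mult_mat)
    also have "\<dots> = (\<Sum>j<n. c * of_real (lam j) * u j i * cnj (u j l))"
      using il by (intro sum.cong) (auto simp: PD Q_def)
    also have "\<dots> = c * a i l"
      unfolding eigenbasis_kernel[OF e il] by (simp add: sum_distrib_left mult.assoc)
    finally show "?A $$ (i, l) = (P * D * Q) $$ (i, l)" using il by simp
  qed (use carr in auto)
  then have "similar_mat_wit ?A D P Q"
    by (rule similar_mat_witI[OF PQ QP _ _ carr(3,1,2)]) simp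
  then have "similar_mat ?A D" unfolding similar_mat_def by blast
  then have "char_poly ?A = char_poly D" by (rule char_poly_similar)
  also have "\<dots> = (\<Prod>a\<leftarrow>diag_mat D. [:- a, 1:])"
    by (rule char_poly_upper_triangular[OF carr(3)]) (auto simp: D_def)
  also have "diag_mat D = map (\<lambda>j. c * of_real (lam j)) [0..<n]"
    by (auto simp: diag_mat_def D_def)
  finally show ?thesis by (simp add: o_def)
qed

lemma proots_linear_factors:
  fixes z :: "nat \<Rightarrow> 'a :: idom"
  shows "proots (\<Prod>j\<leftarrow>[0..<n]. [:- z j, 1:]) = mset (map z [0..<n])"
proof -
  have *: "xs \<noteq> [] \<or> xs = [] \<Longrightarrow> proots (\<Prod>j\<leftarrow>xs. [:- z j, 1:]) = mset (map z xs)" for xs :: "nat list"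
  proof (induction xs)
    case (Cons k xs)
    have "(\<Prod>j\<leftarrow>xs. [:- z j, 1:]) \<noteq> 0" by (auto simp: prod_list_zero_iff)
    then have "proots ([:- z k, 1:] * (\<Prod>j\<leftarrow>xs. [:- z j, 1:])) = {#z k#} + mset (map z xs)"
      using Cons by (subst proots_mult) auto
    then show ?case by simp
  qed auto
  show ?thesis by (rule *) auto
qed

lemma size_filter_mset_map_upt:
  "size (filter_mset P (mset (map z [0..<n]))) = card {j. j < n \<and> P (z j)}"
proof -
  have "size (filter_mset P (mset (map z [0..<n]))) = length (filter P (map z [0..<n]))"
    by (metis mset_filter size_mset)
  also have "\<dots> = card {j. j < n \<and> P (z j)}"
    unfolding length_filter_conv_card by (intro arg_cong[where f = card]) auto
  finally show ?thesis .
qed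

text \<open>The factorisation is found over the complex numbers and descends coefficientwise, as the
  embedding of the reals is injective.\<close>

lemma esd_symmetric_eigenbasis:
  assumes A: "A \<in> carrier_mat n n"
    and e: "eigenbasis n (\<lambda>i l. complex_of_real (A $$ (i, l))) u lam"
  shows "esd_symmetric A x = real (card {j. j < n \<and> lam j \<le> x}) / real n"
proof -
  have "map_mat complex_of_real A = Matrix.mat n n (\<lambda>(i, l). 1 * complex_of_real (A $$ (i, l)))"
    using A by auto
  then have "char_poly (map_mat complex_of_real A) = (\<Prod>j\<leftarrow>[0..<n]. [:- (1 * complex_of_real (lam j)), 1:])"
    using char_poly_eigenbasis[OF e, of 1] by simp
  moreover have "char_poly (map_mat complex_of_real A) = map_poly complex_of_real (char_poly A)"
    by (rule of_real_hom.char_poly_hom[OF A])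
  moreover have "map_poly complex_of_real (\<Prod>j\<leftarrow>xs. [:- lam j, 1:]) = (\<Prod>j\<leftarrow>xs. [:- complex_of_real (lam j), 1:])" for xs
  proof (induction xs)
    case (Cons k xs)
    have "map_poly complex_of_real (p * q) = map_poly complex_of_real p * map_poly complex_of_real q" for p q
      by (simp add: poly_eq_iff coeff_map_poly coeff_mult)
    from this[of "[:- lam k, 1:]" "\<Prod>j\<leftarrow>xs. [:- lam j, 1:]"] show ?case
      using Cons by (simp add: map_poly_pCons del: mult_pCons_left)
  qed simp
  ultimately have "map_poly complex_of_real (char_poly A) = map_poly complex_of_real (\<Prod>j\<leftarrow>[0..<n]. [:- lam j, 1:])"
    by simp
  then have "char_poly A = (\<Prod>j\<leftarrow>[0..<n]. [:- lam j, 1:])"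
    by (simp add: poly_eq_iff coeff_map_poly)
  then show ?thesis using A
    unfolding esd_symmetric_def by (simp only: proots_linear_factors size_filter_mset_map_upt) auto
qed

text \<open>The eigenvalues of \<open>A\<close> are \<open>- \<i> * lam j\<close>, and the factor
  \<open>\<i>\<close> in \<open>esd_skew\<close> returns \<open>lam j\<close> itself, so the
  spectrum is not reflected.\<close>

lemma esd_skew_eigenbasis:
  assumes A: "A \<in> carrier_mat n n"
    and e: "eigenbasis n (\<lambda>i l. \<i> * complex_of_real (A $$ (i, l))) u lam"
  shows "esd_skew A x = real (card {j. j < n \<and> lam j \<le> x}) / real n"
proof -
  have "map_mat complex_of_real A = Matrix.mat n n (\<lambda>(i, l). - \<i> * (\<i> * complex_of_real (A $$ (i, l))))"
    using A by auto
  then have *: "char_poly (map_mat complex_of_real A) = (\<Prod>j\<leftarrow>[0..<n]. [:- (- \<i> * complex_of_real (lam j)), 1:])"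
    using char_poly_eigenbasis[OF e, of "- \<i>"] by simp
  show ?thesis using A
    unfolding esd_skew_def * proots_linear_factors size_filter_mset_map_upt by simp
qed

text \<open>The normalised counting measure of a list of eigenvalues; as a push-forward it adds up
  the mass of repeated ones. At \<open>n = 0\<close> the underlying pmf is unspecified but still a
  probability, so this is a distribution for every \<open>n\<close>.\<close>

definition counting_distr :: "nat \<Rightarrow> (nat \<Rightarrow> real) \<Rightarrow> real measure" where
  "counting_distr n lam = distr (measure_pmf (pmf_of_set {..<n})) borel lam"

lemma real_distribution_counting_distr: "real_distribution (counting_distr n lam)"
  unfolding real_distribution_def real_distribution_axioms_def counting_distr_def
  by (auto intro!: measure_pmf.prob_space_distr)

lemma cdf_counting_distr:
  assumes "n > 0"
  shows "cdf (counting_distr n lam) x = real (card {j. j < n \<and> lam j \<le> x}) / real n"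
proof -
  have "cdf (counting_distr n lam) x = measure (measure_pmf (pmf_of_set {..<n})) {j. lam j \<le> x}"
    unfolding cdf_def counting_distr_def by (subst measure_distr) (auto simp: vimage_def)
  also have "\<dots> = real (card ({..<n} \<inter> {j. lam j \<le> x})) / real n"
    using assms by (subst measure_pmf_of_set) auto
  also have "{..<n} \<inter> {j. lam j \<le> x} = {j. j < n \<and> lam j \<le> x}" by auto
  finally show ?thesis .
qed

lemma integral_counting_distr:
  fixes f :: "real \<Rightarrow> 'b :: {banach, second_countable_topology}"
  assumes "n > 0" and [measurable]: "f \<in> borel_measurable borel"
  shows "integral\<^sup>L (counting_distr n lam) f = (\<Sum>j<n. f (lam j)) /\<^sub>R real n"
    and "integrable (counting_distr n lam) f"
proof -
  have "integral\<^sup>L (counting_distr n lam) f = (\<Sum>j<n. pmf (pmf_of_set {..<n}) j *\<^sub>R f (lam j))"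
    unfolding counting_distr_def using assms
    by (subst integral_distr, simp, simp, subst integral_measure_pmf[of "{..<n}"])
      (auto simp: set_pmf_of_set lessThan_empty_iff pmf_of_set)
  also have "\<dots> = (\<Sum>j<n. (1 / real n) *\<^sub>R f (lam j))"
    using assms by (intro sum.cong) (auto simp: pmf_of_set lessThan_empty_iff)
  finally show "integral\<^sup>L (counting_distr n lam) f = (\<Sum>j<n. f (lam j)) /\<^sub>R real n"
    by (simp add: scaleR_right.sum divide_inverse)
  have "finite (set_pmf (pmf_of_set {..<n}))" using assms by (auto simp: set_pmf_of_set lessThan_empty_iff)
  then show "integrable (counting_distr n lam) f"
    unfolding counting_distr_def by (subst integrable_distr_eq) (auto intro: integrable_measure_pmf_finite)
qed

lemma char_counting_distr:
  assumes "n > 0"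
  shows "char (counting_distr n lam) t = (\<Sum>j<n. iexp (t * lam j)) / of_nat n"
  unfolding char_def using integral_counting_distr(1)[OF assms, of "\<lambda>x. iexp (t * x)" lam]
  by (simp add: scaleR_conv_of_real divide_inverse mult.commute)

section \<open>Counting steps with repeated absolute values\<close>

text \<open>The index set is arbitrary because the variance estimate joins two walks over
  \<open>nat + nat\<close>.\<close>

definition steps :: "'i set \<Rightarrow> nat \<Rightarrow> ('i \<Rightarrow> int) set" where
  "steps J n = J \<rightarrow>\<^sub>E {- int n..int n}"

text \<open>The number of free parameters of a step function up to signs. The value 0 carries no
  freedom, so steps can be erased by setting them to 0.\<close>

definition nvals :: "'i set \<Rightarrow> ('i \<Rightarrow> int) \<Rightarrow> nat" where
  "nvals J s = card ((\<lambda>j. \<bar>s j\<bar>) ` J - {0})"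

text \<open>The configurations that can survive in expectation: a value occurring once contributes
  the mean of one input, which is 0.\<close>

definition no_single :: "'i set \<Rightarrow> ('i \<Rightarrow> int) \<Rightarrow> bool" where
  "no_single J s \<longleftrightarrow> (\<forall>j\<in>J. \<exists>i\<in>J. i \<noteq> j \<and> \<bar>s i\<bar> = \<bar>s j\<bar>)"

text \<open>Injectivity makes the partner of an index unique, so each absolute value occurs exactly
  twice and the inputs enter only through their variances.\<close>

definition opposite_paired :: "'i set \<Rightarrow> ('i \<Rightarrow> int) \<Rightarrow> bool" where
  "opposite_paired J s \<longleftrightarrow> inj_on s J \<and> (\<forall>j\<in>J. s j \<noteq> 0 \<and> - s j \<in> s ` J)"

lemma finite_steps [simp, intro]: "finite J \<Longrightarrow> finite (steps J n)"
  by (auto simp: steps_def intro: finite_PiE)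

text \<open>Coding argument: \<open>h\<close> stores for each index the sign and the rank of the
  absolute value, at most \<open>2 * r + 1\<close> options, and \<open>g\<close> lists the values,
  padded by 0 to length \<open>r\<close>, with \<open>n + 1\<close> options each.\<close>

lemma card_steps_few_values:
  assumes "finite J"
  shows "card {s \<in> steps J n. nvals J s \<le> r} \<le> (2 * r + 1) ^ card J * (n + 1) ^ r"
proof -
  define F :: "('a \<Rightarrow> int) \<times> (nat \<Rightarrow> int) \<Rightarrow> 'a \<Rightarrow> int"
    where "F = (\<lambda>(h, g). \<lambda>j\<in>J. sgn (h j) * g (nat \<bar>h j\<bar> - 1))"
  let ?D = "(J \<rightarrow>\<^sub>E {- int r..int r}) \<times> ({..<r} \<rightarrow>\<^sub>E {0..int n})"
  have "{s \<in> steps J n. nvals J s \<le> r} \<subseteq> F ` ?D"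
  proof
    fix s assume "s \<in> {s \<in> steps J n. nvals J s \<le> r}"
    then have s: "s \<in> J \<rightarrow>\<^sub>E {- int n..int n}" and r: "nvals J s \<le> r" by (auto simp: steps_def)
    define V where "V = (\<lambda>j. \<bar>s j\<bar>) ` J - {0}"
    have V: "finite V" "card V \<le> r" using assms r by (auto simp: V_def nvals_def)
    have Vn: "v \<in> {0..int n}" if vV: "v \<in> V" for v
    proof -
      obtain j where j: "j \<in> J" "v = \<bar>s j\<bar>" using vV by (auto simp: V_def)
      then have "s j \<in> {- int n..int n}" using PiE_mem[OF s] by blast
      then show ?thesis using j by auto
    qed
    obtain e where e: "bij_betw e {0..<card V} V" using ex_bij_betw_nat_finite[OF V(1)] by blast
    define g where "g = (\<lambda>i\<in>{..<r}. if i < card V then e i else 0)"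
    define idx where "idx = inv_into {0..<card V} e"
    have idx: "idx v < card V" "e (idx v) = v" if "v \<in> V" for v
      using that e bij_betw_inv_into_right[OF e that] bij_betwE[OF bij_betw_inv_into[OF e]]
      by (auto simp: idx_def)
    \<comment> \<open>Ranks are shifted by 1 so that the code 0 is reserved for the step 0, which is
      not listed in \<open>V\<close>.\<close>
    define h where "h = (\<lambda>j\<in>J. sgn (s j) * (if s j = 0 then 0 else int (idx \<bar>s j\<bar>) + 1))"
    have sV: "\<bar>s j\<bar> \<in> V" if "j \<in> J" "s j \<noteq> 0" for j using that by (auto simp: V_def)
    have "g \<in> {..<r} \<rightarrow>\<^sub>E {0..int n}"
      using Vn bij_betwE[OF e] by (auto simp: g_def)
    moreover have "h \<in> J \<rightarrow>\<^sub>E {- int r..int r}"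
    proof -
      have "\<bar>h j\<bar> \<le> int r" if "j \<in> J" for j
        using idx(1)[OF sV[OF that]] V(2) that by (auto simp: h_def abs_mult abs_sgn_eq)
      then have "h j \<in> {- int r..int r}" if "j \<in> J" for j using that by (fastforce simp: abs_le_iff)
      then show ?thesis by (intro PiE_I) (simp_all add: h_def)
    qed
    moreover have "F (h, g) = s"
    proof
      fix j
      show "F (h, g) j = s j"
      proof (cases "j \<in> J \<and> s j \<noteq> 0")
        case True
        then have 1: "idx \<bar>s j\<bar> < card V" "e (idx \<bar>s j\<bar>) = \<bar>s j\<bar>" using idx sV by auto
        have 2: "\<bar>h j\<bar> = int (idx \<bar>s j\<bar>) + 1" "sgn (h j) = sgn (s j)"
          using True by (auto simp: h_def abs_mult sgn_mult)
        have "nat \<bar>h j\<bar> - 1 = idx \<bar>s j\<bar>" using 2 by simp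
        moreover have "idx \<bar>s j\<bar> < r" using 1(1) V(2) by linarith
        ultimately have gs: "g (nat \<bar>h j\<bar> - 1) = \<bar>s j\<bar>" using 1 by (simp only: g_def) simp
        have "F (h, g) j = sgn (h j) * g (nat \<bar>h j\<bar> - 1)" using True by (simp only: F_def) simp
        then show ?thesis unfolding gs 2(2) sgn_mult_abs .
      next
        case False
        then consider "j \<notin> J" | "j \<in> J" "s j = 0" by blast
        then show ?thesis
        proof cases
          case 1
          then show ?thesis using PiE_arb[OF s] by (simp add: F_def)
        next
          case 2
          then show ?thesis by (simp add: F_def h_def)
        qed
      qed
    qed
    ultimately show "s \<in> F ` ?D" by (metis SigmaI image_eqI)
  qed
  moreover have "finite ?D" using assms by (auto intro!: finite_PiE)
  ultimately have "card {s \<in> steps J n. nvals J s \<le> r} \<le> card ?D"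
    by (meson card_image_le card_mono finite_imageI order.trans)
  also have "card ?D = (2 * r + 1) ^ card J * (n + 1) ^ r"
    using assms by (simp add: card_cartesian_product card_PiE nat_add_distrib nat_mult_distrib)
  finally show ?thesis .
qed

text \<open>A linear relation which involves the value \<open>\<bar>s a\<bar> = \<bar>s b\<bar>\<close> nontrivially determines it, so that
  one degree of freedom is lost.\<close>

lemma card_steps_linked:
  assumes "finite J" "H \<subseteq> J"
  shows "card {s \<in> steps J n. sum s H = 0 \<and> (\<exists>a\<in>H. \<exists>b\<in>J. a \<noteq> b \<and> (b \<notin> H \<and> \<bar>s a\<bar> = \<bar>s b\<bar> \<or> s a = s b)
             \<and> nvals J (s(a := 0, b := 0)) \<le> r)}
         \<le> 2 * (card J)\<^sup>2 * ((2 * r + 1) ^ card J * (n + 1) ^ r)"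
proof -
  define S where "S = (\<lambda>(a, b, e). {s \<in> steps J n. sum s H = 0 \<and> a \<in> H \<and> b \<in> J \<and> a \<noteq> b \<and> s b = e * s a \<and>
      (b \<notin> H \<or> e = 1) \<and> nvals J (s(a := 0, b := 0)) \<le> r})"
  let ?I = "J \<times> J \<times> {1, -1 :: int}"
  let ?T = "{s \<in> steps J n. nvals J s \<le> r}"
  have card_S: "card (S p) \<le> card ?T" for p
  proof (cases p)
    case (fields a b e)
    \<comment> \<open>The entries other than \<open>a\<close> and \<open>b\<close> are kept, so the
      relation over \<open>H\<close> determines \<open>s a\<close> if \<open>b\<close> lies outside
      \<open>H\<close>, and \<open>2 * s a\<close> if both lie inside with equal sign. Opposite
      signs inside \<open>H\<close> would cancel, which is why \<open>e = 1\<close> is required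
      there.\<close>
    have "inj_on (\<lambda>s. s(a := 0, b := 0)) (S p)"
    proof (rule inj_onI)
      fix s s' assume s: "s \<in> S p" and s': "s' \<in> S p" and eq: "s(a := 0, b := 0) = s'(a := 0, b := 0)"
      have off: "s j = s' j" if "j \<noteq> a" "j \<noteq> b" for j
      proof -
        have "(s(a := 0, b := 0)) j = (s'(a := 0, b := 0)) j" by (rule fun_cong[OF eq])
        then show ?thesis using that by simp
      qed
      have aH: "a \<in> H" and ab: "a \<noteq> b" and be: "b \<notin> H \<or> e = 1"
        and sb: "s b = e * s a" "s' b = e * s' a" and sums: "sum s H = 0" "sum s' H = 0"
        using s s' by (auto simp: S_def fields)
      have fin: "finite H" using assms finite_subset by auto
      have dec: "sum t H = t a + (if b \<in> H then t b else 0) + sum t (H - {a, b})" for t :: "'a \<Rightarrow> int"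
      proof -
        have "sum t H = t a + sum t (H - {a})" using fin aH by (rule sum.remove)
        moreover have "sum t (H - {a}) = (if b \<in> H then t b else 0) + sum t (H - {a, b})"
        proof (cases "b \<in> H")
          case True
          have "sum t (H - {a}) = t b + sum t (H - {a} - {b})"
            using fin ab True by (intro sum.remove) auto
          moreover have "H - {a} - {b} = H - {a, b}" by auto
          ultimately show ?thesis using True by simp
        next
          case False
          then have "H - {a} = H - {a, b}" by auto
          then show ?thesis using False by simp
        qed
        ultimately show ?thesis by simp
      qed
      have "sum s (H - {a, b}) = sum s' (H - {a, b})" using off by (intro sum.cong) auto
      then have "s a + (if b \<in> H then s b else 0) = s' a + (if b \<in> H then s' b else 0)"
        using dec[of s] dec[of s'] sums by simp
      then have "s a = s' a" using sb be by (auto split: if_splits)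
      then show "s = s'" using off sb by (metis ext)
    qed
    moreover have "(\<lambda>s. s(a := 0, b := 0)) ` S p \<subseteq> ?T"
      using \<open>H \<subseteq> J\<close> by (auto simp: S_def fields steps_def PiE_iff extensional_def)
    ultimately show ?thesis using assms(1) by (intro card_inj_on_le[where f = "\<lambda>s. s(a := 0, b := 0)"]) auto
  qed
  have "{s \<in> steps J n. sum s H = 0 \<and> (\<exists>a\<in>H. \<exists>b\<in>J. a \<noteq> b \<and> (b \<notin> H \<and> \<bar>s a\<bar> = \<bar>s b\<bar> \<or> s a = s b)
             \<and> nvals J (s(a := 0, b := 0)) \<le> r)} \<subseteq> (\<Union>p\<in>?I. S p)"
  proof
    fix s assume "s \<in> {s \<in> steps J n. sum s H = 0 \<and> (\<exists>a\<in>H. \<exists>b\<in>J. a \<noteq> b \<and> (b \<notin> H \<and> \<bar>s a\<bar> = \<bar>s b\<bar> \<or> s a = s b)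
             \<and> nvals J (s(a := 0, b := 0)) \<le> r)}"
    then obtain a b where s: "s \<in> steps J n" "sum s H = 0" "a \<in> H" "b \<in> J" "a \<noteq> b"
      "b \<notin> H \<and> \<bar>s a\<bar> = \<bar>s b\<bar> \<or> s a = s b" "nvals J (s(a := 0, b := 0)) \<le> r" by blast
    show "s \<in> (\<Union>p\<in>?I. S p)"
    proof (cases "s a = s b")
      case True
      then have "s \<in> S (a, b, 1)" using s by (auto simp: S_def)
      then show ?thesis using s \<open>H \<subseteq> J\<close> by blast
    next
      case False
      then have "s \<in> S (a, b, -1)" using s by (auto simp: S_def abs_eq_iff)
      then show ?thesis using s \<open>H \<subseteq> J\<close> by blast
    qed
  qed
  moreover have "finite (\<Union>p\<in>?I. S p)" using assms(1) by (auto simp: S_def)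
  ultimately have "card {s \<in> steps J n. sum s H = 0 \<and> (\<exists>a\<in>H. \<exists>b\<in>J. a \<noteq> b \<and> (b \<notin> H \<and> \<bar>s a\<bar> = \<bar>s b\<bar> \<or> s a = s b)
             \<and> nvals J (s(a := 0, b := 0)) \<le> r)} \<le> card (\<Union>p\<in>?I. S p)"
    by (rule card_mono[rotated])
  also have "\<dots> \<le> (\<Sum>p\<in>?I. card (S p))" using assms(1) by (intro card_UN_le) auto
  also have "\<dots> \<le> (\<Sum>p\<in>?I. card ?T)" by (intro sum_mono card_S)
  also have "\<dots> = 2 * (card J)\<^sup>2 * card ?T"
    by (simp add: card_cartesian_product power2_eq_square)
  also have "\<dots> \<le> 2 * (card J)\<^sup>2 * ((2 * r + 1) ^ card J * (n + 1) ^ r)"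
    using card_steps_few_values[OF assms(1)] by (intro mult_left_mono) auto
  finally show ?thesis .
qed

text \<open>Every absolute value has a fibre of at least two indices, and the fibres partition
  \<open>J\<close>. Equality leaves no index for the value 0 and no fibre of size three.\<close>

lemma no_single_card_ge:
  assumes "finite J" "no_single J s"
  shows "2 * nvals J s \<le> card J"
    and "card J \<le> 2 * nvals J s \<Longrightarrow> j \<in> J \<Longrightarrow> s j \<noteq> 0"
    and "card J \<le> 2 * nvals J s \<Longrightarrow> j \<in> J \<Longrightarrow> card {i \<in> J. \<bar>s i\<bar> = \<bar>s j\<bar>} = 2"
proof -
  let ?f = "\<lambda>j. \<bar>s j\<bar>"
  define V where "V = ?f ` J - {0}"
  define fib where "fib y = card {i \<in> J. \<bar>s i\<bar> = y}" for y
  have finV: "finite V" using assms by (simp add: V_def)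
  have fib2: "2 \<le> fib y" if y: "y \<in> ?f ` J" for y
  proof -
    obtain j where j: "j \<in> J" "y = \<bar>s j\<bar>" using y by auto
    obtain i where i: "i \<in> J" "i \<noteq> j" "\<bar>s i\<bar> = \<bar>s j\<bar>" using assms(2) j by (auto simp: no_single_def)
    have "card {i, j} \<le> fib y" unfolding fib_def using assms(1) i j by (intro card_mono) auto
    then show ?thesis using i by simp
  qed
  have "card J = (\<Sum>y\<in>?f ` J. fib y)"
    using sum.image_gen[of J "\<lambda>_. 1 :: nat" ?f] assms(1) by (simp add: fib_def)
  also have "?f ` J = V \<union> (?f ` J \<inter> {0})" by (auto simp: V_def)
  also have "(\<Sum>y\<in>V \<union> (?f ` J \<inter> {0}). fib y) = (\<Sum>y\<in>V. fib y) + (\<Sum>y\<in>?f ` J \<inter> {0}. fib y)"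
    using finV by (intro sum.union_disjoint) (auto simp: V_def)
  finally have dec: "card J = (\<Sum>y\<in>V. fib y) + (\<Sum>y\<in>?f ` J \<inter> {0}. fib y)" .
  have ge: "(\<Sum>y\<in>V. fib y) \<ge> 2 * nvals J s"
    using sum_mono[of V "\<lambda>_. 2" fib] fib2 by (auto simp: V_def nvals_def)
  show "2 * nvals J s \<le> card J" using dec ge by linarith
  assume tight: "card J \<le> 2 * nvals J s" and j: "j \<in> J"
  have z: "(\<Sum>y\<in>?f ` J \<inter> {0}. fib y) = 0" and e: "(\<Sum>y\<in>V. fib y) = (\<Sum>y\<in>V. 2)"
    using dec ge tight by (auto simp: V_def nvals_def)
  show nz: "s j \<noteq> 0"
  proof
    assume "s j = 0"
    then have "0 \<in> ?f ` J" using j by force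
    then have "fib 0 = 0" using z by simp
    then show False using fib2[of 0] \<open>0 \<in> ?f ` J\<close> by simp
  qed
  have "fib \<bar>s j\<bar> = 2"
  proof (rule ccontr)
    assume "fib \<bar>s j\<bar> \<noteq> 2"
    have jV: "\<bar>s j\<bar> \<in> V" using j nz by (auto simp: V_def)
    then have "fib \<bar>s j\<bar> > 2" using fib2[of "\<bar>s j\<bar>"] \<open>fib \<bar>s j\<bar> \<noteq> 2\<close> by (auto simp: V_def)
    then have "(\<Sum>y\<in>V. 2) < (\<Sum>y\<in>V. fib y)"
      using finV jV fib2 by (intro sum_strict_mono_ex1) (auto simp: V_def)
    then show False using e by simp
  qed
  then show "card {i \<in> J. \<bar>s i\<bar> = \<bar>s j\<bar>} = 2" by (simp add: fib_def)
qed

text \<open>In the tight case the fibre of the common absolute value is exactly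
  \<open>{a, b}\<close>, so erasing the pair removes this one value and no other.\<close>

lemma nvals_erase_pair:
  assumes J: "finite J" "no_single J s" "card J \<le> 2 * nvals J s"
    and ab: "a \<in> J" "b \<in> J" "a \<noteq> b" "\<bar>s a\<bar> = \<bar>s b\<bar>"
  shows "nvals J (s(a := 0, b := 0)) + 1 = nvals J s"
proof -
  note t = no_single_card_ge[OF J(1,2)]
  have "card {i \<in> J. \<bar>s i\<bar> = \<bar>s a\<bar>} = 2" using t(3)[OF J(3)] ab by simp
  moreover have "{a, b} \<subseteq> {i \<in> J. \<bar>s i\<bar> = \<bar>s a\<bar>}" using ab by auto
  ultimately have fib: "{i \<in> J. \<bar>s i\<bar> = \<bar>s a\<bar>} = {a, b}"
    using J(1) ab by (metis (no_types, lifting) card_2_iff card_subset_eq finite_Collect_conjI finite_subset Collect_mem_eq mem_Collect_eq subsetI)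
  have "(\<lambda>j. \<bar>(s(a := 0, b := 0)) j\<bar>) ` J - {0} = ((\<lambda>j. \<bar>s j\<bar>) ` J - {0}) - {\<bar>s a\<bar>}"
  proof (intro equalityI subsetI)
    fix y assume "y \<in> (\<lambda>j. \<bar>(s(a := 0, b := 0)) j\<bar>) ` J - {0}"
    then obtain j where j: "j \<in> J" "j \<noteq> a" "j \<noteq> b" "y = \<bar>s j\<bar>" "y \<noteq> 0" by (auto split: if_splits)
    then have "j \<notin> {i \<in> J. \<bar>s i\<bar> = \<bar>s a\<bar>}" unfolding fib by simp
    then show "y \<in> ((\<lambda>j. \<bar>s j\<bar>) ` J - {0}) - {\<bar>s a\<bar>}" using j by auto
  next
    fix y assume "y \<in> ((\<lambda>j. \<bar>s j\<bar>) ` J - {0}) - {\<bar>s a\<bar>}"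
    then obtain j where j: "j \<in> J" "y = \<bar>s j\<bar>" "y \<noteq> 0" "y \<noteq> \<bar>s a\<bar>" by auto
    then have "j \<noteq> a" "j \<noteq> b" using ab by auto
    then show "y \<in> (\<lambda>j. \<bar>(s(a := 0, b := 0)) j\<bar>) ` J - {0}" using j by (auto intro!: image_eqI[of _ _ j])
  qed
  moreover have "\<bar>s a\<bar> \<in> (\<lambda>j. \<bar>s j\<bar>) ` J - {0}" using t(2)[OF J(3) ab(1)] ab by auto
  ultimately show ?thesis unfolding nvals_def
    using J(1) by (metis (no_types, lifting) Suc_eq_plus1 card_Suc_Diff1 finite_Diff finite_imageI)
qed

text \<open>Either there are fewer than \<open>card J / 2\<close> values, or every value occurs
  exactly twice and some pair has equal signs; then the closing relation contains
  \<open>2 * s a\<close> and costs a parameter. For nonempty \<open>J\<close> the exponent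
  \<open>r\<close> is the largest integer below \<open>card J / 2\<close>, for both
  parities.\<close>

lemma card_not_opposite_paired:
  assumes J: "finite J"
  defines "r \<equiv> (card J - 1) div 2"
  shows "card {s \<in> steps J n. no_single J s \<and> sum s J = 0 \<and> \<not> opposite_paired J s}
    \<le> (1 + 2 * (card J)\<^sup>2) * ((2 * r + 1) ^ card J * (n + 1) ^ r)"
proof -
  let ?A = "{s \<in> steps J n. nvals J s \<le> r}"
  let ?B = "{s \<in> steps J n. sum s J = 0 \<and> (\<exists>a\<in>J. \<exists>b\<in>J. a \<noteq> b \<and> (b \<notin> J \<and> \<bar>s a\<bar> = \<bar>s b\<bar> \<or> s a = s b)
             \<and> nvals J (s(a := 0, b := 0)) \<le> r)}"
  have "{s \<in> steps J n. no_single J s \<and> sum s J = 0 \<and> \<not> opposite_paired J s} \<subseteq> ?A \<union> ?B"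
  proof
    fix s assume "s \<in> {s \<in> steps J n. no_single J s \<and> sum s J = 0 \<and> \<not> opposite_paired J s}"
    then have s: "s \<in> steps J n" "no_single J s" "sum s J = 0" "\<not> opposite_paired J s" by auto
    note t = no_single_card_ge[OF J s(2)]
    show "s \<in> ?A \<union> ?B"
    proof (cases "card J \<le> 2 * nvals J s")
      case False
      then show ?thesis using s by (auto simp: r_def)
    next
      case True
      have "\<not> inj_on s J"
      proof
        assume inj: "inj_on s J"
        have "- s j \<in> s ` J" if j: "j \<in> J" for j
        proof -
          obtain i where i: "i \<in> J" "i \<noteq> j" "\<bar>s i\<bar> = \<bar>s j\<bar>" using s(2) j by (auto simp: no_single_def)
          then have "s i \<noteq> s j" using inj j by (auto dest: inj_onD)
          then have "s i = - s j" using i by (auto simp: abs_eq_iff)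
          then show ?thesis using i by (metis image_eqI)
        qed
        then show False using s(4) inj t(2)[OF True] by (auto simp: opposite_paired_def)
      qed
      then obtain a b where ab: "a \<in> J" "b \<in> J" "a \<noteq> b" "s a = s b" by (auto simp: inj_on_def)
      have "nvals J (s(a := 0, b := 0)) + 1 = nvals J s"
        using nvals_erase_pair[OF J s(2) True ab(1-3)] ab by simp
      then have "nvals J (s(a := 0, b := 0)) \<le> r" using t(1) by (simp add: r_def)
      then show ?thesis using s ab by blast
    qed
  qed
  then have "card {s \<in> steps J n. no_single J s \<and> sum s J = 0 \<and> \<not> opposite_paired J s} \<le> card (?A \<union> ?B)"
    using J by (intro card_mono) auto
  also have "\<dots> \<le> card ?A + card ?B" by (rule card_Un_le)
  also have "\<dots> \<le> (2 * r + 1) ^ card J * (n + 1) ^ r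
      + 2 * (card J)\<^sup>2 * ((2 * r + 1) ^ card J * (n + 1) ^ r)"
    by (intro add_mono card_steps_few_values card_steps_linked J order_refl)
  finally show ?thesis by (simp add: algebra_simps)
qed

text \<open>In the tight case a value shared by \<open>A\<close> and \<open>B\<close> occurs exactly
  once in \<open>A\<close>, so the closing relation of \<open>A\<close> determines it. The lost
  parameter is the source of the decay of the variance.\<close>

lemma card_crossing:
  assumes AB: "finite A" "finite B" "A \<inter> B = {}" and k: "card (A \<union> B) = 2 * k"
  shows "card {s \<in> steps (A \<union> B) n. no_single (A \<union> B) s \<and> sum s A = 0 \<and> (\<exists>a\<in>A. \<exists>b\<in>B. \<bar>s a\<bar> = \<bar>s b\<bar>)}
    \<le> (1 + 8 * k\<^sup>2) * ((2 * k + 1) ^ (2 * k) * (n + 1) ^ (k - 1))"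
proof -
  let ?J = "A \<union> B"
  let ?A = "{s \<in> steps ?J n. nvals ?J s \<le> k - 1}"
  let ?B = "{s \<in> steps ?J n. sum s A = 0 \<and> (\<exists>a\<in>A. \<exists>b\<in>?J. a \<noteq> b \<and> (b \<notin> A \<and> \<bar>s a\<bar> = \<bar>s b\<bar> \<or> s a = s b)
             \<and> nvals ?J (s(a := 0, b := 0)) \<le> k - 1)}"
  have J: "finite ?J" using AB by simp
  have "{s \<in> steps ?J n. no_single ?J s \<and> sum s A = 0 \<and> (\<exists>a\<in>A. \<exists>b\<in>B. \<bar>s a\<bar> = \<bar>s b\<bar>)} \<subseteq> ?A \<union> ?B"
  proof
    fix s assume "s \<in> {s \<in> steps ?J n. no_single ?J s \<and> sum s A = 0 \<and> (\<exists>a\<in>A. \<exists>b\<in>B. \<bar>s a\<bar> = \<bar>s b\<bar>)}"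
    then obtain a b where s: "s \<in> steps ?J n" "no_single ?J s" "sum s A = 0" and ab: "a \<in> A" "b \<in> B" "\<bar>s a\<bar> = \<bar>s b\<bar>" by auto
    note t = no_single_card_ge[OF J s(2)]
    show "s \<in> ?A \<union> ?B"
    proof (cases "card ?J \<le> 2 * nvals ?J s")
      case False
      then show ?thesis using s k by auto
    next
      case True
      have ab': "a \<noteq> b" "b \<notin> A" using ab AB by auto
      have "nvals ?J (s(a := 0, b := 0)) + 1 = nvals ?J s"
        using nvals_erase_pair[OF J s(2) True, of a b] ab ab' by simp
      then have "nvals ?J (s(a := 0, b := 0)) \<le> k - 1" using t(1) k by simp
      then show ?thesis using s ab ab' by blast
    qed
  qed
  then have "card {s \<in> steps ?J n. no_single ?J s \<and> sum s A = 0 \<and> (\<exists>a\<in>A. \<exists>b\<in>B. \<bar>s a\<bar> = \<bar>s b\<bar>)} \<le> card (?A \<union> ?B)"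
    using J by (intro card_mono) auto
  also have "\<dots> \<le> card ?A + card ?B" by (rule card_Un_le)
  also have "\<dots> \<le> (2 * (k - 1) + 1) ^ card ?J * (n + 1) ^ (k - 1)
      + 2 * (card ?J)\<^sup>2 * ((2 * (k - 1) + 1) ^ card ?J * (n + 1) ^ (k - 1))"
    by (intro add_mono card_steps_few_values card_steps_linked J Un_upper1)
  also have "\<dots> = (1 + 8 * k\<^sup>2) * ((2 * (k - 1) + 1) ^ (2 * k) * (n + 1) ^ (k - 1))"
    by (simp add: k algebra_simps power2_eq_square)
  also have "\<dots> \<le> (1 + 8 * k\<^sup>2) * ((2 * k + 1) ^ (2 * k) * (n + 1) ^ (k - 1))"
    by (intro mult_left_mono mult_right_mono power_mono) auto
  finally show ?thesis .
qed

section \<open>Lattice points in dilated polytopes\<close>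

text \<open>Two dilations \<open>m\<close> and \<open>n\<close> are compared through their common
  refinement \<open>m * n\<close>, which makes the sequence Cauchy without knowledge of the
  limit.\<close>

lemma convergent_if_scaling_stable:
  fixes f :: "nat \<Rightarrow> real"
  assumes "\<And>m n. m > 0 \<Longrightarrow> n > 0 \<Longrightarrow> \<bar>f (m * n) - f n\<bar> \<le> C / real n"
  shows "convergent f"
proof -
  have C: "C \<ge> 0" using assms[of 1 1] by simp
  have "Cauchy f"
  proof (rule CauchyI)
    fix e :: real assume "e > 0"
    obtain N where N: "real N > 2 * C / e" using reals_Archimedean2 by blast
    show "\<exists>M. \<forall>m\<ge>M. \<forall>n\<ge>M. norm (f m - f n) < e"
    proof (intro exI allI impI)
      fix m n assume mn: "Suc N \<le> m" "Suc N \<le> n"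
      have "\<bar>f (m * n) - f n\<bar> \<le> C / real n" "\<bar>f (n * m) - f m\<bar> \<le> C / real m"
        using mn by (auto intro!: assms)
      then have "\<bar>f m - f n\<bar> \<le> C / real n + C / real m" by (simp add: mult.commute)
      also have "\<dots> \<le> C / real (Suc N) + C / real (Suc N)"
        using mn C by (intro add_mono divide_left_mono) auto
      also have "\<dots> = 2 * C / real (Suc N)" by simp
      also have "\<dots> < e"
      proof -
        have "2 * C / e < real (Suc N)" using N by simp
        then have "2 * C < e * real (Suc N)" using \<open>e > 0\<close> by (simp only: pos_divide_less_eq mult.commute)
        then show ?thesis by (simp add: pos_divide_less_eq del: of_nat_Suc)
      qed
      finally show "norm (f m - f n) < e" by simp
    qed
  qed
  then show ?thesis by (simp add: Cauchy_convergent_iff)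
qed

text \<open>Integer points of dilations of a polytope: refining the lattice by the factor \<open>m\<close> multiplies
  the number of points by \<open>m\<^bsup>d+1\<^esup>\<close>, up to the cells which are close to the boundary.\<close>

locale lattice_points =
  fixes R :: "'r set" and L :: "'l set" and a :: "'l \<Rightarrow> 'r \<Rightarrow> int"
  assumes finR: "finite R" and finL: "finite L"
begin

text \<open>The first coordinate always has coefficient 1. Hence a value of the form together with
  the other coordinates determines the point, on which the count of boundary points rests.\<close>

definition form :: "'l \<Rightarrow> int \<times> ('r \<Rightarrow> int) \<Rightarrow> int" where
  "form l z = fst z + (\<Sum>j\<in>R. a l j * snd z j)"

text \<open>Half-open ranges are tiled exactly by half-open cells of side \<open>m\<close>, with no
  overlap at the faces.\<close>

definition box :: "nat \<Rightarrow> (int \<times> ('r \<Rightarrow> int)) set" where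
  "box n = {0..<int n} \<times> (R \<rightarrow>\<^sub>E {- int n..<int n})"

definition pts :: "nat \<Rightarrow> (int \<times> ('r \<Rightarrow> int)) set" where
  "pts n = {z \<in> box n. \<forall>l\<in>L. 0 \<le> form l z \<and> form l z < int n}"

text \<open>A bound for the variation of every form over a unit cube: 1 for the first coordinate,
  plus the absolute coefficients, summed over all forms to be uniform in \<open>l\<close>.\<close>

definition K :: int where "K = 1 + (\<Sum>l\<in>L. \<Sum>j\<in>R. \<bar>a l j\<bar>)"

lemma K_ge: "K \<ge> 1" by (simp add: K_def sum_nonneg)

lemma finite_box [simp]: "finite (box n)"
  using finR by (auto simp: box_def intro!: finite_PiE)

lemma finite_pts [simp]: "finite (pts n)"
  by (rule finite_subset[OF _ finite_box[of n]]) (auto simp: pts_def)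

lemma card_box: "card (box n) = n * (2 * n) ^ card R"
  using finR by (simp add: box_def card_cartesian_product card_PiE nat_mult_distrib)

definition cell :: "nat \<Rightarrow> int \<times> ('r \<Rightarrow> int) \<Rightarrow> (int \<times> ('r \<Rightarrow> int)) set" where
  "cell m q = (\<lambda>r. (int m * fst q + fst r, \<lambda>j\<in>R. int m * snd q j + snd r j)) `
     ({0..<int m} \<times> (R \<rightarrow>\<^sub>E {0..<int m}))"

lemma card_cell: "card (cell m q) = m ^ (card R + 1)"
proof -
  have "inj_on (\<lambda>r. (int m * fst q + fst r, \<lambda>j\<in>R. int m * snd q j + snd r j)) ({0..<int m} \<times> (R \<rightarrow>\<^sub>E {0..<int m}))"
  proof (rule inj_onI)
    fix r r' assume r: "r \<in> {0..<int m} \<times> (R \<rightarrow>\<^sub>E {0..<int m})" "r' \<in> {0..<int m} \<times> (R \<rightarrow>\<^sub>E {0..<int m})"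
      and eq: "(int m * fst q + fst r, \<lambda>j\<in>R. int m * snd q j + snd r j) = (int m * fst q + fst r', \<lambda>j\<in>R. int m * snd q j + snd r' j)"
    have "snd r j = snd r' j" if "j \<in> R" for j
    proof -
      have "(\<lambda>j\<in>R. int m * snd q j + snd r j) j = (\<lambda>j\<in>R. int m * snd q j + snd r' j) j"
        using eq by (metis prod.inject)
      then show ?thesis using that by simp
    qed
    then have "snd r = snd r'" using r by (intro PiE_ext[of _ R]) auto
    then show "r = r'" using eq by (auto intro: prod_eqI)
  qed
  then show ?thesis using finR by (simp add: cell_def card_image card_cartesian_product card_PiE)
qed

lemma form_cell:
  assumes "z \<in> cell m q" "l \<in> L"
  shows "\<bar>form l z - int m * form l q\<bar> \<le> (int m - 1) * K"
proof -
  obtain r0 r where r: "r0 \<in> {0..<int m}" "r \<in> R \<rightarrow>\<^sub>E {0..<int m}"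
    and z: "z = (int m * fst q + r0, \<lambda>j\<in>R. int m * snd q j + r j)"
    using assms(1) by (auto simp: cell_def)
  have rj: "0 \<le> r j \<and> r j \<le> int m - 1" if "j \<in> R" for j using PiE_mem[OF r(2) that] by auto
  have m1: "0 \<le> int m - 1" using r(1) by auto
  have "form l z - int m * form l q = r0 + (\<Sum>j\<in>R. a l j * r j)"
    by (simp add: form_def z algebra_simps sum.distrib sum_distrib_left)
  also have "\<bar>\<dots>\<bar> \<le> \<bar>r0\<bar> + (\<Sum>j\<in>R. \<bar>a l j * r j\<bar>)"
    using sum_abs[of "\<lambda>j. a l j * r j" R] by linarith
  also have "\<dots> \<le> (int m - 1) + (\<Sum>j\<in>R. \<bar>a l j\<bar> * (int m - 1))"
    using r(1) rj by (intro add_mono sum_mono) (auto simp: abs_mult intro!: mult_left_mono)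
  also have "\<dots> = (int m - 1) * (1 + (\<Sum>j\<in>R. \<bar>a l j\<bar>))"
    unfolding sum_distrib_right[symmetric] by (simp only: distrib_left mult_1_right mult.commute[of _ "int m - 1"])
  also have "\<dots> \<le> (int m - 1) * K"
    using assms(2) finL m1 member_le_sum[of l L "\<lambda>l. \<Sum>j\<in>R. \<bar>a l j\<bar>"]
    by (intro mult_left_mono) (auto simp: K_def sum_nonneg)
  finally show ?thesis .
qed

lemma cells_partition:
  assumes "m > 0"
  shows "box (m * n) = (\<Union>q\<in>box n. cell m q)"
    and "q \<in> box n \<Longrightarrow> q' \<in> box n \<Longrightarrow> q \<noteq> q' \<Longrightarrow> cell m q \<inter> cell m q' = {}"
proof -
  have quot: "z \<in> cell m q \<Longrightarrow> q = (fst z div int m, \<lambda>j\<in>R. snd z j div int m)" if q: "q \<in> box n" for q z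
  proof -
    assume "z \<in> cell m q"
    then obtain r0 r where r: "r0 \<in> {0..<int m}" "r \<in> R \<rightarrow>\<^sub>E {0..<int m}"
      and z: "z = (int m * fst q + r0, \<lambda>j\<in>R. int m * snd q j + r j)"
      by (auto simp: cell_def)
    have "(\<lambda>j\<in>R. snd z j div int m) = snd q"
    proof (rule PiE_ext[of _ R "\<lambda>_. UNIV"])
      show "snd q \<in> R \<rightarrow>\<^sub>E UNIV" using q by (auto simp: box_def)
      fix j assume j: "j \<in> R"
      then show "(\<lambda>j\<in>R. snd z j div int m) j = snd q j" using PiE_mem[OF r(2) j] assms by (simp add: z)
    qed auto
    moreover have "fst z div int m = fst q" using r(1) assms by (simp add: z)
    ultimately show ?thesis by (simp add: prod_eq_iff)
  qed
  show "q \<in> box n \<Longrightarrow> q' \<in> box n \<Longrightarrow> q \<noteq> q' \<Longrightarrow> cell m q \<inter> cell m q' = {}"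
    using quot by blast
  have bd: "- int N \<le> int m * x + y \<and> int m * x + y < int N"
    if "- int n' \<le> x" "x < int n'" "0 \<le> y" "y < int m" "N = m * n'" for x y n' N
  proof -
    have "int m * x \<le> int m * (int n' - 1)" using that by (intro mult_left_mono) auto
    moreover have "int m * (- int n') \<le> int m * x" using that by (intro mult_left_mono) auto
    ultimately show ?thesis using that by (auto simp: algebra_simps)
  qed
  have bd0: "0 \<le> int m * x + y \<and> int m * x + y < int (m * n)"
    if "0 \<le> x" "x < int n" "0 \<le> y" "y < int m" for x y
    using bd[of n x y "m * n"] that by auto
  show "box (m * n) = (\<Union>q\<in>box n. cell m q)"
  proof (intro equalityI subsetI)
    fix z assume z: "z \<in> box (m * n)"
    define q where "q = (fst z div int m, \<lambda>j\<in>R. snd z j div int m)"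
    have 1: "0 \<le> fst z" "fst z < int (m * n)" and 2: "snd z \<in> R \<rightarrow>\<^sub>E {- int (m * n)..<int (m * n)}"
      using z by (auto simp: box_def)
    have divb: "- int n \<le> y div int m \<and> y div int m < int n" if "- int (m * n) \<le> y" "y < int (m * n)" for y
    proof -
      have "- int n = (int m * (- int n)) div int m" using assms by (metis nonzero_mult_div_cancel_left of_nat_0_eq_iff less_irrefl)
      also have "\<dots> \<le> y div int m" using that assms by (intro zdiv_mono1) auto
      moreover have "y div int m < int n"
      proof (rule ccontr)
        assume "\<not> y div int m < int n"
        then have "int m * int n \<le> int m * (y div int m)" by (intro mult_left_mono) auto
        also have "\<dots> \<le> y"
          using assms mult_div_mod_eq[of "int m" y] pos_mod_sign[of "int m" y] by linarith
        finally show False using that by simp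
      qed
      ultimately show ?thesis by simp
    qed
    have "q \<in> box n"
      unfolding q_def box_def using divb[of "fst z"] 1 2 assms divb
      by (auto simp: pos_imp_zdiv_nonneg_iff PiE_iff)
    moreover have "z \<in> cell m q"
      unfolding cell_def
    proof (rule image_eqI[of _ _ "(fst z mod int m, \<lambda>j\<in>R. snd z j mod int m)"])
      have "snd z = (\<lambda>j\<in>R. int m * (snd z j div int m) + snd z j mod int m)"
        using 2 by (intro PiE_ext[of _ R "\<lambda>_. UNIV"]) auto
      then show "z = (int m * fst q + fst (fst z mod int m, \<lambda>j\<in>R. snd z j mod int m),
        \<lambda>j\<in>R. int m * snd q j + snd (fst z mod int m, \<lambda>j\<in>R. snd z j mod int m) j)"
        by (auto simp: q_def prod_eq_iff cong: restrict_cong)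
    qed (use assms in auto)
    ultimately show "z \<in> (\<Union>q\<in>box n. cell m q)" by blast
  next
    fix z assume "z \<in> (\<Union>q\<in>box n. cell m q)"
    then obtain q where q: "q \<in> box n" "z \<in> cell m q" by blast
    then obtain r0 r where r: "r0 \<in> {0..<int m}" "r \<in> R \<rightarrow>\<^sub>E {0..<int m}"
      and z: "z = (int m * fst q + r0, \<lambda>j\<in>R. int m * snd q j + r j)"
      by (auto simp: cell_def)
    have 1: "0 \<le> fst q" "fst q < int n" and 2: "snd q \<in> R \<rightarrow>\<^sub>E {- int n..<int n}"
      using q by (auto simp: box_def)
    have "int m * snd q j + r j \<in> {- int (m * n)..<int (m * n)}" if "j \<in> R" for j
      using bd[of n "snd q j" "r j" "m * n"] PiE_mem[OF 2 that] PiE_mem[OF r(2) that] by auto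
    then show "z \<in> box (m * n)" unfolding z box_def
      using bd0[of "fst q" r0] 1 r(1) by (auto simp: PiE_iff)
  qed
qed

definition near :: "nat \<Rightarrow> int set" where
  "near n = {- K..<K} \<union> {int n - K..<int n + K}"

definition bdry :: "nat \<Rightarrow> (int \<times> ('r \<Rightarrow> int)) set" where
  "bdry n = {q \<in> box n. \<exists>l\<in>L. form l q \<in> near n}"

text \<open>For each form, a boundary point is determined by the value of the form, with at most
  \<open>4 * K\<close> options, and the coordinates in \<open>R\<close>. One factor of order
  \<open>n\<close> is thereby replaced by a constant.\<close>

lemma card_bdry: "card (bdry n) \<le> card L * (4 * nat K * (2 * n) ^ card R)"
proof -
  define E where "E l = {q \<in> box n. form l q \<in> near n}" for l
  let ?D = "near n \<times> (R \<rightarrow>\<^sub>E {- int n..<int n})"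
  have finD: "finite ?D" using finR by (auto simp: near_def intro!: finite_PiE)
  have "card (E l) \<le> card ?D" for l
  proof (rule card_inj_on_le[where f = "\<lambda>q. (form l q, snd q)"])
    show "inj_on (\<lambda>q. (form l q, snd q)) (E l)"
      by (intro inj_onI) (auto simp: form_def prod_eq_iff)
    show "(\<lambda>q. (form l q, snd q)) ` E l \<subseteq> ?D" by (auto simp: E_def box_def)
  qed (rule finD)
  moreover have "card ?D \<le> 4 * nat K * (2 * n) ^ card R"
  proof -
    have "card (near n) \<le> card {- K..<K} + card {int n - K..<int n + K}"
      unfolding near_def by (rule card_Un_le)
    also have "\<dots> = 4 * nat K" using K_ge by simp
    finally show ?thesis using finR by (simp add: card_cartesian_product card_PiE nat_mult_distrib)
  qed
  ultimately have 1: "card (E l) \<le> 4 * nat K * (2 * n) ^ card R" for l using order.trans by blast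
  have "bdry n = (\<Union>l\<in>L. E l)" by (auto simp: bdry_def E_def)
  then have "card (bdry n) \<le> (\<Sum>l\<in>L. card (E l))" using card_UN_le[OF finL] by simp
  also have "\<dots> \<le> (\<Sum>l\<in>L. 4 * nat K * (2 * n) ^ card R)" by (intro sum_mono 1)
  finally show ?thesis by simp
qed

text \<open>A form varies over a cell by at most \<open>(m - 1) * K\<close>, less than the margin
  \<open>m * K\<close> that a point outside \<open>bdry n\<close> keeps from both faces after
  scaling. So a cell lies entirely inside the polytope or entirely outside.\<close>

lemma cell_pts:
  assumes "m > 0" "q \<in> box n" "q \<notin> bdry n"
  shows "card (pts (m * n) \<inter> cell m q) = m ^ (card R + 1) * of_bool (q \<in> pts n)"
proof -
  have nn: "form l q \<notin> near n" if "l \<in> L" for l using assms that by (auto simp: bdry_def)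
  have mK: "(int m - 1) * K < int m * K" using K_ge by (simp add: algebra_simps)
  show ?thesis
  proof (cases "\<forall>l\<in>L. K \<le> form l q \<and> form l q < int n - K")
    case True
    have "cell m q \<subseteq> pts (m * n)"
    proof
      fix z assume z: "z \<in> cell m q"
      have "0 \<le> form l z \<and> form l z < int (m * n)" if l: "l \<in> L" for l
      proof -
        have "int m * K \<le> int m * form l q" "int m * form l q \<le> int m * (int n - K)"
          using True l by (auto intro!: mult_left_mono)
        then show ?thesis using form_cell[OF z l] mK unfolding abs_le_iff by (auto simp: algebra_simps)
      qed
      moreover have "z \<in> box (m * n)" using cells_partition(1)[OF assms(1)] assms(2) z by blast
      ultimately show "z \<in> pts (m * n)" by (auto simp: pts_def)
    qed
    then have "pts (m * n) \<inter> cell m q = cell m q" by blast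
    moreover have "q \<in> pts n" using True K_ge assms(2) by (force simp: pts_def)
    ultimately show ?thesis by (simp add: card_cell)
  next
    case False
    then obtain l where l: "l \<in> L" "\<not> (K \<le> form l q \<and> form l q < int n - K)" by blast
    then have far: "form l q < - K \<or> form l q \<ge> int n + K" using nn[OF l(1)] by (auto simp: near_def)
    have "z \<notin> pts (m * n)" if z: "z \<in> cell m q" for z
    proof -
      have "form l z < 0 \<or> form l z \<ge> int (m * n)"
        using far
      proof
        assume "form l q < - K"
        then have "int m * form l q \<le> int m * (- K)" by (intro mult_left_mono) auto
        then show ?thesis using form_cell[OF z l(1)] mK unfolding abs_le_iff by (auto simp: algebra_simps)
      next
        assume "form l q \<ge> int n + K"
        then have "int m * (int n + K) \<le> int m * form l q" by (intro mult_left_mono) auto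
        then show ?thesis using form_cell[OF z l(1)] mK unfolding abs_le_iff by (auto simp: algebra_simps)
      qed
      then show ?thesis using l(1) by (force simp: pts_def)
    qed
    then have "pts (m * n) \<inter> cell m q = {}" by blast
    moreover have "q \<notin> pts n" using far l(1) K_ge by (force simp: pts_def)
    ultimately show ?thesis by simp
  qed
qed

lemma card_pts_scaling:
  assumes m: "m > 0"
  shows "\<bar>real (card (pts (m * n))) - real m ^ (card R + 1) * real (card (pts n))\<bar>
    \<le> real m ^ (card R + 1) * real (card (bdry n))"
proof -
  let ?M = "real m ^ (card R + 1)"
  have fin: "finite (cell m q)" for q using finR by (auto simp: cell_def intro!: finite_PiE)
  have "pts (m * n) = (\<Union>q\<in>box n. pts (m * n) \<inter> cell m q)"
    using cells_partition(1)[OF m, of n] by (auto simp: pts_def)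
  then have "card (pts (m * n)) = (\<Sum>q\<in>box n. card (pts (m * n) \<inter> cell m q))"
    using cells_partition(2)[OF m] fin by (subst card_UN_disjoint[symmetric]) (auto, blast+)
  moreover have "card (pts n) = (\<Sum>q\<in>box n. of_bool (q \<in> pts n))"
  proof -
    have "box n \<inter> pts n = pts n" by (auto simp: pts_def)
    then show ?thesis by (simp add: of_bool_def sum.If_cases Int_def)
  qed
  ultimately have "\<bar>real (card (pts (m * n))) - ?M * real (card (pts n))\<bar>
    = \<bar>\<Sum>q\<in>box n. real (card (pts (m * n) \<inter> cell m q)) - ?M * of_bool (q \<in> pts n)\<bar>"
    by (simp add: sum_subtractf sum_distrib_left[symmetric] mult_ac)
  also have "\<dots> \<le> (\<Sum>q\<in>box n. \<bar>real (card (pts (m * n) \<inter> cell m q)) - ?M * of_bool (q \<in> pts n)\<bar>)"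
    by (rule sum_abs)
  also have "\<dots> \<le> (\<Sum>q\<in>box n. ?M * of_bool (q \<in> bdry n))"
  proof (intro sum_mono)
    fix q assume q: "q \<in> box n"
    show "\<bar>real (card (pts (m * n) \<inter> cell m q)) - ?M * of_bool (q \<in> pts n)\<bar> \<le> ?M * of_bool (q \<in> bdry n)"
    proof (cases "q \<in> bdry n")
      case True
      have "card (pts (m * n) \<inter> cell m q) \<le> m ^ (card R + 1)"
        using card_mono[OF fin[of q], of "pts (m * n) \<inter> cell m q"] card_cell[of m q] by simp
      then have "real (card (pts (m * n) \<inter> cell m q)) \<le> ?M" by (metis of_nat_le_iff of_nat_power)
      then show ?thesis using True by (auto simp: abs_le_iff of_bool_def)
    next
      case False
      then show ?thesis using cell_pts[OF m q] by simp
    qed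
  qed
  also have "\<dots> = ?M * real (card (bdry n))"
  proof -
    have "box n \<inter> bdry n = bdry n" by (auto simp: bdry_def)
    then show ?thesis by (simp add: sum_distrib_left[symmetric] of_bool_def sum.If_cases Int_def)
  qed
  finally show ?thesis .
qed

lemma convergent_card_pts: "convergent (\<lambda>n. real (card (pts n)) / real n ^ (card R + 1))"
proof (rule convergent_if_scaling_stable)
  fix m n :: nat assume m: "m > 0" and n: "n > 0"
  let ?d = "card R"
  let ?C = "real (card L) * 4 * real (nat K) * 2 ^ ?d"
  let ?M = "real m ^ (?d + 1)" and ?N = "real n ^ (?d + 1)"
  have MN: "?M > 0" "?N > 0" using m n by simp_all
  have "real (card (bdry n)) \<le> real (card L * (4 * nat K * (2 * n) ^ ?d))"
    using card_bdry by (simp only: of_nat_le_iff)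
  also have "\<dots> = ?C * real n ^ ?d" by (simp add: power_mult_distrib)
  finally have b: "real (card (bdry n)) \<le> ?C * real n ^ ?d" .
  have "\<bar>real (card (pts (m * n))) / real (m * n) ^ (?d + 1) - real (card (pts n)) / ?N\<bar>
    = \<bar>real (card (pts (m * n))) - ?M * real (card (pts n))\<bar> / (?M * ?N)"
  proof -
    have "real (card (pts (m * n))) / real (m * n) ^ (?d + 1) - real (card (pts n)) / ?N
      = (real (card (pts (m * n))) - ?M * real (card (pts n))) / (?M * ?N)"
    proof -
      have "x / (M * N) - y / N = (x - M * y) / (M * N)" if "M > 0" "N > 0" for x y M N :: real
        using that by (simp add: field_simps)
      from this[OF MN] show ?thesis by (simp only: of_nat_mult power_mult_distrib)
    qed
    then show ?thesis using MN by (simp del: power_Suc)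
  qed
  also have "\<dots> \<le> ?M * (?C * real n ^ ?d) / (?M * ?N)"
    using card_pts_scaling[OF m, of n] b MN
    by (intro divide_right_mono order.trans[OF card_pts_scaling[OF m]] mult_left_mono) auto
  also have "\<dots> = ?C / real n" using m n by simp
  finally show "\<bar>real (card (pts (m * n))) / real (m * n) ^ (?d + 1) - real (card (pts n)) / ?N\<bar> \<le> ?C / real n" .
qed

lemma card_pts_le: "card (pts n) \<le> 2 ^ card R * n ^ (card R + 1)"
proof -
  have "card (pts n) \<le> card (box n)" by (intro card_mono) (auto simp: pts_def)
  then show ?thesis by (simp add: card_box power_mult_distrib mult_ac)
qed

end

section \<open>Closed walks and pairings\<close>

text \<open>A closed walk in \<open>{0..<n}\<close> is given by its starting point \<open>i\<close> and its \<open>k\<close> displacements \<open>s\<close>.\<close>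

definition closed_walk :: "nat \<Rightarrow> nat \<Rightarrow> nat \<Rightarrow> (nat \<Rightarrow> int) \<Rightarrow> bool" where
  "closed_walk k n i s \<longleftrightarrow>
     (\<Sum>m<k. s m) = 0 \<and> (\<forall>l\<le>k. 0 \<le> int i + (\<Sum>m<l. s m) \<and> int i + (\<Sum>m<l. s m) < int n)"

text \<open>Perfect matchings of \<open>{..<k}\<close>, encoded as fixed-point-free involutions;
  extensionality makes each matching a single function, so that they can be counted.\<close>

definition pairings :: "nat \<Rightarrow> (nat \<Rightarrow> nat) set" where
  "pairings k = {p \<in> {..<k} \<rightarrow>\<^sub>E {..<k}. \<forall>j<k. p j \<noteq> j \<and> p (p j) = j}"

definition pair_opposite :: "nat \<Rightarrow> (nat \<Rightarrow> nat) \<Rightarrow> (nat \<Rightarrow> int) \<Rightarrow> bool" where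
  "pair_opposite k p s \<longleftrightarrow> (\<forall>j<k. s (p j) = - s j)"

lemma finite_pairings [simp]: "finite (pairings k)"
  by (rule finite_subset[of _ "{..<k} \<rightarrow>\<^sub>E {..<k}"]) (auto simp: pairings_def intro: finite_PiE)

lemma pairingsD:
  assumes "p \<in> pairings k" "j < k"
  shows "p j < k" "p j \<noteq> j" "p (p j) = j"
  using assms by (auto simp: pairings_def)

text \<open>The smaller index of each pair is taken as its representative; the steps at these
  indices are the free coordinates of a walk that obeys the matching.\<close>

lemma pairings_openers:
  assumes p: "p \<in> pairings k"
  defines "R \<equiv> {j. j < k \<and> j < p j}"
  shows "{..<k} = R \<union> p ` R" "R \<inter> p ` R = {}" "inj_on p R" "k = 2 * card R"
proof -
  have fin: "finite R" by (simp add: R_def)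
  show 1: "{..<k} = R \<union> p ` R"
  proof (intro equalityI subsetI)
    fix j assume j: "j \<in> {..<k}"
    show "j \<in> R \<union> p ` R"
    proof (cases "j < p j")
      case False
      then have "p j < j" "p (p j) = j" "p j < k" using pairingsD[OF p, of j] j by auto
      then have "p j \<in> R" by (auto simp: R_def)
      then show ?thesis using \<open>p (p j) = j\<close> by (metis UnI2 image_eqI)
    qed (use j in \<open>auto simp: R_def\<close>)
  qed (use pairingsD[OF p] in \<open>auto simp: R_def\<close>)
  show 2: "R \<inter> p ` R = {}"
  proof -
    have "p j \<notin> R" if "j \<in> R" for j
      using pairingsD(3)[OF p, of j] that by (auto simp: R_def)
    then show ?thesis by auto
  qed
  show 3: "inj_on p R"
  proof (rule inj_onI)
    fix i j assume ij: "i \<in> R" "j \<in> R" and eq: "p i = p j"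
    have "p (p i) = i" using pairingsD(3)[OF p, of i] ij(1) by (simp add: R_def)
    moreover have "p (p j) = j" using pairingsD(3)[OF p, of j] ij(2) by (simp add: R_def)
    ultimately show "i = j" using eq by metis
  qed
  have "card (R \<union> p ` R) = card R + card (p ` R)" by (rule card_Un_disjoint[OF fin finite_imageI[OF fin] 2])
  then show "k = 2 * card R" unfolding 1[symmetric] card_image[OF 3] by simp
qed

lemma pair_opposite_no_single: "p \<in> pairings k \<Longrightarrow> pair_opposite k p s \<Longrightarrow> no_single {..<k} s"
  unfolding no_single_def
proof
  fix j assume p: "p \<in> pairings k" "pair_opposite k p s" and "j \<in> {..<k}"
  then show "\<exists>i\<in>{..<k}. i \<noteq> j \<and> \<bar>s i\<bar> = \<bar>s j\<bar>"
    using pairingsD[OF p(1), of j] by (intro bexI[of _ "p j"]) (auto simp: pair_opposite_def)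
qed

lemma pair_opposite_sum_zero:
  assumes p: "p \<in> pairings k" and c: "pair_opposite k p s"
  shows "(\<Sum>m<k. s m) = 0"
proof -
  have "(\<Sum>m<k. s m) = (\<Sum>m<k. s (p m))"
    by (rule sum.reindex_bij_witness[of _ p p]) (use pairingsD[OF p] in auto)
  also have "\<dots> = - (\<Sum>m<k. s m)" using c by (simp add: pair_opposite_def sum_negf)
  finally show ?thesis by simp
qed

text \<open>Since the step \<open>- s j\<close> occurs at one index only, the matching is forced.
  The sum over matchings thus counts each leading walk once.\<close>

lemma card_pair_opposite:
  assumes s: "opposite_paired {..<k} s"
  shows "card {p \<in> pairings k. pair_opposite k p s} = 1"
proof -
  have inj: "inj_on s {..<k}" and nz: "\<And>j. j < k \<Longrightarrow> s j \<noteq> 0" and cl: "\<And>j. j < k \<Longrightarrow> - s j \<in> s ` {..<k}"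
    using s by (auto simp: opposite_paired_def)
  define p where "p = (\<lambda>j\<in>{..<k}. inv_into {..<k} s (- s j))"
  have p1: "p j < k" "s (p j) = - s j" if "j < k" for j
    using inv_into_into[OF cl[OF that]] f_inv_into_f[OF cl[OF that]] that by (auto simp: p_def)
  have "p (p j) = j" if "j < k" for j
    using p1[OF that] p1[of "p j"] inj_onD[OF inj, of "p (p j)" j] that by simp
  moreover have "p j \<noteq> j" if "j < k" for j using p1[OF that] nz[OF that] by auto
  ultimately have "p \<in> pairings k" using p1 by (auto simp: pairings_def p_def)
  moreover have "pair_opposite k p s" using p1 by (simp add: pair_opposite_def)
  moreover have "q = p" if q: "q \<in> pairings k" "pair_opposite k q s" for q
  proof (rule PiE_ext)
    show "q \<in> {..<k} \<rightarrow>\<^sub>E UNIV" "p \<in> {..<k} \<rightarrow>\<^sub>E UNIV" using q by (auto simp: pairings_def p_def)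
    fix j assume "j \<in> {..<k}"
    then show "q j = p j"
      using inj_onD[OF inj, of "q j" "p j"] p1[of j] q(2) pairingsD(1)[OF q(1), of j] by (simp add: pair_opposite_def)
  qed
  ultimately have "{p \<in> pairings k. pair_opposite k p s} = {p}" by blast
  then show ?thesis by simp
qed

text \<open>A matching is determined by its openers, at most \<open>2 ^ k\<close> subsets, and their
  partners, at most \<open>k ^ d\<close> choices. With \<open>k = 2 * d\<close> this is
  \<open>8 ^ d * d ^ d\<close>, and one term of the exponential series gives
  \<open>d ^ d <= 3 ^ d * fact d\<close>, as \<open>exp 1 <= 3\<close>.\<close>

lemma card_pairings_le:
  assumes "k = 2 * d"
  shows "real (card (pairings k)) \<le> 24 ^ d * fact d"
proof -
  define Rf where "Rf p = {j. j < k \<and> j < p j}" for p :: "nat \<Rightarrow> nat"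
  let ?D = "SIGMA R : {R \<in> Pow {..<k}. card R = d}. R \<rightarrow>\<^sub>E {..<k}"
  have "inj_on (\<lambda>p. (Rf p, restrict p (Rf p))) (pairings k)"
  proof (rule inj_onI)
    fix p q assume p: "p \<in> pairings k" and q: "q \<in> pairings k"
      and eq: "(Rf p, restrict p (Rf p)) = (Rf q, restrict q (Rf q))"
    then have R: "Rf p = Rf q" by simp
    have on: "p j = q j" if "j \<in> Rf p" for j
      using eq that R by (metis prod.inject restrict_apply')
    show "p = q"
    proof (rule PiE_ext)
      show "p \<in> {..<k} \<rightarrow>\<^sub>E UNIV" "q \<in> {..<k} \<rightarrow>\<^sub>E UNIV" using p q by (auto simp: pairings_def)
      fix j assume j: "j \<in> {..<k}"
      show "p j = q j"
      proof (cases "j \<in> Rf p")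
        case False
        then obtain i where i: "i \<in> Rf p" "j = p i"
          using j pairings_openers(1)[OF p] by (auto simp: Rf_def)
        have "i < k" using i(1) by (simp add: Rf_def)
        have "j = q i" using i(2) on[OF i(1)] by simp
        have "p j = i" using pairingsD(3)[OF p \<open>i < k\<close>] i(2) by simp
        moreover have "q j = i" using pairingsD(3)[OF q \<open>i < k\<close>] \<open>j = q i\<close> by simp
        ultimately show ?thesis by simp
      qed (rule on)
    qed
  qed
  moreover have "(\<lambda>p. (Rf p, restrict p (Rf p))) ` pairings k \<subseteq> ?D"
  proof (intro subsetI, elim imageE)
    fix z p assume z: "z = (Rf p, restrict p (Rf p))" and p: "p \<in> pairings k"
    have "card (Rf p) = d" using pairings_openers(4)[OF p] assms by (simp add: Rf_def)
    then show "z \<in> ?D" using pairingsD(1)[OF p] by (auto simp: z Rf_def)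
  qed
  moreover have "finite ?D" by (intro finite_SigmaI) (auto intro!: finite_PiE finite_subset[of _ "{..<k}"])
  ultimately have "card (pairings k) \<le> card ?D" by (rule card_inj_on_le)
  also have "card ?D = (\<Sum>R\<in>{R \<in> Pow {..<k}. card R = d}. k ^ d)"
    by (subst card_SigmaI) (auto intro!: finite_PiE sum.cong simp: card_PiE finite_subset[of _ "{..<k}"])
  also have "\<dots> \<le> 2 ^ k * k ^ d"
  proof -
    have "card {R \<in> Pow {..<k}. card R = d} \<le> card (Pow {..<k})" by (intro card_mono) auto
    then show ?thesis by (simp add: card_Pow)
  qed
  finally have "real (card (pairings k)) \<le> real (2 ^ k * k ^ d)" by (simp only: of_nat_le_iff)
  also have "\<dots> = 8 ^ d * real d ^ d"
  proof -
    have "(2 :: real) ^ (2 * d) * real (2 * d) ^ d = (4 ^ d * 2 ^ d) * real d ^ d"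
      by (simp add: power_mult power_mult_distrib)
    also have "(4 :: real) ^ d * 2 ^ d = 8 ^ d" by (simp only: power_mult_distrib[symmetric]) simp
    finally show ?thesis by (simp add: assms)
  qed
  also have "real d ^ d \<le> 3 ^ d * fact d"
  proof -
    have "real d ^ d / fact d \<le> exp (real d)"
    proof -
      have "(\<Sum>n\<in>{d}. inverse (fact n) * real d ^ n) \<le> exp (real d)"
        using sum_le_suminf[OF summable_exp, of "{d}" "real d"] by (simp add: exp_def scaleR_conv_of_real divide_inverse)
      then show ?thesis by (simp add: divide_inverse mult.commute)
    qed
    also have "\<dots> = exp 1 ^ d" by (simp add: exp_of_nat_mult[symmetric])
    also have "\<dots> \<le> 3 ^ d" using exp_le by (intro power_mono) auto
    finally show ?thesis by (simp add: divide_le_eq)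
  qed
  finally show ?thesis by (simp add: power_mult_distrib[symmetric] mult.assoc[symmetric])
qed

definition walk_count :: "nat \<Rightarrow> (nat \<Rightarrow> nat) \<Rightarrow> nat \<Rightarrow> nat" where
  "walk_count k p n = card {(i, s). i < n \<and> s \<in> steps {..<k} n \<and> pair_opposite k p s \<and> closed_walk k n i s}"

text \<open>A closing step is minus its opening step, so every position is a form in the start and
  the opening steps. For \<open>j\<close> in \<open>R\<close> the coefficient \<open>a l j\<close>
  is 1 while the pair of \<open>j\<close> is open at time \<open>l\<close>, and 0 otherwise.\<close>

lemma walk_count_lattice:
  assumes p: "p \<in> pairings k"
  defines "R \<equiv> {j. j < k \<and> j < p j}"
  defines "a \<equiv> \<lambda>l j. \<Sum>m<l. of_bool (m = j) - of_bool (m = p j) :: int"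
  shows "walk_count k p n = card (lattice_points.pts R {..k} a n)"
proof -
  interpret lattice_points R "{..k}" a by unfold_locales (auto simp: R_def)
  note op = pairings_openers[OF p, folded R_def]
  define ext where "ext t = (\<lambda>m\<in>{..<k}. if m \<in> R then t m else - t (p m))" for t :: "nat \<Rightarrow> int"
  have pR: "p m \<in> R" "p (p m) = m" if "m < k" "m \<notin> R" for m
    using pairingsD[OF p that(1)] that by (auto simp: R_def)
  have ext_sum: "(\<Sum>m<l. ext t m) = (\<Sum>j\<in>R. a l j * t j)" if "l \<le> k" for l t
  proof -
    have "ext t m = (\<Sum>j\<in>R. (of_bool (m = j) - of_bool (m = p j)) * t j)" if m: "m < k" for m
    proof (cases "m \<in> R")
      case True
      have "(\<Sum>j\<in>R. (of_bool (m = j) - of_bool (m = p j)) * t j) = (\<Sum>j\<in>R. if j = m then t j else 0)"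
        using op(2) True by (intro sum.cong) auto
      then show ?thesis using True m finR by (simp add: ext_def)
    next
      case False
      have "(\<Sum>j\<in>R. (of_bool (m = j) - of_bool (m = p j)) * t j) = (\<Sum>j\<in>R. if j = p m then - t j else 0)"
      proof (rule sum.cong)
        fix j assume j: "j \<in> R"
        then have "p (p j) = j" using pairingsD(3)[OF p] by (simp add: R_def)
        then show "(of_bool (m = j) - of_bool (m = p j)) * t j = (if j = p m then - t j else 0)"
          using False j pR[OF m False] by auto
      qed simp
      then show ?thesis using False m finR pR[OF m False] by (simp add: ext_def)
    qed
    then have "(\<Sum>m<l. ext t m) = (\<Sum>m<l. \<Sum>j\<in>R. (of_bool (m = j) - of_bool (m = p j)) * t j)"
      using that by (intro sum.cong) auto
    also have "\<dots> = (\<Sum>j\<in>R. a l j * t j)" unfolding a_def sum_distrib_right by (rule sum.swap)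
    finally show ?thesis .
  qed
  have "bij_betw (\<lambda>(i, s). (int i, restrict s R))
      {(i, s). i < n \<and> s \<in> steps {..<k} n \<and> pair_opposite k p s \<and> closed_walk k n i s} (pts n)"
  proof (rule bij_betw_byWitness[where f' = "\<lambda>(i, t). (nat i, ext t)"])
    have inv: "ext (restrict s R) = s" if "s \<in> steps {..<k} n" "pair_opposite k p s" for s
    proof (rule PiE_ext)
      show "ext (restrict s R) \<in> {..<k} \<rightarrow>\<^sub>E UNIV" "s \<in> {..<k} \<rightarrow>\<^sub>E UNIV" using that by (auto simp: ext_def steps_def)
      fix m assume "m \<in> {..<k}"
      then show "ext (restrict s R) m = s m"
        using that(2) pR[of m] by (auto simp: ext_def pair_opposite_def)
    qed
    show "\<forall>z\<in>{(i, s). i < n \<and> s \<in> steps {..<k} n \<and> pair_opposite k p s \<and> closed_walk k n i s}.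
        (case (case z of (i, s) \<Rightarrow> (int i, restrict s R)) of (i, t) \<Rightarrow> (nat i, ext t)) = z"
      using inv by auto
    show "\<forall>z\<in>pts n. (case (case z of (i, t) \<Rightarrow> (nat i, ext t)) of (i, s) \<Rightarrow> (int i, restrict s R)) = z"
    proof
      fix z assume z: "z \<in> pts n"
      obtain i t where zit: "z = (i, t)" by (cases z)
      have t: "t \<in> R \<rightarrow>\<^sub>E {- int n..<int n}" and i: "0 \<le> i" using z by (auto simp: pts_def box_def zit)
      have "restrict (ext t) R = t"
        using t by (intro PiE_ext[of _ R "\<lambda>_. UNIV"]) (auto simp: ext_def R_def)
      then show "(case (case z of (i, t) \<Rightarrow> (nat i, ext t)) of (i, s) \<Rightarrow> (int i, restrict s R)) = z"
        using i by (simp add: zit)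
    qed
    show "(\<lambda>(i, s). (int i, restrict s R)) `
        {(i, s). i < n \<and> s \<in> steps {..<k} n \<and> pair_opposite k p s \<and> closed_walk k n i s} \<subseteq> pts n"
    proof (clarify)
      fix i s assume i: "i < n" and s: "s \<in> steps {..<k} n" "pair_opposite k p s" and w: "closed_walk k n i s"
      have pos: "0 \<le> int i + (\<Sum>m<l. s m) \<and> int i + (\<Sum>m<l. s m) < int n" if "l \<le> k" for l
        using w that by (auto simp: closed_walk_def)
      \<comment> \<open>A step is the difference of two consecutive positions in
        \<open>{0..<n}\<close>, so the upper bound is strict, as the half-open box demands.\<close>
      have "- int n \<le> s j \<and> s j < int n" if "j \<in> R" for j
        using pos[of j] pos[of "Suc j"] that by (simp add: R_def)
      then have "restrict s R \<in> R \<rightarrow>\<^sub>E {- int n..<int n}" by auto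
      moreover have "form l (int i, restrict s R) = int i + (\<Sum>m<l. s m)" if "l \<le> k" for l
        using ext_sum[OF that, of "restrict s R"] inv[OF s] by (simp add: form_def)
      ultimately show "(int i, restrict s R) \<in> pts n"
        using i pos by (auto simp: pts_def box_def)
    qed
    show "(\<lambda>(i, t). (nat i, ext t)) ` pts n
        \<subseteq> {(i, s). i < n \<and> s \<in> steps {..<k} n \<and> pair_opposite k p s \<and> closed_walk k n i s}"
    proof (clarify)
      fix i t assume z: "(i, t) \<in> pts n"
      then have i: "0 \<le> i" "i < int n" and t: "t \<in> R \<rightarrow>\<^sub>E {- int n..<int n}"
        and f: "\<And>l. l \<le> k \<Longrightarrow> 0 \<le> form l (i, t) \<and> form l (i, t) < int n"
        by (auto simp: pts_def box_def)
      have tR: "- int n \<le> t j \<and> t j < int n" if "j \<in> R" for j using PiE_mem[OF t that] by auto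
      have "ext t m \<in> {- int n..int n}" if "m < k" for m
        using tR[of m] tR[of "p m"] pR[OF that] that by (auto simp: ext_def)
      then have st: "ext t \<in> steps {..<k} n" by (auto simp: steps_def ext_def PiE_iff)
      have co: "pair_opposite k p (ext t)"
        unfolding pair_opposite_def
      proof (intro allI impI)
        fix j assume j: "j < k"
        note pj = pairingsD[OF p j]
        show "ext t (p j) = - ext t j"
        proof (cases "j \<in> R")
          case True
          then have "p j \<notin> R" using op(2) by auto
          then show ?thesis using True j pj by (simp add: ext_def)
        next
          case False
          then show ?thesis using pR[OF j False] j pj by (simp add: ext_def)
        qed
      qed
      have "int (nat i) + (\<Sum>m<l. ext t m) = form l (i, t)" if "l \<le> k" for l
        using ext_sum[OF that] i by (simp add: form_def)
      then have "closed_walk k n (nat i) (ext t)"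
        using f pair_opposite_sum_zero[OF p co] by (auto simp: closed_walk_def)
      then show "nat i < n \<and> ext t \<in> steps {..<k} n \<and> pair_opposite k p (ext t) \<and> closed_walk k n (nat i) (ext t)"
        using st co i by auto
    qed
  qed
  then show ?thesis unfolding walk_count_def by (rule bij_betw_same_card)
qed

text \<open>The starting point and one step of each pair are free, so this is the volume of a polytope in dimension
  \<open>k/2 + 1\<close>.\<close>

definition pairing_limit :: "nat \<Rightarrow> (nat \<Rightarrow> nat) \<Rightarrow> real" where
  "pairing_limit k p = lim (\<lambda>n. real (walk_count k p n) / real n ^ (k div 2 + 1))"

text \<open>The upper bound comes from the box: each of the \<open>k div 2\<close> free steps has
  \<open>2 * n\<close> values and the start has \<open>n\<close>.\<close>

lemma walk_count_limit:
  assumes p: "p \<in> pairings k"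
  shows "(\<lambda>n. real (walk_count k p n) / real n ^ (k div 2 + 1)) \<longlonglongrightarrow> pairing_limit k p"
    and "0 \<le> pairing_limit k p" "pairing_limit k p \<le> 2 ^ (k div 2)"
proof -
  define R where "R = {j. j < k \<and> j < p j}"
  define a where "a = (\<lambda>l j. \<Sum>m<l. of_bool (m = j) - of_bool (m = p j) :: int)"
  interpret lattice_points R "{..k}" a by unfold_locales (auto simp: R_def)
  have kR: "k div 2 = card R" using pairings_openers(4)[OF p] by (simp add: R_def)
  have wc: "walk_count k p n = card (pts n)" for n
    using walk_count_lattice[OF p] by (simp add: R_def a_def)
  have "convergent (\<lambda>n. real (walk_count k p n) / real n ^ (k div 2 + 1))"
    unfolding wc kR by (rule convergent_card_pts)
  then show lim: "(\<lambda>n. real (walk_count k p n) / real n ^ (k div 2 + 1)) \<longlonglongrightarrow> pairing_limit k p"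
    by (simp add: pairing_limit_def convergent_LIMSEQ_iff)
  show "0 \<le> pairing_limit k p" by (rule LIMSEQ_le_const[OF lim]) auto
  have "real (walk_count k p n) / real n ^ (k div 2 + 1) \<le> 2 ^ (k div 2)" for n
  proof -
    have "real (walk_count k p n) \<le> real (2 ^ card R * n ^ (card R + 1))"
      unfolding wc using card_pts_le[of n] by (simp only: of_nat_le_iff)
    then show ?thesis by (cases "n = 0") (auto simp: kR divide_le_eq)
  qed
  then show "pairing_limit k p \<le> 2 ^ (k div 2)" by (intro LIMSEQ_le_const2[OF lim]) auto
qed

definition toeplitz_moment :: "nat \<Rightarrow> real" where
  "toeplitz_moment k = (\<Sum>p\<in>pairings k. pairing_limit k p)"

lemma toeplitz_moment_odd: "odd k \<Longrightarrow> toeplitz_moment k = 0"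
  using pairings_openers(4)[of _ k] unfolding toeplitz_moment_def by (metis (no_types, lifting) dvd_triv_left sum.neutral)

text \<open>The number of matchings, \<open>24 ^ d * fact d\<close>, is multiplied by the bound
  \<open>2 ^ d\<close> for each limiting volume.\<close>

lemma toeplitz_moment_even_le: "\<bar>toeplitz_moment (2 * d)\<bar> \<le> 48 ^ d * fact d"
proof -
  have "\<bar>toeplitz_moment (2 * d)\<bar> \<le> (\<Sum>p\<in>pairings (2 * d). \<bar>pairing_limit (2 * d) p\<bar>)"
    unfolding toeplitz_moment_def by (rule sum_abs)
  also have "\<dots> \<le> (\<Sum>p\<in>pairings (2 * d). 2 ^ d)"
    using walk_count_limit(2,3)[of _ "2 * d"] by (intro sum_mono) fastforce
  also have "\<dots> \<le> 24 ^ d * fact d * 2 ^ d"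
    using card_pairings_le[of "2 * d" d] by (simp add: mult_right_mono)
  also have "\<dots> = 48 ^ d * fact d" by (simp add: power_mult_distrib[symmetric])
  finally show ?thesis .
qed

section \<open>Expectation and variance of walk sums\<close>

definition walks :: "nat \<Rightarrow> nat \<Rightarrow> (nat \<times> (nat \<Rightarrow> int)) set" where
  "walks k n = {z. fst z < n \<and> snd z \<in> steps {..<k} n \<and> closed_walk k n (fst z) (snd z)}"

lemma walks_subset: "walks k n \<subseteq> {..<n} \<times> steps {..<k} n"
  by (auto simp: walks_def)

lemma finite_walks [simp]: "finite (walks k n)"
  by (rule finite_subset[OF walks_subset]) auto

lemma walks_sum_zero: "z \<in> walks k n \<Longrightarrow> (\<Sum>j<k. snd z j) = 0"
  by (auto simp: walks_def closed_walk_def)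

definition value_mult :: "'i set \<Rightarrow> ('i \<Rightarrow> int) \<Rightarrow> nat \<Rightarrow> nat" where
  "value_mult J s y = card {j \<in> J. nat \<bar>s j\<bar> = y}"

text \<open>The common ground of (A1) and (A3): uniform bounds on all moments make the expectations
  of walk products bounded. Assumption (A2) is reached later by truncation.\<close>

locale centered_input = prob_space M for M :: "'a measure" +
  fixes x :: "nat \<Rightarrow> 'a \<Rightarrow> real"
  assumes indep: "indep_vars (\<lambda>_. borel) x UNIV"
    and mean: "\<And>i. expectation (x i) = 0"
    and var: "\<And>i. expectation (\<lambda>\<omega>. (x i \<omega>)\<^sup>2) = 1"
    and moments: "\<And>k. \<exists>C. \<forall>i. integrable M (\<lambda>\<omega>. \<bar>x i \<omega>\<bar> ^ k) \<and> expectation (\<lambda>\<omega>. \<bar>x i \<omega>\<bar> ^ k) \<le> C"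
begin

lemma x_measurable [measurable]: "x i \<in> borel_measurable M"
  using indep unfolding indep_vars_def by auto

lemma integrable_x_power: "integrable M (\<lambda>\<omega>. x i \<omega> ^ k)"
proof -
  have "integrable M (\<lambda>\<omega>. \<bar>x i \<omega>\<bar> ^ k)" using moments[of k] by blast
  then show ?thesis by (rule Bochner_Integration.integrable_bound) (auto simp: power_abs)
qed

definition step_prod :: "'i set \<Rightarrow> ('i \<Rightarrow> int) \<Rightarrow> 'a \<Rightarrow> real" where
  "step_prod J s \<omega> = (\<Prod>j\<in>J. x (nat \<bar>s j\<bar>) \<omega>)"

lemma step_prod_eq:
  assumes "finite J"
  shows "step_prod J s \<omega> = (\<Prod>y\<in>(\<lambda>j. nat \<bar>s j\<bar>) ` J. x y \<omega> ^ value_mult J s y)"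
proof -
  have "step_prod J s \<omega> = (\<Prod>y\<in>(\<lambda>j. nat \<bar>s j\<bar>) ` J. \<Prod>j\<in>{j \<in> J. nat \<bar>s j\<bar> = y}. x (nat \<bar>s j\<bar>) \<omega>)"
    unfolding step_prod_def by (rule prod.image_gen[OF assms])
  also have "\<dots> = (\<Prod>y\<in>(\<lambda>j. nat \<bar>s j\<bar>) ` J. x y \<omega> ^ value_mult J s y)"
    by (intro prod.cong refl) (simp add: value_mult_def)
  finally show ?thesis .
qed

lemma
  assumes "finite J"
  shows integrable_step_prod: "integrable M (step_prod J s)"
    and expectation_step_prod:
      "expectation (step_prod J s) = (\<Prod>y\<in>(\<lambda>j. nat \<bar>s j\<bar>) ` J. expectation (\<lambda>\<omega>. x y \<omega> ^ value_mult J s y))"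
proof -
  have ind: "indep_vars (\<lambda>_. borel) (\<lambda>y \<omega>. x y \<omega> ^ value_mult J s y) ((\<lambda>j. nat \<bar>s j\<bar>) ` J)"
    by (rule indep_vars_compose2[OF indep_vars_subset[OF indep subset_UNIV], where Y = "\<lambda>y r. r ^ value_mult J s y"]) simp
  have eq: "step_prod J s = (\<lambda>\<omega>. \<Prod>y\<in>(\<lambda>j. nat \<bar>s j\<bar>) ` J. x y \<omega> ^ value_mult J s y)"
    using step_prod_eq[OF assms] by blast
  show "integrable M (step_prod J s)"
    unfolding eq using assms by (intro indep_vars_integrable ind integrable_x_power) auto
  show "expectation (step_prod J s) = (\<Prod>y\<in>(\<lambda>j. nat \<bar>s j\<bar>) ` J. expectation (\<lambda>\<omega>. x y \<omega> ^ value_mult J s y))"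
    unfolding eq using assms by (intro indep_vars_lebesgue_integral ind integrable_x_power) auto
qed

lemma expectation_step_prod_single:
  assumes "finite J" "\<not> no_single J s"
  shows "expectation (step_prod J s) = 0"
proof -
  obtain j where j: "j \<in> J" "\<And>i. i \<in> J \<Longrightarrow> i \<noteq> j \<Longrightarrow> \<bar>s i\<bar> \<noteq> \<bar>s j\<bar>"
    using assms(2) by (auto simp: no_single_def)
  have "{i \<in> J. nat \<bar>s i\<bar> = nat \<bar>s j\<bar>} = {j}" using j by (auto simp: eq_nat_nat_iff)
  then have "value_mult J s (nat \<bar>s j\<bar>) = 1" by (simp add: value_mult_def)
  then have "expectation (\<lambda>\<omega>. x (nat \<bar>s j\<bar>) \<omega> ^ value_mult J s (nat \<bar>s j\<bar>)) = 0" using mean by simp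
  then show ?thesis unfolding expectation_step_prod[OF assms(1)] using assms(1) j(1)
    by (intro prod_zero) auto
qed

text \<open>Every input index occurs with exponent 2, so the expectation is a product of variances
  1, whatever the laws of the inputs.\<close>

lemma expectation_step_prod_paired:
  assumes "finite J" "opposite_paired J s"
  shows "expectation (step_prod J s) = 1"
proof -
  have "value_mult J s y = 2" if y: "y \<in> (\<lambda>j. nat \<bar>s j\<bar>) ` J" for y
  proof -
    obtain j where j: "j \<in> J" "y = nat \<bar>s j\<bar>" using y by auto
    have nz: "s j \<noteq> 0" and "- s j \<in> s ` J" using assms(2) j(1) by (auto simp: opposite_paired_def)
    then obtain i where i: "i \<in> J" "s i = - s j" by (metis imageE)
    have inj: "inj_on s J" using assms(2) by (simp add: opposite_paired_def)
    have "{l \<in> J. nat \<bar>s l\<bar> = y} = {j, i}"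
    proof (intro equalityI subsetI)
      fix l assume "l \<in> {l \<in> J. nat \<bar>s l\<bar> = y}"
      then have l: "l \<in> J" "\<bar>s l\<bar> = \<bar>s j\<bar>" using j by auto
      then have "s l = s j \<or> s l = s i" using i by (auto simp: abs_eq_iff)
      then show "l \<in> {j, i}" using inj l(1) i(1) j(1) by (auto dest: inj_onD)
    qed (use i j in auto)
    moreover have "j \<noteq> i" using i nz by auto
    ultimately show ?thesis by (simp add: value_mult_def)
  qed
  then show ?thesis unfolding expectation_step_prod[OF assms(1)] by (simp add: var)
qed

lemma expectation_step_prod_disjoint:
  assumes "finite A" "finite B" "A \<inter> B = {}" "\<And>a b. a \<in> A \<Longrightarrow> b \<in> B \<Longrightarrow> \<bar>s a\<bar> \<noteq> \<bar>s b\<bar>"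
  shows "expectation (step_prod (A \<union> B) s) = expectation (step_prod A s) * expectation (step_prod B s)"
proof -
  let ?f = "\<lambda>j. nat \<bar>s j\<bar>"
  have ne: "nat \<bar>s a\<bar> \<noteq> nat \<bar>s b\<bar>" if "a \<in> A" "b \<in> B" for a b using assms(4)[OF that] by auto
  have A: "value_mult (A \<union> B) s y = value_mult A s y" if "y \<in> ?f ` A" for y
    unfolding value_mult_def using that ne by (intro arg_cong[where f = card]) fastforce
  have B: "value_mult (A \<union> B) s y = value_mult B s y" if "y \<in> ?f ` B" for y
    unfolding value_mult_def using that ne by (intro arg_cong[where f = card]) fastforce
  have AB: "?f ` (A \<union> B) = ?f ` A \<union> ?f ` B" by (rule image_Un)
  have "finite (A \<union> B)" using assms by simp
  then have "expectation (step_prod (A \<union> B) s)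
      = (\<Prod>y\<in>?f ` A \<union> ?f ` B. expectation (\<lambda>\<omega>. x y \<omega> ^ value_mult (A \<union> B) s y))"
    using expectation_step_prod[of "A \<union> B" s] AB by simp
  also have "\<dots> = (\<Prod>y\<in>?f ` A. expectation (\<lambda>\<omega>. x y \<omega> ^ value_mult (A \<union> B) s y))
      * (\<Prod>y\<in>?f ` B. expectation (\<lambda>\<omega>. x y \<omega> ^ value_mult (A \<union> B) s y))"
  proof (rule prod.union_disjoint)
    show "?f ` A \<inter> ?f ` B = {}" using ne by fast
  qed (use assms in auto)
  also have "(\<Prod>y\<in>?f ` A. expectation (\<lambda>\<omega>. x y \<omega> ^ value_mult (A \<union> B) s y)) = expectation (step_prod A s)"
    unfolding expectation_step_prod[OF assms(1)] by (rule prod.cong) (simp_all only: A)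
  also have "(\<Prod>y\<in>?f ` B. expectation (\<lambda>\<omega>. x y \<omega> ^ value_mult (A \<union> B) s y)) = expectation (step_prod B s)"
    unfolding expectation_step_prod[OF assms(2)] by (rule prod.cong) (simp_all only: B)
  finally show ?thesis .
qed

lemma expectation_step_prod_bound:
  obtains B where "B \<ge> 0" "\<And>(J :: 'i set) s. finite J \<Longrightarrow> card J \<le> k \<Longrightarrow> \<bar>expectation (step_prod J s)\<bar> \<le> B"
proof -
  obtain C where C: "\<And>l i. expectation (\<lambda>\<omega>. \<bar>x i \<omega>\<bar> ^ l) \<le> C l" using moments by metis
  \<comment> \<open>Adding 1 ensures \<open>D >= 1\<close>, so that the power over the distinct
    indices can be enlarged to \<open>D ^ k\<close>, uniformly in \<open>J\<close> and
    \<open>s\<close>.\<close>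
  define D where "D = (\<Sum>l\<le>k. \<bar>C l\<bar>) + 1"
  have D1: "D \<ge> 1" by (simp add: D_def sum_nonneg)
  have DC: "expectation (\<lambda>\<omega>. \<bar>x i \<omega>\<bar> ^ l) \<le> D" if "l \<le> k" for i l
    using C[of i l] member_le_sum[of l "{..k}" "\<lambda>l. \<bar>C l\<bar>"] that by (simp add: D_def)
  have "\<bar>expectation (step_prod J s)\<bar> \<le> D ^ k" if J: "finite J" "card J \<le> k" for J :: "'i set" and s
  proof -
    let ?I = "(\<lambda>j. nat \<bar>s j\<bar>) ` J"
    have "\<bar>expectation (step_prod J s)\<bar> = (\<Prod>y\<in>?I. \<bar>expectation (\<lambda>\<omega>. x y \<omega> ^ value_mult J s y)\<bar>)"
      unfolding expectation_step_prod[OF J(1)] by (rule abs_prod)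
    also have "\<dots> \<le> (\<Prod>y\<in>?I. D)"
    proof (intro prod_mono conjI)
      fix y
      have "value_mult J s y \<le> k" unfolding value_mult_def using J card_mono[of J "{j \<in> J. nat \<bar>s j\<bar> = y}"] by auto
      moreover have "\<bar>expectation (\<lambda>\<omega>. x y \<omega> ^ value_mult J s y)\<bar> \<le> expectation (\<lambda>\<omega>. \<bar>x y \<omega>\<bar> ^ value_mult J s y)"
        using integral_abs_bound[of M "\<lambda>\<omega>. x y \<omega> ^ value_mult J s y"] by (simp add: power_abs)
      ultimately show "\<bar>expectation (\<lambda>\<omega>. x y \<omega> ^ value_mult J s y)\<bar> \<le> D" using DC[of "value_mult J s y" y] by linarith
    qed simp
    also have "\<dots> = D ^ card ?I" by simp
    also have "\<dots> \<le> D ^ k"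
      using D1 card_image_le[OF J(1), of "\<lambda>j. nat \<bar>s j\<bar>"] J(2) by (intro power_increasing) auto
    finally show ?thesis .
  qed
  then show ?thesis using that[of "D ^ k"] D1 by simp
qed

text \<open>The weight is left abstract: the estimates below ask at most for modulus bounded by 1
  and value 1 on opposite-paired steps, so that they serve both matrix ensembles.\<close>

definition walk_sum :: "nat \<Rightarrow> ((nat \<Rightarrow> int) \<Rightarrow> real) \<Rightarrow> nat \<Rightarrow> 'a \<Rightarrow> real" where
  "walk_sum k w n \<omega> = (\<Sum>z\<in>walks k n. w (snd z) * step_prod {..<k} (snd z) \<omega>)"

lemma expectation_walk_sum:
  "expectation (walk_sum k w n) = (\<Sum>z\<in>walks k n. w (snd z) * expectation (step_prod {..<k} (snd z)))"
  unfolding walk_sum_def by (subst Bochner_Integration.integral_sum) (auto intro!: integrable_mult_right integrable_step_prod)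

lemma sum_walk_count:
  "(\<Sum>p\<in>pairings k. walk_count k p n) = (\<Sum>z\<in>walks k n. card {p \<in> pairings k. pair_opposite k p (snd z)})"
proof -
  have "walk_count k p n = (\<Sum>z\<in>walks k n. of_bool (pair_opposite k p (snd z)))" for p
  proof -
    have "{(i, s). i < n \<and> s \<in> steps {..<k} n \<and> pair_opposite k p s \<and> closed_walk k n i s} = walks k n \<inter> {z. pair_opposite k p (snd z)}"
      by (auto simp: walks_def)
    then show ?thesis by (simp add: walk_count_def of_bool_def sum.If_cases)
  qed
  then have "(\<Sum>p\<in>pairings k. walk_count k p n) = (\<Sum>p\<in>pairings k. \<Sum>z\<in>walks k n. of_bool (pair_opposite k p (snd z)))"
    by (rule sum.cong[OF refl])
  also have "\<dots> = (\<Sum>z\<in>walks k n. \<Sum>p\<in>pairings k. of_bool (pair_opposite k p (snd z)))"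
    by (rule sum.swap)
  also have "\<dots> = (\<Sum>z\<in>walks k n. card {p \<in> pairings k. pair_opposite k p (snd z)})"
    by (intro sum.cong refl) (simp add: of_bool_def sum.If_cases Int_def)
  finally show ?thesis .
qed

text \<open>Termwise comparison of the weighted expectation with the number of matchings that a walk
  obeys. Both are 1 on opposite-paired walks and 0 on walks with a single value; the remaining walks
  are few.\<close>

lemma expectation_walk_sum_approx:
  assumes "k \<ge> 1"
  obtains C where "C \<ge> 0"
    "\<And>w n. (\<And>s. \<bar>w s\<bar> \<le> 1) \<Longrightarrow> (\<And>s. opposite_paired {..<k} s \<Longrightarrow> w s = 1) \<Longrightarrow>
      \<bar>expectation (walk_sum k w n) - real (\<Sum>p\<in>pairings k. walk_count k p n)\<bar>
        \<le> C * (real n * (real n + 1) ^ ((k - 1) div 2))"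
proof -
  obtain B where B: "B \<ge> 0" "\<And>(J :: nat set) s. finite J \<Longrightarrow> card J \<le> k \<Longrightarrow> \<bar>expectation (step_prod J s)\<bar> \<le> B"
    using expectation_step_prod_bound[of k] by blast
  \<comment> \<open>A degenerate walk may obey several matchings, at most \<open>P\<close>; together
    with the bound \<open>B\<close> for its expectation this gives the error \<open>B + P\<close>
    per bad walk.\<close>
  define P where "P = real (card (pairings k))"
  define r where "r = (k - 1) div 2"
  define C0 where "C0 = (1 + 2 * k\<^sup>2) * (2 * r + 1) ^ k"
  define C where "C = (B + P) * real C0"
  have "\<bar>expectation (walk_sum k w n) - real (\<Sum>p\<in>pairings k. walk_count k p n)\<bar> \<le> C * (real n * (real n + 1) ^ r)"
    if w: "\<And>s. \<bar>w s\<bar> \<le> 1" "\<And>s. opposite_paired {..<k} s \<Longrightarrow> w s = 1" for w n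
  proof -
    define bad where "bad = {s \<in> steps {..<k} n. no_single {..<k} s \<and> sum s {..<k} = 0 \<and> \<not> opposite_paired {..<k} s}"
    have finbad: "finite bad" by (simp add: bad_def)
    let ?t = "\<lambda>z. w (snd z) * expectation (step_prod {..<k} (snd z)) - real (card {p \<in> pairings k. pair_opposite k p (snd z)})"
    have t: "\<bar>?t z\<bar> \<le> (B + P) * of_bool (snd z \<in> bad)" if z: "z \<in> walks k n" for z
    proof (cases "opposite_paired {..<k} (snd z)")
      case True
      then show ?thesis
        using expectation_step_prod_paired[of "{..<k}" "snd z"] card_pair_opposite[of k "snd z"] w(2) B(1) by (simp add: P_def)
    next
      case no: False
      show ?thesis
      proof (cases "no_single {..<k} (snd z)")
        case True
        then have "snd z \<in> bad" using z no walks_sum_zero[OF z] by (auto simp: bad_def walks_def)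
        moreover have "\<bar>w (snd z) * expectation (step_prod {..<k} (snd z))\<bar> \<le> 1 * B"
          unfolding abs_mult using w(1) B by (intro mult_mono) auto
        moreover have "real (card {p \<in> pairings k. pair_opposite k p (snd z)}) \<le> P"
          unfolding P_def by (simp add: card_mono)
        ultimately show ?thesis by simp
      next
        case False
        then have none: "{p \<in> pairings k. pair_opposite k p (snd z)} = {}" using pair_opposite_no_single by blast
        have e: "expectation (step_prod {..<k} (snd z)) = 0"
          using expectation_step_prod_single[of "{..<k}" "snd z"] False by simp
        have "?t z = 0" unfolding none e by simp
        moreover have "0 \<le> (B + P) * of_bool (snd z \<in> bad)" using B(1) by (simp add: P_def)
        ultimately show ?thesis by linarith
      qed
    qed
    have "expectation (walk_sum k w n) - real (\<Sum>p\<in>pairings k. walk_count k p n) = (\<Sum>z\<in>walks k n. ?t z)"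
      unfolding expectation_walk_sum sum_walk_count by (simp add: sum_subtractf)
    also have "\<bar>\<dots>\<bar> \<le> (\<Sum>z\<in>walks k n. (B + P) * of_bool (snd z \<in> bad))"
      by (intro order.trans[OF sum_abs] sum_mono t)
    also have "\<dots> = (B + P) * real (card {z \<in> walks k n. snd z \<in> bad})"
      by (simp add: sum_distrib_left[symmetric] of_bool_def sum.If_cases Int_def)
    also have "\<dots> \<le> (B + P) * real (n * (C0 * (n + 1) ^ r))"
    proof -
      have "card {z \<in> walks k n. snd z \<in> bad} \<le> card ({..<n} \<times> bad)"
        using walks_subset[of k n] finbad by (intro card_mono) auto
      also have "\<dots> \<le> n * (C0 * (n + 1) ^ r)"
      proof -
        have "card bad \<le> C0 * (n + 1) ^ r"
          using card_not_opposite_paired[OF finite_lessThan[of k], of n]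
          unfolding bad_def C0_def r_def card_lessThan by (simp only: mult.assoc)
        then show ?thesis by (simp add: card_cartesian_product)
      qed
      finally show ?thesis using B(1) by (intro mult_left_mono) (simp_all only: of_nat_le_iff, simp add: P_def)
    qed
    also have "\<dots> = C * (real n * (real n + 1) ^ r)" by (simp add: C_def algebra_simps)
    finally show ?thesis .
  qed
  then show ?thesis using that[of C] B(1) by (simp add: C_def P_def r_def)
qed

text \<open>Two walks are joined to a step function on \<open>nat + nat\<close>. Their covariance vanishes unless the joined steps
  have no single value and a step of one walk agrees up to sign with a step of the other.\<close>

lemma variance_walk_sum_bound:
  assumes "k \<ge> 1"
  obtains C where "C \<ge> 0"
    "\<And>w n. (\<And>s. \<bar>w s\<bar> \<le> 1) \<Longrightarrow> integrable M (\<lambda>\<omega>. (walk_sum k w n \<omega> - expectation (walk_sum k w n))\<^sup>2)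
      \<and> expectation (\<lambda>\<omega>. (walk_sum k w n \<omega> - expectation (walk_sum k w n))\<^sup>2) \<le> C * ((real n)\<^sup>2 * (real n + 1) ^ (k - 1))"
proof -
  let ?A = "Inl ` {..<k} :: (nat + nat) set" and ?B = "Inr ` {..<k} :: (nat + nat) set"
  have AB: "finite ?A" "finite ?B" "?A \<inter> ?B = {}" by auto
  have cAB: "card (?A \<union> ?B) = 2 * k"
    using card_Un_disjoint[OF AB] by (simp add: card_image)
  obtain B where B: "B \<ge> 0" "\<And>(J :: (nat + nat) set) s. finite J \<Longrightarrow> card J \<le> 2 * k \<Longrightarrow> \<bar>expectation (step_prod J s)\<bar> \<le> B"
    using expectation_step_prod_bound[of "2 * k"] by blast
  define C0 where "C0 = (1 + 8 * k\<^sup>2) * (2 * k + 1) ^ (2 * k)"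
  define C where "C = (B + B\<^sup>2) * real C0"
  define join :: "(nat \<Rightarrow> int) \<Rightarrow> (nat \<Rightarrow> int) \<Rightarrow> nat + nat \<Rightarrow> int"
    where "join s s' = (\<lambda>j\<in>?A \<union> ?B. case_sum s s' j)" for s s'
  have joinA: "step_prod ?A (join s s') = step_prod {..<k} s" for s s'
    by (rule ext) (simp add: step_prod_def join_def prod.reindex)
  have joinB: "step_prod ?B (join s s') = step_prod {..<k} s'" for s s'
    by (rule ext) (simp add: step_prod_def join_def prod.reindex)
  have join: "step_prod (?A \<union> ?B) (join s s') \<omega> = step_prod {..<k} s \<omega> * step_prod {..<k} s' \<omega>" for s s' \<omega>
  proof -
    have "step_prod (?A \<union> ?B) (join s s') \<omega> = step_prod ?A (join s s') \<omega> * step_prod ?B (join s s') \<omega>"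
      unfolding step_prod_def by (rule prod.union_disjoint[OF AB])
    then show ?thesis by (simp only: joinA joinB)
  qed
  define cov where "cov s s' = expectation (\<lambda>\<omega>. (step_prod {..<k} s \<omega> - expectation (step_prod {..<k} s)) *
      (step_prod {..<k} s' \<omega> - expectation (step_prod {..<k} s')))" for s s'
  have intX: "integrable M (step_prod {..<k} s)" for s by (rule integrable_step_prod) simp
  have intXX: "integrable M (\<lambda>\<omega>. step_prod {..<k} s \<omega> * step_prod {..<k} s' \<omega>)" for s s'
    using integrable_step_prod[of "?A \<union> ?B" "join s s'"] unfolding join[symmetric] by simp
  have intcov: "integrable M (\<lambda>\<omega>. (step_prod {..<k} s \<omega> - expectation (step_prod {..<k} s)) *
      (step_prod {..<k} s' \<omega> - expectation (step_prod {..<k} s')))" for s s'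
    unfolding left_diff_distrib right_diff_distrib using intX intXX
    by (intro Bochner_Integration.integrable_diff integrable_mult_right integrable_mult_left) auto
  have cov: "cov s s' = expectation (step_prod (?A \<union> ?B) (join s s'))
      - expectation (step_prod ?A (join s s')) * expectation (step_prod ?B (join s s'))" for s s'
    unfolding cov_def joinA joinB join[THEN ext] left_diff_distrib right_diff_distrib using intX intXX
    by (simp add: prob_space algebra_simps)
  have cov_le: "\<bar>cov s s'\<bar> \<le> B + B\<^sup>2" for s s'
  proof -
    have "card ?A \<le> 2 * k" "card ?B \<le> 2 * k" by (simp_all add: card_image)
    then have "\<bar>expectation (step_prod ?A (join s s'))\<bar> * \<bar>expectation (step_prod ?B (join s s'))\<bar> \<le> B * B"
      using B by (intro mult_mono) auto
    moreover have "\<bar>expectation (step_prod (?A \<union> ?B) (join s s'))\<bar> \<le> B" using cAB B(2)[of "?A \<union> ?B"] by simp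
    ultimately show ?thesis unfolding cov abs_mult[symmetric] power2_eq_square by linarith
  qed
  have cov0: "cov s s' = 0" if "\<not> (\<exists>a\<in>?A. \<exists>b\<in>?B. \<bar>join s s' a\<bar> = \<bar>join s s' b\<bar>)" for s s'
    using expectation_step_prod_disjoint[OF AB, of "join s s'"] that unfolding cov by auto
  \<comment> \<open>A value that is single in the joined walk is single in its own half, so the
    joint mean and the product of the means both vanish.\<close>
  have cov1: "cov s s' = 0" if ns: "\<not> no_single (?A \<union> ?B) (join s s')" for s s'
  proof -
    have "no_single (?A \<union> ?B) (join s s')" if "no_single ?A (join s s')" "no_single ?B (join s s')"
      using that unfolding no_single_def by blast
    then have "\<not> no_single ?A (join s s') \<or> \<not> no_single ?B (join s s')" using ns by blast
    then have "expectation (step_prod ?A (join s s')) * expectation (step_prod ?B (join s s')) = 0"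
      using expectation_step_prod_single[of ?A "join s s'"] expectation_step_prod_single[of ?B "join s s'"] by auto
    then show ?thesis using expectation_step_prod_single[OF _ ns] unfolding cov by simp
  qed
  have "integrable M (\<lambda>\<omega>. (walk_sum k w n \<omega> - expectation (walk_sum k w n))\<^sup>2)
      \<and> expectation (\<lambda>\<omega>. (walk_sum k w n \<omega> - expectation (walk_sum k w n))\<^sup>2) \<le> C * ((real n)\<^sup>2 * (real n + 1) ^ (k - 1))"
    if w: "\<And>s. \<bar>w s\<bar> \<le> 1" for w n
  proof -
    define cross where "cross = {s \<in> steps (?A \<union> ?B) n. no_single (?A \<union> ?B) s \<and> sum s ?A = 0 \<and> (\<exists>a\<in>?A. \<exists>b\<in>?B. \<bar>s a\<bar> = \<bar>s b\<bar>)}"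
    have fincross: "finite cross" by (simp add: cross_def)
    let ?W = "walks k n"
    let ?Z = "\<lambda>z \<omega>. w (snd z) * (step_prod {..<k} (snd z) \<omega> - expectation (step_prod {..<k} (snd z)))"
    have "walk_sum k w n \<omega> - expectation (walk_sum k w n) = (\<Sum>z\<in>?W. ?Z z \<omega>)" for \<omega>
      unfolding expectation_walk_sum by (simp add: walk_sum_def sum_subtractf right_diff_distrib)
    then have sq: "(\<lambda>\<omega>. (walk_sum k w n \<omega> - expectation (walk_sum k w n))\<^sup>2) = (\<lambda>\<omega>. \<Sum>z\<in>?W. \<Sum>z'\<in>?W. w (snd z) * w (snd z') *
        ((step_prod {..<k} (snd z) \<omega> - expectation (step_prod {..<k} (snd z))) *
         (step_prod {..<k} (snd z') \<omega> - expectation (step_prod {..<k} (snd z')))))"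
      by (simp add: power2_eq_square sum_product mult_ac)
    have int: "integrable M (\<lambda>\<omega>. (walk_sum k w n \<omega> - expectation (walk_sum k w n))\<^sup>2)"
      unfolding sq by (intro Bochner_Integration.integrable_sum integrable_mult_right intcov)
    have "expectation (\<lambda>\<omega>. (walk_sum k w n \<omega> - expectation (walk_sum k w n))\<^sup>2)
        = (\<Sum>z\<in>?W. \<Sum>z'\<in>?W. w (snd z) * w (snd z') * cov (snd z) (snd z'))"
      unfolding sq cov_def
      by (subst Bochner_Integration.integral_sum, (intro Bochner_Integration.integrable_sum integrable_mult_right intcov),
          intro sum.cong refl, subst Bochner_Integration.integral_sum, (intro integrable_mult_right intcov), simp)
    also have "\<dots> \<le> (\<Sum>z\<in>?W. \<Sum>z'\<in>?W. (B + B\<^sup>2) * of_bool (join (snd z) (snd z') \<in> cross))"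
    proof (intro sum_mono)
      fix z z' assume z: "z \<in> ?W" "z' \<in> ?W"
      show "w (snd z) * w (snd z') * cov (snd z) (snd z') \<le> (B + B\<^sup>2) * of_bool (join (snd z) (snd z') \<in> cross)"
      proof (cases "cov (snd z) (snd z') = 0")
        case True
        then show ?thesis using B(1) by simp
      next
        case False
        have st: "snd z \<in> steps {..<k} n" "snd z' \<in> steps {..<k} n" using z by (auto simp: walks_def)
        then have "join (snd z) (snd z') \<in> steps (?A \<union> ?B) n" by (auto simp: steps_def join_def PiE_iff)
        moreover have "sum (join (snd z) (snd z')) ?A = 0"
          using walks_sum_zero[OF z(1)] by (simp add: join_def sum.reindex)
        ultimately have cr: "join (snd z) (snd z') \<in> cross" using False cov0 cov1 unfolding cross_def by blast
        have "w (snd z) * w (snd z') * cov (snd z) (snd z') \<le> \<bar>w (snd z)\<bar> * \<bar>w (snd z')\<bar> * \<bar>cov (snd z) (snd z')\<bar>"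
          by (simp add: abs_mult[symmetric])
        also have "\<dots> \<le> (1 * 1) * (B + B\<^sup>2)" using w cov_le by (intro mult_mono) auto
        finally show ?thesis using cr by simp
      qed
    qed
    also have "\<dots> = (\<Sum>p\<in>?W \<times> ?W. (B + B\<^sup>2) * of_bool (join (snd (fst p)) (snd (snd p)) \<in> cross))"
      by (rule trans[OF sum.cartesian_product], rule sum.cong[OF refl]) (simp only: split_beta)
    also have "\<dots> = (B + B\<^sup>2) * real (card {p \<in> ?W \<times> ?W. join (snd (fst p)) (snd (snd p)) \<in> cross})"
    proof -
      have "(\<Sum>p\<in>?W \<times> ?W. of_bool (Q p)) = real (card {p \<in> ?W \<times> ?W. Q p})" for Q
        by (simp add: of_bool_def sum.If_cases Int_def)
      then show ?thesis by (simp only: sum_distrib_left[symmetric])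
    qed
    also have "\<dots> \<le> (B + B\<^sup>2) * real ((n * n) * (C0 * (n + 1) ^ (k - 1)))"
    proof -
      let ?S = "{p \<in> ?W \<times> ?W. join (snd (fst p)) (snd (snd p)) \<in> cross}"
      \<comment> \<open>Two free starting points and a crossing step function determine the pair of
        walks: the points give \<open>n * n\<close>, the steps only order
        \<open>n ^ (k - 1)\<close>.\<close>
      let ?g = "\<lambda>p. ((fst (fst p), fst (snd p)), join (snd (fst p)) (snd (snd p)))"
      have "inj_on ?g ?S"
      proof (rule inj_onI)
        fix p q assume p: "p \<in> ?S" and q: "q \<in> ?S" and eq: "?g p = ?g q"
        have st: "snd (fst p) \<in> {..<k} \<rightarrow>\<^sub>E UNIV" "snd (snd p) \<in> {..<k} \<rightarrow>\<^sub>E UNIV"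
          "snd (fst q) \<in> {..<k} \<rightarrow>\<^sub>E UNIV" "snd (snd q) \<in> {..<k} \<rightarrow>\<^sub>E UNIV"
        proof -
          have sub: "snd (fst r) \<in> {..<k} \<rightarrow>\<^sub>E UNIV \<and> snd (snd r) \<in> {..<k} \<rightarrow>\<^sub>E UNIV" if "r \<in> ?S" for r
          proof -
            have "snd (fst r) \<in> steps {..<k} n" "snd (snd r) \<in> steps {..<k} n"
              using that walks_subset[of k n] by (metis (no_types, lifting) mem_Collect_eq mem_Sigma_iff prod.collapse subsetD)+
            then show ?thesis by (auto simp: steps_def)
          qed
          show "snd (fst p) \<in> {..<k} \<rightarrow>\<^sub>E UNIV" "snd (snd p) \<in> {..<k} \<rightarrow>\<^sub>E UNIV"
            "snd (fst q) \<in> {..<k} \<rightarrow>\<^sub>E UNIV" "snd (snd q) \<in> {..<k} \<rightarrow>\<^sub>E UNIV"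
            using sub[OF p] sub[OF q] by blast+
        qed
        have f: "fst (fst p) = fst (fst q)" "fst (snd p) = fst (snd q)"
          and jj: "join (snd (fst p)) (snd (snd p)) = join (snd (fst q)) (snd (snd q))"
          using eq by (simp_all only: prod.inject)
        have "snd (fst p) = snd (fst q)"
        proof (rule PiE_ext[OF st(1,3)])
          fix i assume "i \<in> {..<k}"
          then show "snd (fst p) i = snd (fst q) i" using fun_cong[OF jj, of "Inl i"] by (simp add: join_def)
        qed
        moreover have "snd (snd p) = snd (snd q)"
        proof (rule PiE_ext[OF st(2,4)])
          fix i assume "i \<in> {..<k}"
          then show "snd (snd p) i = snd (snd q) i" using fun_cong[OF jj, of "Inr i"] by (simp add: join_def)
        qed
        ultimately show "p = q" using f by (simp add: prod_eq_iff)
      qed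
      moreover have "?g ` ?S \<subseteq> ({..<n} \<times> {..<n}) \<times> cross"
      proof (intro image_subsetI)
        fix p assume p: "p \<in> ?S"
        then have "fst p \<in> ?W" "snd p \<in> ?W" by (simp_all add: mem_Times_iff)
        then show "?g p \<in> ({..<n} \<times> {..<n}) \<times> cross" using p by (simp add: walks_def)
      qed
      ultimately have "card ?S \<le> card (({..<n} \<times> {..<n}) \<times> cross)"
        using fincross by (intro card_inj_on_le) auto
      also have "\<dots> \<le> (n * n) * (C0 * (n + 1) ^ (k - 1))"
      proof -
        have "card cross \<le> C0 * (n + 1) ^ (k - 1)"
          using card_crossing[OF AB cAB, of n] unfolding cross_def C0_def by (simp only: mult.assoc)
        then show ?thesis by (simp add: card_cartesian_product)
      qed
      finally show ?thesis using B(1) by (intro mult_left_mono) (simp_all only: of_nat_le_iff, simp)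
    qed
    also have "\<dots> = C * ((real n)\<^sup>2 * (real n + 1) ^ (k - 1))" by (simp add: C_def algebra_simps power2_eq_square)
    finally show ?thesis using int by blast
  qed
  then show ?thesis using that[of C] B(1) by (simp add: C_def)
qed

end

section \<open>Moments of Toeplitz kernels\<close>

text \<open>The argument of \<open>c\<close> is the displacement from row \<open>i\<close> to column
  \<open>l\<close>, so the product of the entries along a walk depends only on its steps.\<close>

definition toeplitz_kernel :: "(int \<Rightarrow> complex) \<Rightarrow> (nat \<Rightarrow> real) \<Rightarrow> nat \<Rightarrow> nat \<Rightarrow> complex" where
  "toeplitz_kernel c a i l = c (int l - int i) * of_real (a (nat \<bar>int l - int i\<bar>))"

definition scaled_kernel :: "(int \<Rightarrow> complex) \<Rightarrow> (nat \<Rightarrow> real) \<Rightarrow> nat \<Rightarrow> nat \<Rightarrow> nat \<Rightarrow> complex" where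
  "scaled_kernel c a n i l = toeplitz_kernel c a i l / of_real (sqrt (real n))"

text \<open>The value \<open>c 0\<close> affects only the diagonal; allowing \<open>c 0 = 0\<close> covers the skew-symmetric case.\<close>

definition phase :: "(int \<Rightarrow> complex) \<Rightarrow> bool" where
  "phase c \<longleftrightarrow> (\<forall>s. c (- s) = cnj (c s)) \<and> (\<forall>s. s \<noteq> 0 \<longrightarrow> cmod (c s) = 1) \<and> cmod (c 0) \<le> 1"

lemma phase_le_1: "phase c \<Longrightarrow> cmod (c s) \<le> 1"
  by (cases "s = 0") (auto simp: phase_def)

lemma phase_mult_neg: "phase c \<Longrightarrow> s \<noteq> 0 \<Longrightarrow> c s * c (- s) = 1"
  by (simp add: phase_def complex_norm_square[symmetric])

lemma hermitian_toeplitz_kernel: "phase c \<Longrightarrow> toeplitz_kernel c a l i = cnj (toeplitz_kernel c a i l)"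
proof -
  assume "phase c"
  then have "c (int i - int l) = cnj (c (int l - int i))" unfolding phase_def by (metis minus_diff_eq)
  then show ?thesis by (simp add: toeplitz_kernel_def abs_minus_commute)
qed

fun kernel_power :: "(nat \<Rightarrow> nat \<Rightarrow> complex) \<Rightarrow> nat \<Rightarrow> nat \<Rightarrow> nat \<Rightarrow> nat \<Rightarrow> complex" where
  "kernel_power a n 0 i l = of_bool (i = l)"
| "kernel_power a n (Suc k) i l = (\<Sum>m<n. kernel_power a n k i m * a m l)"

lemma kernel_power_eigenbasis:
  assumes e: "eigenbasis n a u lam" and "i < n" "l < n"
  shows "kernel_power a n k i l = (\<Sum>j<n. of_real (lam j) ^ k * u j i * cnj (u j l))"
  using \<open>l < n\<close>
proof (induction k arbitrary: l)
  case 0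
  then show ?case using eigenbasis_complete[OF e \<open>i < n\<close>, of l] by simp
next
  case (Suc k)
  have "kernel_power a n (Suc k) i l = (\<Sum>m<n. (\<Sum>j<n. of_real (lam j) ^ k * u j i * cnj (u j m)) * a m l)"
    using Suc.IH by simp
  also have "\<dots> = (\<Sum>j<n. of_real (lam j) ^ k * u j i * (\<Sum>m<n. cnj (u j m) * a m l))"
    unfolding sum_distrib_left sum_distrib_right by (subst sum.swap) (simp add: mult_ac)
  also have "\<dots> = (\<Sum>j<n. of_real (lam j) ^ k * u j i * (of_real (lam j) * cnj (u j l)))"
    using eigenbasis_left[OF e Suc.prems] by (intro sum.cong) auto
  finally show ?case by (simp add: mult_ac)
qed

lemma trace_kernel_power:
  assumes e: "eigenbasis n a u lam"
  shows "(\<Sum>i<n. kernel_power a n k i i) = of_real (\<Sum>j<n. lam j ^ k)"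
proof -
  have "(\<Sum>i<n. kernel_power a n k i i) = (\<Sum>i<n. \<Sum>j<n. of_real (lam j) ^ k * u j i * cnj (u j i))"
    using kernel_power_eigenbasis[OF e] by simp
  also have "\<dots> = (\<Sum>j<n. of_real (lam j) ^ k * (\<Sum>i<n. u j i * cnj (u j i)))"
    unfolding sum_distrib_left by (subst sum.swap) (simp add: mult.assoc)
  also have "\<dots> = (\<Sum>j<n. of_real (lam j) ^ k)" using eigenbasis_orth[OF e] by simp
  finally show ?thesis by simp
qed

lemma kernel_power_divide: "kernel_power (\<lambda>i l. a i l / z) n k i l = kernel_power a n k i l / z ^ k"
  by (induction k arbitrary: l) (simp_all add: sum_divide_distrib mult.commute)

lemma sum_steps_Suc:
  "(\<Sum>s\<in>steps {..<Suc k} n. F s) = (\<Sum>s\<in>steps {..<k} n. \<Sum>t\<in>{- int n..int n}. F (s(k := t)))"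
proof -
  let ?T = "{- int n..int n}"
  have img: "steps {..<Suc k} n = (\<lambda>(t, s). s(k := t)) ` (?T \<times> steps {..<k} n)"
    unfolding steps_def lessThan_Suc PiE_insert_eq ..
  have inj: "inj_on (\<lambda>(t, s). s(k := t)) (?T \<times> steps {..<k} n)"
    unfolding steps_def by (rule inj_combinator) simp
  have "(\<Sum>s\<in>steps {..<Suc k} n. F s) = (\<Sum>(t, s)\<in>?T \<times> steps {..<k} n. F (s(k := t)))"
    unfolding img sum.reindex[OF inj] by (simp add: o_def split_beta)
  also have "\<dots> = (\<Sum>t\<in>?T. \<Sum>s\<in>steps {..<k} n. F (s(k := t)))" by (rule sum.cartesian_product[symmetric])
  also have "\<dots> = (\<Sum>s\<in>steps {..<k} n. \<Sum>t\<in>?T. F (s(k := t)))" by (rule sum.swap)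
  finally show ?thesis .
qed

text \<open>When the power is expanded, the intermediate indices are recorded as displacements; the
  demand that all partial positions stay in range replaces the bounds of the summation.\<close>

lemma kernel_power_walks:
  assumes "i < n" "l < n"
  shows "kernel_power (toeplitz_kernel c a) n k i l = (\<Sum>s\<in>steps {..<k} n.
     of_bool ((\<forall>q\<le>k. 0 \<le> int i + (\<Sum>m<q. s m) \<and> int i + (\<Sum>m<q. s m) < int n) \<and> int i + (\<Sum>m<k. s m) = int l)
       * (\<Prod>j<k. c (s j) * of_real (a (nat \<bar>s j\<bar>))))"
  using \<open>l < n\<close>
proof (induction k arbitrary: l)
  case 0
  have "steps {..<0::nat} n = {\<lambda>_. undefined}" by (auto simp: steps_def)
  then show ?case using assms by simp
next
  case (Suc k)
  define stay where "stay s \<longleftrightarrow> (\<forall>q\<le>k. 0 \<le> int i + (\<Sum>m<q. s m) \<and> int i + (\<Sum>m<q. s m) < int n)" for s :: "nat \<Rightarrow> int"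
  define e where "e s = int i + (\<Sum>m<k. s m)" for s :: "nat \<Rightarrow> int"
  define P where "P s = (\<Prod>j<k. c (s j) * of_real (a (nat \<bar>s j\<bar>)))" for s :: "nat \<Rightarrow> int"
  have e: "0 \<le> e s \<and> e s < int n" if "stay s" for s using that by (auto simp: stay_def e_def)
  have "kernel_power (toeplitz_kernel c a) n (Suc k) i l
    = (\<Sum>m<n. \<Sum>s\<in>steps {..<k} n. of_bool (stay s \<and> e s = int m) * P s * toeplitz_kernel c a m l)"
  proof -
    have "kernel_power (toeplitz_kernel c a) n k i m = (\<Sum>s\<in>steps {..<k} n. of_bool (stay s \<and> e s = int m) * P s)"
      if "m < n" for m
      unfolding stay_def e_def P_def by (rule Suc.IH[OF that])
    then show ?thesis
      by (simp only: kernel_power.simps) (intro sum.cong refl, simp only: lessThan_iff sum_distrib_right)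
  qed
  also have "\<dots> = (\<Sum>s\<in>steps {..<k} n. \<Sum>m<n. of_bool (stay s \<and> e s = int m) * P s * toeplitz_kernel c a m l)"
    by (rule sum.swap)
  also have "\<dots> = (\<Sum>s\<in>steps {..<k} n. of_bool (stay s) * P s * toeplitz_kernel c a (nat (e s)) l)"
  proof (intro sum.cong refl)
    fix s
    show "(\<Sum>m<n. of_bool (stay s \<and> e s = int m) * P s * toeplitz_kernel c a m l)
        = of_bool (stay s) * P s * toeplitz_kernel c a (nat (e s)) l"
    proof (cases "stay s")
      case True
      have "(\<Sum>m<n. of_bool (stay s \<and> e s = int m) * P s * toeplitz_kernel c a m l)
        = (\<Sum>m<n. if m = nat (e s) then P s * toeplitz_kernel c a m l else 0)"
        using True e[OF True] by (intro sum.cong) auto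
      moreover have "nat (e s) < n" using e[OF True] by linarith
      ultimately show ?thesis using True by simp
    qed simp
  qed
  also have "\<dots> = (\<Sum>s\<in>steps {..<k} n. \<Sum>t\<in>{- int n..int n}.
      of_bool (stay s \<and> e s + t = int l) * (P s * (c t * of_real (a (nat \<bar>t\<bar>)))))"
  proof (intro sum.cong refl)
    fix s
    show "of_bool (stay s) * P s * toeplitz_kernel c a (nat (e s)) l
      = (\<Sum>t\<in>{- int n..int n}. of_bool (stay s \<and> e s + t = int l) * (P s * (c t * of_real (a (nat \<bar>t\<bar>)))))"
    proof (cases "stay s")
      case True
      have "(\<Sum>t\<in>{- int n..int n}. of_bool (stay s \<and> e s + t = int l) * (P s * (c t * of_real (a (nat \<bar>t\<bar>)))))
        = (\<Sum>t\<in>{- int n..int n}. if t = int l - e s then P s * (c t * of_real (a (nat \<bar>t\<bar>))) else 0)"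
        using True by (intro sum.cong) auto
      moreover have "int l - e s \<in> {- int n..int n}" using e[OF True] Suc.prems by auto
      ultimately show ?thesis using True e[OF True] by (simp add: toeplitz_kernel_def)
    qed simp
  qed
  also have "\<dots> = (\<Sum>s\<in>steps {..<k} n. \<Sum>t\<in>{- int n..int n}.
      of_bool ((\<forall>q\<le>Suc k. 0 \<le> int i + (\<Sum>m<q. (s(k := t)) m) \<and> int i + (\<Sum>m<q. (s(k := t)) m) < int n)
          \<and> int i + (\<Sum>m<Suc k. (s(k := t)) m) = int l)
       * (\<Prod>j<Suc k. c ((s(k := t)) j) * of_real (a (nat \<bar>(s(k := t)) j\<bar>))))"
  proof (intro sum.cong refl)
    fix s :: "nat \<Rightarrow> int" and t :: int
    have part: "(\<Sum>m<q. (s(k := t)) m) = (\<Sum>m<q. s m)" if "q \<le> k" for q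
      using that by (intro sum.cong) auto
    have full: "int i + (\<Sum>m<Suc k. (s(k := t)) m) = e s + t" using part[of k] by (simp add: e_def)
    have "(\<forall>q\<le>Suc k. 0 \<le> int i + (\<Sum>m<q. (s(k := t)) m) \<and> int i + (\<Sum>m<q. (s(k := t)) m) < int n)
          \<and> int i + (\<Sum>m<Suc k. (s(k := t)) m) = int l \<longleftrightarrow> stay s \<and> e s + t = int l"
      unfolding full le_Suc_eq stay_def using part full Suc.prems by auto
    moreover have "(\<Prod>j<Suc k. c ((s(k := t)) j) * of_real (a (nat \<bar>(s(k := t)) j\<bar>))) = P s * (c t * of_real (a (nat \<bar>t\<bar>)))"
      unfolding P_def by (simp add: prod.lessThan_Suc)
    ultimately show "of_bool (stay s \<and> e s + t = int l) * (P s * (c t * of_real (a (nat \<bar>t\<bar>)))) =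
      of_bool ((\<forall>q\<le>Suc k. 0 \<le> int i + (\<Sum>m<q. (s(k := t)) m) \<and> int i + (\<Sum>m<q. (s(k := t)) m) < int n)
          \<and> int i + (\<Sum>m<Suc k. (s(k := t)) m) = int l)
       * (\<Prod>j<Suc k. c ((s(k := t)) j) * of_real (a (nat \<bar>(s(k := t)) j\<bar>)))"
      by (simp only:)
  qed
  finally show ?case unfolding sum_steps_Suc .
qed

text \<open>The traces of powers of a Hermitian kernel are real, so taking the real part of each
  phase product does not change the total.\<close>

definition walk_weight :: "(int \<Rightarrow> complex) \<Rightarrow> nat \<Rightarrow> (nat \<Rightarrow> int) \<Rightarrow> real" where
  "walk_weight c k s = Re (\<Prod>j<k. c (s j))"

lemma walk_weight_le_1: "phase c \<Longrightarrow> \<bar>walk_weight c k s\<bar> \<le> 1"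
proof -
  assume "phase c"
  then have "cmod (\<Prod>j<k. c (s j)) \<le> 1"
    unfolding prod_norm[symmetric] by (intro prod_le_1) (auto intro: phase_le_1)
  then show ?thesis unfolding walk_weight_def using abs_Re_le_cmod order.trans by blast
qed

text \<open>Each matched pair contributes \<open>c s * c (- s) = 1\<close>. Opposite-paired steps
  are nonzero, so the diagonal value \<open>c 0\<close> never enters; here the symmetric and
  skew-symmetric ensembles become indistinguishable.\<close>

lemma walk_weight_paired:
  assumes c: "phase c" and s: "opposite_paired {..<k} s"
  shows "walk_weight c k s = 1"
proof -
  have "{p \<in> pairings k. pair_opposite k p s} \<noteq> {}" using card_pair_opposite[OF s] by force
  then obtain p where p: "p \<in> pairings k" and co: "pair_opposite k p s" by blast
  define R where "R = {j. j < k \<and> j < p j}"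
  note op = pairings_openers[OF p, folded R_def]
  have "(\<Prod>j<k. c (s j)) = (\<Prod>j\<in>R \<union> p ` R. c (s j))" by (simp only: op(1)[symmetric])
  also have "\<dots> = (\<Prod>j\<in>R. c (s j)) * (\<Prod>j\<in>p ` R. c (s j))"
    by (rule prod.union_disjoint) (auto simp: R_def op(2)[unfolded R_def])
  also have "(\<Prod>j\<in>p ` R. c (s j)) = (\<Prod>j\<in>R. c (s (p j)))" using op(3) by (simp add: prod.reindex)
  also have "(\<Prod>j\<in>R. c (s j)) * (\<Prod>j\<in>R. c (s (p j))) = (\<Prod>j\<in>R. c (s j) * c (s (p j)))"
    by (rule prod.distrib[symmetric])
  also have "\<dots> = (\<Prod>j\<in>R. 1)"
  proof (rule prod.cong)
    fix j assume "j \<in> R"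
    then have "j < k" by (simp add: R_def)
    then have "s j \<noteq> 0" "s (p j) = - s j" using s co by (auto simp: opposite_paired_def pair_opposite_def)
    then show "c (s j) * c (s (p j)) = 1" using phase_mult_neg[OF c] by simp
  qed simp
  finally show ?thesis by (simp add: walk_weight_def)
qed

theorem power_sum_eigenvalues:
  assumes e: "eigenbasis n (scaled_kernel c a n) u lam"
  shows "(\<Sum>j<n. lam j ^ k)
    = (\<Sum>z\<in>walks k n. walk_weight c k (snd z) * (\<Prod>j<k. a (nat \<bar>snd z j\<bar>))) / sqrt (real n) ^ k"
proof -
  let ?P = "\<lambda>s. \<Prod>j<k. c (s j) * of_real (a (nat \<bar>s j\<bar>))"
  have "(\<Sum>i<n. kernel_power (toeplitz_kernel c a) n k i i) = (\<Sum>i<n. \<Sum>s\<in>steps {..<k} n. of_bool (closed_walk k n i s) * ?P s)"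
    unfolding closed_walk_def by (intro sum.cong refl, subst kernel_power_walks) (auto intro!: sum.cong)
  also have "\<dots> = (\<Sum>z\<in>{..<n} \<times> steps {..<k} n. of_bool (closed_walk k n (fst z) (snd z)) * ?P (snd z))"
    by (rule trans[OF sum.cartesian_product], rule sum.cong[OF refl]) (simp only: split_beta)
  also have "\<dots> = (\<Sum>z\<in>walks k n. ?P (snd z))"
  proof (rule sum.mono_neutral_cong_right)
    show "\<forall>z\<in>{..<n} \<times> steps {..<k} n - walks k n. of_bool (closed_walk k n (fst z) (snd z)) * ?P (snd z) = 0"
      by (auto simp: walks_def)
  qed (use walks_subset in \<open>auto simp: walks_def\<close>)
  finally have tr: "(\<Sum>i<n. kernel_power (toeplitz_kernel c a) n k i i) = (\<Sum>z\<in>walks k n. ?P (snd z))" .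
  have "of_real (\<Sum>j<n. lam j ^ k) = (\<Sum>i<n. kernel_power (scaled_kernel c a n) n k i i)"
    by (rule trace_kernel_power[OF e, symmetric])
  also have "\<dots> = (\<Sum>i<n. kernel_power (toeplitz_kernel c a) n k i i / of_real (sqrt (real n)) ^ k)"
    unfolding scaled_kernel_def[abs_def] by (simp only: kernel_power_divide)
  also have "\<dots> = (\<Sum>z\<in>walks k n. ?P (snd z)) / of_real (sqrt (real n) ^ k)"
    by (simp add: sum_divide_distrib[symmetric] tr)
  finally have "(\<Sum>j<n. lam j ^ k) = Re ((\<Sum>z\<in>walks k n. ?P (snd z)) / of_real (sqrt (real n) ^ k))"
    by (metis Re_complex_of_real)
  also have "\<dots> = (\<Sum>z\<in>walks k n. Re (?P (snd z))) / sqrt (real n) ^ k" by (simp only: Re_divide_of_real Re_sum)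
  also have "(\<Sum>z\<in>walks k n. Re (?P (snd z))) = (\<Sum>z\<in>walks k n. walk_weight c k (snd z) * (\<Prod>j<k. a (nat \<bar>snd z j\<bar>)))"
  proof (intro sum.cong refl)
    fix z
    have "?P (snd z) = (\<Prod>j<k. c (snd z j)) * of_real (\<Prod>j<k. a (nat \<bar>snd z j\<bar>))"
      by (simp add: prod.distrib)
    moreover have "Re (A * of_real B) = Re A * B" for A B by simp
    ultimately show "Re (?P (snd z)) = walk_weight c k (snd z) * (\<Prod>j<k. a (nat \<bar>snd z j\<bar>))"
      by (simp only: walk_weight_def)
  qed
  finally show ?thesis .
qed

lemma sum_power2_eigenvalues:
  assumes e: "eigenbasis n a u lam" and herm: "\<And>i l. i < n \<Longrightarrow> l < n \<Longrightarrow> a l i = cnj (a i l)"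
  shows "(\<Sum>j<n. (lam j)\<^sup>2) = (\<Sum>i<n. \<Sum>l<n. (cmod (a i l))\<^sup>2)"
proof -
  have "complex_of_real (\<Sum>j<n. (lam j)\<^sup>2) = (\<Sum>i<n. kernel_power a n 2 i i)"
    by (rule trace_kernel_power[OF e, symmetric])
  also have "\<dots> = (\<Sum>i<n. \<Sum>m<n. a i m * a m i)"
  proof -
    have "kernel_power a n (Suc 0) i m = a i m" if "i < n" for i m
    proof -
      have "kernel_power a n (Suc 0) i m = (\<Sum>q<n. if q = i then a q m else 0)"
        unfolding kernel_power.simps by (intro sum.cong refl) simp
      then show ?thesis using that by simp
    qed
    then show ?thesis unfolding numeral_2_eq_2 kernel_power.simps(2)[of a n "Suc 0"]
      by (intro sum.cong refl) (simp only: lessThan_iff)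
  qed
  also have "\<dots> = (\<Sum>i<n. \<Sum>m<n. complex_of_real ((cmod (a i m))\<^sup>2))"
  proof (intro sum.cong refl)
    fix i m assume "i \<in> {..<n}" "m \<in> {..<n}"
    then have "a m i = cnj (a i m)" by (intro herm) auto
    then show "a i m * a m i = complex_of_real ((cmod (a i m))\<^sup>2)" by (simp only: complex_norm_square)
  qed
  finally show ?thesis by (simp only: of_real_sum[symmetric] of_real_eq_iff)
qed

section \<open>From moments to characteristic functions\<close>

text \<open>Any choice is good enough, since only symmetric functions of the eigenvalues occur
  below. Probabilistic statements about their moments go through walk sums, which are explicit in
  the input.\<close>

definition toeplitz_ev :: "(int \<Rightarrow> complex) \<Rightarrow> (nat \<Rightarrow> real) \<Rightarrow> nat \<Rightarrow> nat \<Rightarrow> real" where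
  "toeplitz_ev c a n = (SOME lam. \<exists>u. eigenbasis n (scaled_kernel c a n) u lam)"

lemma toeplitz_ev_eigenbasis:
  assumes "phase c"
  obtains u where "eigenbasis n (scaled_kernel c a n) u (toeplitz_ev c a n)"
proof -
  have "scaled_kernel c a n l i = cnj (scaled_kernel c a n i l)" for i l
    unfolding scaled_kernel_def hermitian_toeplitz_kernel[OF assms, of a l i] by simp
  then obtain u lam where "eigenbasis n (scaled_kernel c a n) u lam"
    using hermitian_spectral[of n "scaled_kernel c a n"] by blast
  then have "\<exists>lam u. eigenbasis n (scaled_kernel c a n) u lam" by blast
  then have "\<exists>u. eigenbasis n (scaled_kernel c a n) u (toeplitz_ev c a n)"
    unfolding toeplitz_ev_def by (rule someI_ex)
  then show ?thesis using that by blast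
qed

definition toeplitz_mom :: "(int \<Rightarrow> complex) \<Rightarrow> (nat \<Rightarrow> real) \<Rightarrow> nat \<Rightarrow> nat \<Rightarrow> real" where
  "toeplitz_mom c a n k = (\<Sum>j<n. toeplitz_ev c a n j ^ k) / real n"

definition toeplitz_char :: "(int \<Rightarrow> complex) \<Rightarrow> (nat \<Rightarrow> real) \<Rightarrow> nat \<Rightarrow> real \<Rightarrow> complex" where
  "toeplitz_char c a n t = (\<Sum>j<n. iexp (t * toeplitz_ev c a n j)) / of_nat n"

text \<open>The total mass is set by hand, as the moment theorems concern
  \<open>k > 0\<close>.\<close>

definition limit_moment :: "nat \<Rightarrow> real" where
  "limit_moment k = (if k = 0 then 1 else toeplitz_moment k)"

definition limit_char_approx :: "real \<Rightarrow> nat \<Rightarrow> complex" where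
  "limit_char_approx t K = (\<Sum>j<2 * K. (\<i> * of_real t) ^ j * of_real (limit_moment j) / fact j)"

text \<open>Built from the moments alone. That the partial sums converge, and that the limit is the
  characteristic function of a measure, is shown later.\<close>

definition limit_char :: "real \<Rightarrow> complex" where
  "limit_char t = lim (limit_char_approx t)"

text \<open>Truncation at the even order \<open>2 * K\<close> makes the absolute moment in the
  remainder an ordinary moment, whose limit is known.\<close>

lemma toeplitz_char_taylor:
  assumes n: "n > 0" and K: "K > 0"
  shows "cmod (toeplitz_char c a n t - (\<Sum>j<2 * K. (\<i> * of_real t) ^ j * of_real (toeplitz_mom c a n j) / fact j))
    \<le> \<bar>t\<bar> ^ (2 * K) * toeplitz_mom c a n (2 * K) / fact (2 * K)"
proof -
  let ?e = "toeplitz_ev c a n"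
  have "(\<Sum>j<2 * K. (\<i> * of_real t) ^ j * of_real (toeplitz_mom c a n j) / fact j)
    = (\<Sum>i<n. \<Sum>j<2 * K. (\<i> * of_real (t * ?e i)) ^ j / fact j) / of_nat n"
  proof -
    have "(\<i> * of_real t) ^ j * of_real (toeplitz_mom c a n j) / fact j
        = (\<Sum>i<n. (\<i> * of_real (t * ?e i)) ^ j / fact j) / of_nat n" for j
      by (simp add: toeplitz_mom_def sum_distrib_left sum_divide_distrib power_mult_distrib mult_ac)
    then have "(\<Sum>j<2 * K. (\<i> * of_real t) ^ j * of_real (toeplitz_mom c a n j) / fact j)
        = (\<Sum>j<2 * K. (\<Sum>i<n. (\<i> * of_real (t * ?e i)) ^ j / fact j) / of_nat n)"
      by (rule sum.cong[OF refl])
    also have "\<dots> = (\<Sum>j<2 * K. \<Sum>i<n. (\<i> * of_real (t * ?e i)) ^ j / fact j) / of_nat n"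
      by (rule sum_divide_distrib[symmetric])
    also have "\<dots> = (\<Sum>i<n. \<Sum>j<2 * K. (\<i> * of_real (t * ?e i)) ^ j / fact j) / of_nat n"
      by (rule arg_cong[where f = "\<lambda>z. z / of_nat n"], rule sum.swap)
    finally show ?thesis .
  qed
  then have "toeplitz_char c a n t - (\<Sum>j<2 * K. (\<i> * of_real t) ^ j * of_real (toeplitz_mom c a n j) / fact j)
    = (\<Sum>i<n. iexp (t * ?e i) - (\<Sum>j<2 * K. (\<i> * of_real (t * ?e i)) ^ j / fact j)) / of_nat n"
    by (simp add: toeplitz_char_def sum_subtractf diff_divide_distrib)
  also have "cmod \<dots> \<le> (\<Sum>i<n. \<bar>t * ?e i\<bar> ^ (2 * K) / fact (2 * K)) / real n"
  proof -
    have "cmod (iexp y - (\<Sum>j<2 * K. (\<i> * of_real y) ^ j / fact j)) \<le> \<bar>y\<bar> ^ (2 * K) / fact (2 * K)" for y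
    proof -
      have "{..2 * K - 1} = {..<2 * K}" "Suc (2 * K - 1) = 2 * K" using K by auto
      then show ?thesis using iexp_approx1[of y "2 * K - 1"] by simp
    qed
    then have "cmod (\<Sum>i<n. iexp (t * ?e i) - (\<Sum>j<2 * K. (\<i> * of_real (t * ?e i)) ^ j / fact j))
      \<le> (\<Sum>i<n. \<bar>t * ?e i\<bar> ^ (2 * K) / fact (2 * K))"
      by (intro order.trans[OF norm_sum] sum_mono)
    then show ?thesis unfolding norm_divide norm_of_nat by (rule divide_right_mono) simp
  qed
  also have "\<dots> = \<bar>t\<bar> ^ (2 * K) * toeplitz_mom c a n (2 * K) / fact (2 * K)"
    by (simp add: toeplitz_mom_def abs_mult power_mult_distrib sum_distrib_left sum_divide_distrib power_even_abs mult_ac)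
  finally show ?thesis .
qed

text \<open>The central binomial coefficient is at least 1, so \<open>(2K)! >= (K!)^2\<close>; this
  leaves a term of the exponential series at \<open>48 * t^2\<close>.\<close>

lemma limit_moment_tail: "(\<lambda>K. \<bar>t\<bar> ^ (2 * K) * toeplitz_moment (2 * K) / fact (2 * K)) \<longlonglongrightarrow> 0"
proof (rule Lim_null_comparison)
  have "(\<lambda>K. inverse (fact K) * (48 * t\<^sup>2) ^ K) \<longlonglongrightarrow> 0"
    using summable_exp[of "48 * t\<^sup>2"] by (rule summable_LIMSEQ_zero)
  then show "(\<lambda>K. (48 * t\<^sup>2) ^ K / fact K) \<longlonglongrightarrow> 0" by (simp add: divide_inverse mult.commute)
  have "\<bar>\<bar>t\<bar> ^ (2 * K) * toeplitz_moment (2 * K) / fact (2 * K)\<bar> \<le> (48 * t\<^sup>2) ^ K / fact K" for K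
  proof -
    have f: "fact K * fact K \<le> (fact (2 * K) :: real)"
    proof -
      have "fact K * fact (2 * K - K) * (2 * K choose K) = (fact (2 * K) :: nat)"
        by (rule binomial_fact_lemma) simp
      moreover have "(2 * K choose K) \<ge> 1" using zero_less_binomial[of K "2 * K"] by (simp add: Suc_le_eq)
      ultimately have "fact K * fact K \<le> (fact (2 * K) :: nat)"
        by (metis mult.right_neutral mult_le_mono2 add_diff_cancel_left' mult_2)
      then have "real (fact K * fact K) \<le> real (fact (2 * K))" by (simp only: of_nat_le_iff)
      then show ?thesis by simp
    qed
    have "\<bar>\<bar>t\<bar> ^ (2 * K) * toeplitz_moment (2 * K) / fact (2 * K)\<bar>
      = (t\<^sup>2) ^ K * \<bar>toeplitz_moment (2 * K)\<bar> / fact (2 * K)"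
      by (simp add: abs_mult power_mult)
    also have "\<dots> \<le> (t\<^sup>2) ^ K * (48 ^ K * fact K) / (fact K * fact K)"
      using f toeplitz_moment_even_le[of K] by (intro frac_le mult_left_mono) auto
    also have "\<dots> = (48 * t\<^sup>2) ^ K / fact K" by (simp add: power_mult_distrib)
    finally show ?thesis .
  qed
  then show "\<forall>\<^sub>F K in sequentially. norm (\<bar>t\<bar> ^ (2 * K) * toeplitz_moment (2 * K) / fact (2 * K)) \<le> (48 * t\<^sup>2) ^ K / fact K"
    by simp
qed

text \<open>The remainder is controlled by a moment of the same matrices, so for late
  \<open>r\<close> it is small once the limiting remainder is. No uniform bound on the eigenvalues
  is required.\<close>

lemma toeplitz_char_limit_of_moments:
  assumes N: "\<And>r. N r > 0"
    and mom: "\<And>k. k > 0 \<Longrightarrow> (\<lambda>r. toeplitz_mom c a (N r) k) \<longlonglongrightarrow> toeplitz_moment k"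
  shows "(\<lambda>r. toeplitz_char c a (N r) t) \<longlonglongrightarrow> limit_char t"
proof -
  let ?e = "\<lambda>r. toeplitz_char c a (N r) t"
  let ?S = "limit_char_approx t"
  have mom': "(\<lambda>r. toeplitz_mom c a (N r) k) \<longlonglongrightarrow> limit_moment k" for k
  proof (cases "k = 0")
    case True
    have "toeplitz_mom c a (N r) 0 = 1" for r using N[of r] by (simp add: toeplitz_mom_def)
    then show ?thesis using True by (simp add: limit_moment_def)
  qed (use mom in \<open>simp add: limit_moment_def\<close>)
  have key: "\<exists>K0. \<forall>K\<ge>K0. eventually (\<lambda>r. cmod (?e r - ?S K) < \<epsilon>) sequentially" if e0: "\<epsilon> > 0" for \<epsilon>
  proof -
    obtain K0 where K0: "\<And>K. K \<ge> K0 \<Longrightarrow> \<bar>t\<bar> ^ (2 * K) * toeplitz_moment (2 * K) / fact (2 * K) < \<epsilon> / 2"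
      using order_tendstoD(2)[OF limit_moment_tail[of t], of "\<epsilon> / 2"] e0 by (auto simp: eventually_sequentially)
    show ?thesis
    proof (intro exI[of _ "Suc K0"] allI impI)
      fix K assume K: "Suc K0 \<le> K"
      let ?Sr = "\<lambda>r. \<Sum>j<2 * K. (\<i> * of_real t) ^ j * of_real (toeplitz_mom c a (N r) j) / fact j"
      have "?Sr \<longlonglongrightarrow> ?S K"
        unfolding limit_char_approx_def by (intro tendsto_intros mom') auto
      then have 1: "eventually (\<lambda>r. dist (?Sr r) (?S K) < \<epsilon> / 2) sequentially"
        using e0 by (intro tendstoD) auto
      have "(\<lambda>r. \<bar>t\<bar> ^ (2 * K) * toeplitz_mom c a (N r) (2 * K) / fact (2 * K))
          \<longlonglongrightarrow> \<bar>t\<bar> ^ (2 * K) * toeplitz_moment (2 * K) / fact (2 * K)"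
        using K by (intro tendsto_intros mom) auto
      then have 2: "eventually (\<lambda>r. \<bar>t\<bar> ^ (2 * K) * toeplitz_mom c a (N r) (2 * K) / fact (2 * K) < \<epsilon> / 2) sequentially"
        by (rule order_tendstoD(2)) (use K0[of K] K in simp)
      show "eventually (\<lambda>r. cmod (?e r - ?S K) < \<epsilon>) sequentially"
        using 1 2
      proof eventually_elim
        case (elim r)
        have "cmod (?e r - ?S K) \<le> cmod (?e r - ?Sr r) + cmod (?Sr r - ?S K)"
          using norm_triangle_ineq[of "?e r - ?Sr r" "?Sr r - ?S K"] by simp
        moreover have "cmod (?e r - ?Sr r) \<le> \<bar>t\<bar> ^ (2 * K) * toeplitz_mom c a (N r) (2 * K) / fact (2 * K)"
          by (rule toeplitz_char_taylor[OF N]) (use K in simp)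
        ultimately show ?case using elim unfolding dist_norm by linarith
      qed
    qed
  qed
  \<comment> \<open>Convergence of the series is read off from \<open>key\<close>: two late partial
    sums are both close to \<open>?e r\<close> for a common \<open>r\<close>.\<close>
  have "Cauchy ?S"
  proof (rule metric_CauchyI)
    fix \<epsilon> :: real assume "\<epsilon> > 0"
    then obtain K0 where K0: "\<And>K. K \<ge> K0 \<Longrightarrow> eventually (\<lambda>r. cmod (?e r - ?S K) < \<epsilon> / 2) sequentially"
      using key[of "\<epsilon> / 2"] by auto
    have "dist (?S K) (?S K') < \<epsilon>" if kk: "K \<ge> K0" "K' \<ge> K0" for K K'
    proof -
      obtain r where r: "cmod (?e r - ?S K) < \<epsilon> / 2" "cmod (?e r - ?S K') < \<epsilon> / 2"
        using eventually_happens'[OF _ eventually_conj[OF K0[OF kk(1)] K0[OF kk(2)]]] by auto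
      have "dist (?S K) (?S K') \<le> dist (?S K) (?e r) + dist (?e r) (?S K')" by (rule dist_triangle)
      then show ?thesis using r by (simp add: dist_norm norm_minus_commute)
    qed
    then show "\<exists>M. \<forall>m\<ge>M. \<forall>n\<ge>M. dist (?S m) (?S n) < \<epsilon>" by blast
  qed
  then have S: "?S \<longlonglongrightarrow> limit_char t"
    unfolding limit_char_def by (simp add: Cauchy_convergent_iff convergent_LIMSEQ_iff)
  show ?thesis
  proof (rule tendstoI)
    fix \<epsilon> :: real assume "\<epsilon> > 0"
    then obtain K0 where K0: "\<And>K. K \<ge> K0 \<Longrightarrow> eventually (\<lambda>r. cmod (?e r - ?S K) < \<epsilon> / 2) sequentially"
      using key[of "\<epsilon> / 2"] by auto
    have "eventually (\<lambda>K. dist (?S K) (limit_char t) < \<epsilon> / 2) sequentially"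
      using S \<open>\<epsilon> > 0\<close> by (intro tendstoD) auto
    then obtain K1 where K1: "\<And>K. K \<ge> K1 \<Longrightarrow> dist (?S K) (limit_char t) < \<epsilon> / 2"
      by (auto simp: eventually_sequentially)
    let ?K = "max K0 K1"
    have "eventually (\<lambda>r. cmod (?e r - ?S ?K) < \<epsilon> / 2) sequentially" by (rule K0) simp
    then show "eventually (\<lambda>r. dist (?e r) (limit_char t) < \<epsilon>) sequentially"
    proof eventually_elim
      case (elim r)
      have "dist (?e r) (limit_char t) \<le> dist (?e r) (?S ?K) + dist (?S ?K) (limit_char t)" by (rule dist_triangle)
      moreover have "dist (?S ?K) (limit_char t) < \<epsilon> / 2" by (rule K1) simp
      ultimately show ?case using elim by (simp add: dist_norm)
    qed
  qed
qed

section \<open>Stability under changes of the input and of the dimension\<close>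

lemma iexp_lipschitz: "cmod (iexp (t * y) - iexp (t * z)) \<le> \<bar>t\<bar> * \<bar>y - z\<bar>"
proof -
  have "iexp (t * y) - iexp (t * z) = iexp (t * z) * (iexp (t * (y - z)) - 1)"
    by (simp add: right_diff_distrib flip: exp_add)
  then have "cmod (iexp (t * y) - iexp (t * z)) = cmod (iexp (t * (y - z)) - 1)"
    by (simp only: norm_mult norm_exp_i_times)
  also have "\<dots> \<le> \<bar>t * (y - z)\<bar>" using iexp_approx1[of "t * (y - z)" 0] by simp
  finally show ?thesis by (simp add: abs_mult)
qed

text \<open>Along a row every distance occurs at most twice, once on each side of the
  diagonal.\<close>

lemma sum_abs_diff_le:
  fixes g :: "nat \<Rightarrow> real"
  assumes "i < n" "\<And>d. g d \<ge> 0"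
  shows "(\<Sum>l<n. g (nat \<bar>int l - int i\<bar>)) \<le> 2 * (\<Sum>d<n. g d)"
proof -
  have "{..<n} = {..i} \<union> {i<..<n}" using assms(1) by auto
  then have "(\<Sum>l<n. g (nat \<bar>int l - int i\<bar>)) = (\<Sum>l\<in>{..i}. g (nat \<bar>int l - int i\<bar>)) + (\<Sum>l\<in>{i<..<n}. g (nat \<bar>int l - int i\<bar>))"
    by (simp add: sum.union_disjoint ivl_disj_int)
  also have "(\<Sum>l\<in>{..i}. g (nat \<bar>int l - int i\<bar>)) = (\<Sum>d\<in>{..i}. g d)"
    by (rule sum.reindex_bij_witness[of _ "\<lambda>d. i - d" "\<lambda>l. i - l"]) (auto simp: nat_diff_distrib)
  also have "(\<Sum>l\<in>{i<..<n}. g (nat \<bar>int l - int i\<bar>)) = (\<Sum>d\<in>{0<..<n - i}. g d)"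
    by (rule sum.reindex_bij_witness[of _ "\<lambda>d. d + i" "\<lambda>l. l - i"]) (auto simp: nat_diff_distrib)
  also have "(\<Sum>d\<in>{..i}. g d) + (\<Sum>d\<in>{0<..<n - i}. g d) \<le> (\<Sum>d<n. g d) + (\<Sum>d<n. g d)"
    using assms by (intro add_mono sum_mono2) auto
  finally show ?thesis by simp
qed

text \<open>Each input difference appears in at most \<open>2 * n\<close> entries, and the scaling
  divides its square by \<open>n\<close>. What remains is the mean square difference, which a
  maximal inequality can control for all \<open>n\<close> at once.\<close>

lemma toeplitz_char_diff_input:
  assumes c: "phase c" and n: "n > 0"
  shows "cmod (toeplitz_char c a n t - toeplitz_char c b n t)
    \<le> \<bar>t\<bar> * sqrt (2 * (\<Sum>d<n. (a d - b d)\<^sup>2) / real n)"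
proof -
  obtain u where u: "eigenbasis n (scaled_kernel c a n) u (toeplitz_ev c a n)" using toeplitz_ev_eigenbasis[OF c] .
  obtain v where v: "eigenbasis n (scaled_kernel c b n) v (toeplitz_ev c b n)" using toeplitz_ev_eigenbasis[OF c] .
  define D where "D = (\<Sum>d<n. (a d - b d)\<^sup>2)"
  have "(\<Sum>i<n. \<Sum>l<n. (cmod (scaled_kernel c a n i l - scaled_kernel c b n i l))\<^sup>2)
    \<le> (\<Sum>i<n. \<Sum>l<n. (a (nat \<bar>int l - int i\<bar>) - b (nat \<bar>int l - int i\<bar>))\<^sup>2 / real n)"
  proof (intro sum_mono)
    fix i l
    have "scaled_kernel c a n i l - scaled_kernel c b n i l
      = c (int l - int i) * of_real ((a (nat \<bar>int l - int i\<bar>) - b (nat \<bar>int l - int i\<bar>)) / sqrt (real n))"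
      by (simp add: scaled_kernel_def toeplitz_kernel_def right_diff_distrib diff_divide_distrib)
    also have "(cmod \<dots>)\<^sup>2 = (cmod (c (int l - int i)))\<^sup>2 * ((a (nat \<bar>int l - int i\<bar>) - b (nat \<bar>int l - int i\<bar>))\<^sup>2 / real n)"
      by (simp only: norm_mult norm_of_real power_mult_distrib power2_abs power_divide real_sqrt_pow2 of_nat_0_le_iff)
    also have "\<dots> \<le> 1 * ((a (nat \<bar>int l - int i\<bar>) - b (nat \<bar>int l - int i\<bar>))\<^sup>2 / real n)"
      using phase_le_1[OF c] by (intro mult_right_mono power_le_one) auto
    finally show "(cmod (scaled_kernel c a n i l - scaled_kernel c b n i l))\<^sup>2
      \<le> (a (nat \<bar>int l - int i\<bar>) - b (nat \<bar>int l - int i\<bar>))\<^sup>2 / real n" by simp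
  qed
  also have "\<dots> = (\<Sum>i<n. \<Sum>l<n. (a (nat \<bar>int l - int i\<bar>) - b (nat \<bar>int l - int i\<bar>))\<^sup>2) / real n"
    by (simp only: sum_divide_distrib)
  also have "\<dots> \<le> (\<Sum>i<n. 2 * D) / real n"
    unfolding D_def by (intro divide_right_mono sum_mono sum_abs_diff_le[where g = "\<lambda>d. (a d - b d)\<^sup>2"]) auto
  also have "\<dots> = 2 * D" using n by simp
  finally have HS: "(\<Sum>i<n. \<Sum>l<n. (cmod (scaled_kernel c a n i l - scaled_kernel c b n i l))\<^sup>2) \<le> 2 * D" .
  have "toeplitz_char c a n t - toeplitz_char c b n t
    = ((\<Sum>j<n. iexp (t * toeplitz_ev c a n j)) - (\<Sum>j<n. iexp (t * toeplitz_ev c b n j))) / of_nat n"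
    by (simp add: toeplitz_char_def diff_divide_distrib)
  also have "cmod \<dots> \<le> (\<bar>t\<bar> * sqrt (real n) * sqrt (2 * D)) / real n"
    unfolding norm_divide norm_of_nat
    by (intro divide_right_mono order.trans[OF spectral_sum_diff_le[OF u v iexp_lipschitz abs_ge_zero]] mult_left_mono
        real_sqrt_le_mono HS) auto
  also have "\<dots> = \<bar>t\<bar> * sqrt (2 * D / real n)"
    using n by (simp add: real_sqrt_divide real_sqrt_mult field_simps)
  finally show ?thesis by (simp add: D_def)
qed

text \<open>The matrix of size \<open>m\<close> is padded by zeros to size \<open>n\<close>.\<close>

lemma toeplitz_char_compare:
  fixes a :: "nat \<Rightarrow> real"
  assumes c: "phase c" and m: "0 < m" and mn: "m \<le> n"
  defines "Q \<equiv> \<Sum>d<n. (a d)\<^sup>2"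
  shows "cmod (toeplitz_char c a n t - (of_nat m / of_nat n * toeplitz_char c a m t + of_nat (n - m) / of_nat n))
    \<le> \<bar>t\<bar> * sqrt (6 * Q * (real (n - m) / (real n)\<^sup>2))"
proof -
  have n: "n > 0" using m mn by simp
  obtain u where u: "eigenbasis n (scaled_kernel c a n) u (toeplitz_ev c a n)" using toeplitz_ev_eigenbasis[OF c] .
  obtain v where v: "eigenbasis m (scaled_kernel c a m) v (toeplitz_ev c a m)" using toeplitz_ev_eigenbasis[OF c] .
  let ?mu = "\<lambda>j. if j < m then toeplitz_ev c a m j else 0"
  let ?b = "\<lambda>i l. if i < m \<and> l < m then scaled_kernel c a m i l else 0"
  note v' = eigenbasis_embed[OF v mn]
  define x where "x i l = (a (nat \<bar>int l - int i\<bar>))\<^sup>2" for i l :: nat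
  \<comment> \<open>Inside the common block only the normalisation changes: for
    \<open>q <= p\<close> one has \<open>(p - q)^2 <= p^2 - q^2\<close>, here with
    \<open>p = 1 / sqrt m\<close> and \<open>q = 1 / sqrt n\<close>.\<close>
  define \<kappa> where "\<kappa> = 1 / real m - 1 / real n"
  have k0: "\<kappa> \<ge> 0" using m mn by (simp add: \<kappa>_def frac_le)
  have x0: "x i l \<ge> 0" for i l by (simp add: x_def)
  have row: "(\<Sum>l<n. x i l) \<le> 2 * Q" if "i < n" for i
    unfolding x_def Q_def by (rule sum_abs_diff_le[OF that]) simp
  have xsym: "x i l = x l i" for i l by (simp add: x_def abs_minus_commute)
  \<comment> \<open>The three terms account for the rescaled block, the new rows and the new
    columns. After summation each is at most \<open>2 * Q * (n - m) / n\<close>, whence the constant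
    6.\<close>
  have entry: "(cmod (scaled_kernel c a n i l - ?b i l))\<^sup>2
    \<le> of_bool (i < m) * x i l * \<kappa> + of_bool (m \<le> i) * x i l / real n + of_bool (m \<le> l) * x i l / real n" for i l
  proof -
    define z where "z = (if i < m \<and> l < m then 1 / sqrt (real n) - 1 / sqrt (real m) else 1 / sqrt (real n))"
    have "scaled_kernel c a n i l - ?b i l = c (int l - int i) * of_real (a (nat \<bar>int l - int i\<bar>) * z)"
      by (simp add: scaled_kernel_def toeplitz_kernel_def z_def right_diff_distrib)
    also have "(cmod \<dots>)\<^sup>2 = (cmod (c (int l - int i)))\<^sup>2 * (x i l * z\<^sup>2)"
      by (simp only: norm_mult norm_of_real power_mult_distrib power2_abs x_def)
    also have "\<dots> \<le> 1 * (x i l * z\<^sup>2)"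
      using phase_le_1[OF c] x0 by (intro mult_right_mono power_le_one) auto
    also have "\<dots> \<le> of_bool (i < m) * x i l * \<kappa> + of_bool (m \<le> i) * x i l / real n + of_bool (m \<le> l) * x i l / real n"
    proof (cases "i < m \<and> l < m")
      case True
      have "(1 / sqrt (real n) - 1 / sqrt (real m))\<^sup>2 \<le> \<kappa>"
      proof -
        define p q where "p = 1 / sqrt (real m)" and "q = 1 / sqrt (real n)"
        have pq: "0 \<le> q" "q \<le> p" using m mn by (auto simp: p_def q_def frac_le)
        have "(q - p)\<^sup>2 = (p - q) * (p - q)" by (simp add: power2_eq_square algebra_simps)
        also have "\<dots> \<le> (p - q) * (p + q)" using pq by (intro mult_left_mono) auto
        also have "\<dots> = p\<^sup>2 - q\<^sup>2" by (simp add: power2_eq_square algebra_simps)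
        also have "\<dots> = \<kappa>" by (simp add: p_def q_def \<kappa>_def power_divide)
        finally show ?thesis by (simp add: p_def q_def)
      qed
      then have "x i l * z\<^sup>2 \<le> x i l * \<kappa>" using True x0 by (simp add: z_def mult_left_mono)
      then show ?thesis using True by simp
    next
      case False
      then have z2: "x i l * z\<^sup>2 = x i l / real n" by (auto simp: z_def power_divide)
      have "0 \<le> x i l * \<kappa>" "0 \<le> x i l / real n" using x0 k0 by auto
      then show ?thesis using False unfolding mult_1 z2 by (cases "i < m"; cases "l < m") auto
    qed
    finally show ?thesis .
  qed
  have S: "(\<Sum>i<n. \<Sum>l<n. of_bool (P i) * x i l) \<le> real (card {i. i < n \<and> P i}) * (2 * Q)" for P
  proof -
    have "(\<Sum>i<n. \<Sum>l<n. of_bool (P i) * x i l) = (\<Sum>i<n. of_bool (P i) * (\<Sum>l<n. x i l))"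
      by (simp only: sum_distrib_left)
    also have "\<dots> \<le> (\<Sum>i<n. of_bool (P i) * (2 * Q))" using row by (intro sum_mono mult_left_mono) auto
    also have "\<dots> = (\<Sum>i<n. of_bool (P i)) * (2 * Q)" by (simp only: sum_distrib_right)
    also have "(\<Sum>i<n. of_bool (P i)) = real (card {i. i < n \<and> P i})"
      by (simp add: of_bool_def sum.If_cases lessThan_def Int_def)
    finally show ?thesis .
  qed
  have c1: "card {i. i < n \<and> i < m} = m"
  proof -
    have "{i. i < n \<and> i < m} = {..<m}" using mn by auto
    then show ?thesis by simp
  qed
  have c2: "card {i. i < n \<and> m \<le> i} = n - m"
  proof -
    have "{i. i < n \<and> m \<le> i} = {m..<n}" by auto
    then show ?thesis by simp
  qed
  have "(\<Sum>i<n. \<Sum>l<n. (cmod (scaled_kernel c a n i l - ?b i l))\<^sup>2)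
    \<le> (\<Sum>i<n. \<Sum>l<n. of_bool (i < m) * x i l * \<kappa> + of_bool (m \<le> i) * x i l / real n + of_bool (m \<le> l) * x i l / real n)"
    by (intro sum_mono entry)
  also have "\<dots> = (\<Sum>i<n. \<Sum>l<n. of_bool (i < m) * x i l) * \<kappa> + (\<Sum>i<n. \<Sum>l<n. of_bool (m \<le> i) * x i l) / real n
      + (\<Sum>i<n. \<Sum>l<n. of_bool (m \<le> l) * x i l) / real n"
    by (simp only: sum.distrib sum_distrib_right[symmetric] sum_divide_distrib[symmetric])
  also have "(\<Sum>i<n. \<Sum>l<n. of_bool (m \<le> l) * x i l) = (\<Sum>i<n. \<Sum>l<n. of_bool (m \<le> i) * x i l)"
    by (subst sum.swap) (simp only: xsym)
  also have "(\<Sum>i<n. \<Sum>l<n. of_bool (i < m) * x i l) * \<kappa> + (\<Sum>i<n. \<Sum>l<n. of_bool (m \<le> i) * x i l) / real n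
      + (\<Sum>i<n. \<Sum>l<n. of_bool (m \<le> i) * x i l) / real n
    \<le> (real m * (2 * Q)) * \<kappa> + (real (n - m) * (2 * Q)) / real n + (real (n - m) * (2 * Q)) / real n"
    using S[of "\<lambda>i. i < m"] S[of "\<lambda>i. m \<le> i"] k0 unfolding c1 c2
    by (intro add_mono mult_right_mono divide_right_mono) auto
  also have "\<dots> = 6 * Q * (real (n - m) / real n)"
  proof -
    have 1: "real m * \<kappa> = real (n - m) / real n"
      using m n mn by (simp add: \<kappa>_def right_diff_distrib of_nat_diff diff_divide_distrib)
    have 2: "(real m * (2 * Q)) * \<kappa> = 2 * Q * (real m * \<kappa>)" by (simp only: mult_ac)
    have 3: "(real (n - m) * (2 * Q)) / real n = 2 * Q * (real (n - m) / real n)" by (simp only: times_divide_eq_right mult_ac)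
    show ?thesis unfolding 2 3 1 by simp
  qed
  finally have HS: "(\<Sum>i<n. \<Sum>l<n. (cmod (scaled_kernel c a n i l - ?b i l))\<^sup>2) \<le> 6 * Q * (real (n - m) / real n)" .
  have mu: "(\<Sum>j<n. iexp (t * ?mu j)) = (\<Sum>j<m. iexp (t * toeplitz_ev c a m j)) + of_nat (n - m)"
  proof -
    have "(\<Sum>j<n. g j) = (\<Sum>j<m. g j) + (\<Sum>j=m..<n. g j)" for g :: "nat \<Rightarrow> complex"
      using mn by (metis lessThan_atLeast0 sum.atLeastLessThan_concat zero_le)
    then have "(\<Sum>j<n. iexp (t * ?mu j)) = (\<Sum>j<m. iexp (t * ?mu j)) + (\<Sum>j=m..<n. iexp (t * ?mu j))"
      by blast
    also have "(\<Sum>j<m. iexp (t * ?mu j)) = (\<Sum>j<m. iexp (t * toeplitz_ev c a m j))" by (rule sum.cong) auto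
    also have "(\<Sum>j=m..<n. iexp (t * ?mu j)) = (\<Sum>j=m..<n. 1)" by (rule sum.cong) auto
    finally show ?thesis by simp
  qed
  have "toeplitz_char c a n t - (of_nat m / of_nat n * toeplitz_char c a m t + of_nat (n - m) / of_nat n)
    = ((\<Sum>j<n. iexp (t * toeplitz_ev c a n j)) - (\<Sum>j<n. iexp (t * ?mu j))) / of_nat n"
    unfolding mu using m by (simp add: toeplitz_char_def diff_divide_distrib add_divide_distrib)
  also have "cmod \<dots> \<le> (\<bar>t\<bar> * sqrt (real n) * sqrt (6 * Q * (real (n - m) / real n))) / real n"
    unfolding norm_divide norm_of_nat
    by (intro divide_right_mono order.trans[OF spectral_sum_diff_le[OF u v' iexp_lipschitz abs_ge_zero]] mult_left_mono
        real_sqrt_le_mono HS) auto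
  also have "\<dots> = \<bar>t\<bar> * sqrt (6 * Q * (real (n - m) / (real n)\<^sup>2))"
  proof -
    have "sqrt (6 * Q * (real (n - m) / real n)) = sqrt (6 * Q * (real (n - m) / (real n)\<^sup>2)) * sqrt (real n)"
      using n by (simp add: real_sqrt_mult[symmetric] power2_eq_square)
    moreover have "T * s * (z * s) / N = T * z" if "s * s = N" "N \<noteq> 0" for T s z N :: real
    proof -
      have *: "T * s * (z * s) = T * z * (s * s)" by (simp only: mult_ac)
      show ?thesis unfolding * that(1) using that(2) by simp
    qed
    ultimately show ?thesis using n by simp
  qed
  finally show ?thesis .
qed

text \<open>Bounding the square sum of the input by the second spectral moment avoids a separate law of large numbers
  for the squares.\<close>

lemma input_square_sum_le:
  assumes c: "phase c" and D: "0 < D" "2 * D \<le> N"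
  shows "(\<Sum>d<D. (a d)\<^sup>2) \<le> (a 0)\<^sup>2 + (real N)\<^sup>2 / real D * toeplitz_mom c a N 2"
proof -
  have N: "N > 0" using D by simp
  obtain u where u: "eigenbasis N (scaled_kernel c a N) u (toeplitz_ev c a N)" using toeplitz_ev_eigenbasis[OF c] .
  have herm: "scaled_kernel c a N l i = cnj (scaled_kernel c a N i l)" for i l
    unfolding scaled_kernel_def hermitian_toeplitz_kernel[OF c, of a l i] by simp
  have sq: "(cmod (scaled_kernel c a N i l))\<^sup>2 = (cmod (c (int l - int i)))\<^sup>2 * (a (nat \<bar>int l - int i\<bar>))\<^sup>2 / real N" for i l
    by (simp add: scaled_kernel_def toeplitz_kernel_def norm_mult norm_divide power_mult_distrib power_divide)
  \<comment> \<open>In the first \<open>D\<close> rows, the strip to the right of the diagonal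
    contains every distance \<open>0 < d < D\<close> exactly \<open>D\<close> times, and it fits
    because \<open>2 * D <= N\<close>. The diagonal is left out since \<open>c 0\<close> may vanish;
    hence the separate term for \<open>a 0\<close>.\<close>
  have "real D * (\<Sum>d\<in>{0<..<D}. (a d)\<^sup>2) / real N = (\<Sum>i<D. \<Sum>l\<in>{i<..<i + D}. (cmod (scaled_kernel c a N i l))\<^sup>2)"
  proof -
    have "(\<Sum>l\<in>{i<..<i + D}. (cmod (scaled_kernel c a N i l))\<^sup>2) = (\<Sum>d\<in>{0<..<D}. (a d)\<^sup>2 / real N)" for i
    proof (rule sum.reindex_bij_witness[of _ "\<lambda>d. d + i" "\<lambda>l. l - i"])
      fix l assume l: "l \<in> {i<..<i + D}"
      then have c1: "cmod (c (int l - int i)) = 1" using c by (simp add: phase_def)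
      have e: "nat \<bar>int l - int i\<bar> = l - i" using l by auto
      show "(a (l - i))\<^sup>2 / real N = (cmod (scaled_kernel c a N i l))\<^sup>2" unfolding sq e c1 by simp
    qed auto
    then show ?thesis by (simp add: sum_divide_distrib[symmetric])
  qed
  also have "\<dots> \<le> (\<Sum>i<D. \<Sum>l<N. (cmod (scaled_kernel c a N i l))\<^sup>2)"
  proof (rule sum_mono)
    fix i assume "i \<in> {..<D}"
    then have "{i<..<i + D} \<subseteq> {..<N}" using D(2) by auto
    then show "(\<Sum>l\<in>{i<..<i + D}. (cmod (scaled_kernel c a N i l))\<^sup>2) \<le> (\<Sum>l<N. (cmod (scaled_kernel c a N i l))\<^sup>2)"
      by (intro sum_mono2) simp_all
  qed
  also have "\<dots> \<le> (\<Sum>i<N. \<Sum>l<N. (cmod (scaled_kernel c a N i l))\<^sup>2)"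
  proof (rule sum_mono2)
    show "{..<D} \<subseteq> {..<N}" using D(2) by auto
  qed (simp_all add: sum_nonneg)
  also have "\<dots> = real N * toeplitz_mom c a N 2"
    unfolding sum_power2_eigenvalues[OF u herm, symmetric] toeplitz_mom_def using N by simp
  finally have le: "real D * (\<Sum>d\<in>{0<..<D}. (a d)\<^sup>2) / real N \<le> real N * toeplitz_mom c a N 2" .
  have "(\<Sum>d\<in>{0<..<D}. (a d)\<^sup>2) \<le> (real N)\<^sup>2 / real D * toeplitz_mom c a N 2"
  proof -
    have "y = (real D * y / real N) * (real N / real D)" for y :: real using D N by simp
    then have "(\<Sum>d\<in>{0<..<D}. (a d)\<^sup>2) = (real D * (\<Sum>d\<in>{0<..<D}. (a d)\<^sup>2) / real N) * (real N / real D)" .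
    also have "\<dots> \<le> (real N * toeplitz_mom c a N 2) * (real N / real D)" by (intro mult_right_mono le) simp
    also have "\<dots> = (real N)\<^sup>2 / real D * toeplitz_mom c a N 2" by (simp add: power2_eq_square)
    finally show ?thesis .
  qed
  moreover have "(\<Sum>d<D. (a d)\<^sup>2) = (a 0)\<^sup>2 + (\<Sum>d\<in>{0<..<D}. (a d)\<^sup>2)"
  proof -
    have "{..<D} = insert 0 {0<..<D}" using D(1) by auto
    then have "(\<Sum>d<D. (a d)\<^sup>2) = (\<Sum>d\<in>insert 0 {0<..<D}. (a d)\<^sup>2)" by (rule arg_cong)
    then show ?thesis by (subst (asm) sum.insert) simp_all
  qed
  ultimately show ?thesis by simp
qed

text \<open>Above the square of \<open>m n\<close> only a proportion \<open>\<rho> n\<close>, at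
  most \<open>2 / sqrt n\<close>, of the rows is new. The comparison error is of order
  \<open>sqrt (\<rho> n)\<close> as soon as the square sum of the input is linear in
  \<open>n\<close>, which the second moment at a nearby larger square guarantees.\<close>

theorem toeplitz_char_limit:
  assumes c: "phase c"
    and mom: "\<And>k. k > 0 \<Longrightarrow> (\<lambda>r. toeplitz_mom c a ((Suc r)\<^sup>2) k) \<longlonglongrightarrow> toeplitz_moment k"
  shows "(\<lambda>n. toeplitz_char c a n t) \<longlonglongrightarrow> limit_char t"
proof -
  define m where "m n = nat \<lfloor>sqrt (real n)\<rfloor>" for n
  have m_floor: "real (m n) = of_int \<lfloor>sqrt (real n)\<rfloor>" for n by (simp add: m_def)
  have m_le: "real (m n) \<le> sqrt (real n)" for n unfolding m_floor by (rule of_int_floor_le)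
  have m_gt: "sqrt (real n) < real (m n) + 1" for n unfolding m_floor by (rule real_of_int_floor_add_one_gt)
  have m_sq: "(m n)\<^sup>2 \<le> n" for n
  proof -
    have "(real (m n))\<^sup>2 \<le> (sqrt (real n))\<^sup>2" by (intro power_mono m_le) simp
    then have "real ((m n)\<^sup>2) \<le> real n" by simp
    then show ?thesis by (simp only: of_nat_le_iff)
  qed
  have m_pos: "m n > 0" if "n > 0" for n
    using m_gt[of n] that by (cases "m n = 0") (auto simp: real_sqrt_ge_one dest: less_le_trans)
  have m_top: "filterlim (\<lambda>n. m n - 1) sequentially sequentially"
  proof (rule filterlim_at_top[THEN iffD2], rule allI)
    fix Z
    show "eventually (\<lambda>n. Z \<le> m n - 1) sequentially"
    proof (rule eventually_sequentiallyI[of "(Z + 1)\<^sup>2"])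
      fix n assume "(Z + 1)\<^sup>2 \<le> n"
      then have "real (Z + 1) \<le> sqrt (real n)"
        by (intro real_le_rsqrt) (metis of_nat_le_iff of_nat_power)
      then show "Z \<le> m n - 1" using m_gt[of n] by simp
    qed
  qed
  define \<rho> where "\<rho> n = real (n - (m n)\<^sup>2) / real n" for n
  have rho0: "\<rho> n \<ge> 0" for n by (simp add: \<rho>_def)
  have rho_le: "\<rho> n \<le> 2 / sqrt (real n)" for n
  proof (cases "n = 0")
    case False
    have "real n - (real (m n))\<^sup>2 \<le> 2 * sqrt (real n)"
    proof -
      have "(sqrt (real n) - 1)\<^sup>2 \<le> (real (m n))\<^sup>2"
        using m_gt[of n] False by (intro power_mono) auto
      then show ?thesis by (simp add: power2_diff)
    qed
    then have "\<rho> n \<le> 2 * sqrt (real n) / real n"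
      unfolding \<rho>_def using m_sq[of n] by (intro divide_right_mono) (auto simp: of_nat_diff)
    also have "\<dots> = 2 / sqrt (real n)" using False by (simp add: real_div_sqrt divide_simps)
    finally show ?thesis .
  qed (simp add: \<rho>_def)
  have lim2: "(\<lambda>n. 2 / sqrt (real n)) \<longlonglongrightarrow> 0"
    by (intro tendsto_divide_0[OF tendsto_const] filterlim_at_top_imp_at_infinity
        filterlim_compose[OF sqrt_at_top] filterlim_real_sequentially)
  have rho: "\<rho> \<longlonglongrightarrow> 0"
    by (rule tendsto_sandwich[OF _ _ tendsto_const lim2]) (simp_all add: rho0 rho_le)
  have "Bseq (\<lambda>r. toeplitz_mom c a ((Suc r)\<^sup>2) 2)"
    using mom[of 2] by (intro convergent_imp_Bseq convergentI) auto
  then obtain C where C: "\<And>r. \<bar>toeplitz_mom c a ((Suc r)\<^sup>2) 2\<bar> \<le> C"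
    unfolding Bseq_def by auto
  define C' where "C' = (a 0)\<^sup>2 + 256 * C"
  have Q: "(\<Sum>d<n. (a d)\<^sup>2) \<le> C' * real n" if n: "n > 0" for n
  proof -
    \<comment> \<open>This must be a perfect square, where the second moment is bounded by
      \<open>C\<close>, and at least \<open>2 * n\<close>. It is at most \<open>16 * n\<close>,
      whence the 256 in \<open>C'\<close>.\<close>
    let ?N = "(2 * (m n + 1))\<^sup>2"
    have "sqrt (real n) \<le> real (m n + 1)" using m_gt[of n] by simp
    then have "real n \<le> (real (m n + 1))\<^sup>2" by (rule sqrt_le_D)
    then have "n \<le> (m n + 1)\<^sup>2" by (metis of_nat_le_iff of_nat_power)
    moreover have "?N = 4 * (m n + 1)\<^sup>2" by (simp only: power_mult_distrib) simp
    ultimately have N: "2 * n \<le> ?N" by linarith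
    have Neq: "?N = (Suc (2 * m n + 1))\<^sup>2" by simp
    have "(\<Sum>d<n. (a d)\<^sup>2) \<le> (a 0)\<^sup>2 + (real ?N)\<^sup>2 / real n * toeplitz_mom c a ?N 2"
      by (rule input_square_sum_le[OF c n N])
    also have "(real ?N)\<^sup>2 / real n * toeplitz_mom c a ?N 2 \<le> (256 * real n) * C"
    proof (intro mult_mono)
      have "real ?N \<le> 16 * real n"
      proof -
        have "(2 * (m n + 1))\<^sup>2 \<le> (4 * m n)\<^sup>2" using m_pos[OF n] by (intro power_mono) auto
        also have "\<dots> \<le> 16 * n" using m_sq[of n] by (simp add: power_mult_distrib)
        finally have "?N \<le> 16 * n" .
        then have "real ?N \<le> real (16 * n)" by (simp only: of_nat_le_iff)
        then show ?thesis by simp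
      qed
      then have "(real ?N)\<^sup>2 \<le> (16 * real n)\<^sup>2" by (intro power_mono) auto
      then show "(real ?N)\<^sup>2 / real n \<le> 256 * real n"
        using n by (simp add: divide_le_eq power2_eq_square)
      show "toeplitz_mom c a ?N 2 \<le> C" unfolding Neq using C[of "2 * m n + 1"] by linarith
      show "0 \<le> toeplitz_mom c a ?N 2" by (simp add: toeplitz_mom_def sum_nonneg)
    qed auto
    also have "(a 0)\<^sup>2 \<le> (a 0)\<^sup>2 * real n" using n by (simp add: mult_le_cancel_left1)
    finally show ?thesis by (simp add: C'_def algebra_simps)
  qed
  \<comment> \<open>The padding contributes mass \<open>\<rho> n\<close> at 0, where the exponential
    is 1. The hypothesis indexes squares by \<open>Suc r\<close>, and for \<open>n > 0\<close> the
    positive root \<open>m n\<close> equals \<open>Suc (m n - 1)\<close>.\<close>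
  have main: "cmod (toeplitz_char c a n t - ((1 - of_real (\<rho> n)) * toeplitz_char c a ((Suc (m n - 1))\<^sup>2) t + of_real (\<rho> n)))
      \<le> \<bar>t\<bar> * sqrt (6 * C' * \<rho> n)" if n: "n > 0" for n
  proof -
    have mm: "(Suc (m n - 1))\<^sup>2 = (m n)\<^sup>2" using m_pos[OF n] by simp
    have 1: "of_nat (n - (m n)\<^sup>2) / of_nat n = (of_real (\<rho> n) :: complex)" by (simp add: \<rho>_def)
    have "\<rho> n = 1 - real ((m n)\<^sup>2) / real n"
      using n m_sq[of n] by (simp add: \<rho>_def of_nat_diff diff_divide_distrib)
    then have 2: "of_nat ((m n)\<^sup>2) / of_nat n = (1 - of_real (\<rho> n) :: complex)" by simp
    have "cmod (toeplitz_char c a n t - ((1 - of_real (\<rho> n)) * toeplitz_char c a ((m n)\<^sup>2) t + of_real (\<rho> n)))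
      \<le> \<bar>t\<bar> * sqrt (6 * (\<Sum>d<n. (a d)\<^sup>2) * (real (n - (m n)\<^sup>2) / (real n)\<^sup>2))"
      using toeplitz_char_compare[OF c _ m_sq[of n], of a t] m_pos[OF n] unfolding 1 2 by simp
    also have "\<dots> \<le> \<bar>t\<bar> * sqrt (6 * (C' * real n) * (real (n - (m n)\<^sup>2) / (real n)\<^sup>2))"
      using Q[OF n] by (intro mult_left_mono real_sqrt_le_mono mult_right_mono) auto
    also have "6 * (C' * real n) * (real (n - (m n)\<^sup>2) / (real n)\<^sup>2) = 6 * C' * \<rho> n"
      using n by (simp add: \<rho>_def power2_eq_square)
    finally show ?thesis unfolding mm .
  qed
  have sq: "(\<lambda>n. toeplitz_char c a ((Suc (m n - 1))\<^sup>2) t) \<longlonglongrightarrow> limit_char t"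
    by (rule filterlim_compose[OF toeplitz_char_limit_of_moments[of "\<lambda>r. (Suc r)\<^sup>2"] m_top]) (use mom in auto)
  have "(\<lambda>n. \<bar>t\<bar> * sqrt (6 * C' * \<rho> n)) \<longlonglongrightarrow> \<bar>t\<bar> * sqrt (6 * C' * 0)"
    by (intro tendsto_intros rho)
  then have g0: "(\<lambda>n. \<bar>t\<bar> * sqrt (6 * C' * \<rho> n)) \<longlonglongrightarrow> 0" by simp
  have "(\<lambda>n. toeplitz_char c a n t - ((1 - of_real (\<rho> n)) * toeplitz_char c a ((Suc (m n - 1))\<^sup>2) t + of_real (\<rho> n))) \<longlonglongrightarrow> 0"
  proof (rule Lim_null_comparison[OF eventually_sequentiallyI[of 1] g0])
    fix n :: nat assume "1 \<le> n"
    then show "norm (toeplitz_char c a n t - ((1 - of_real (\<rho> n)) * toeplitz_char c a ((Suc (m n - 1))\<^sup>2) t + of_real (\<rho> n)))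
      \<le> \<bar>t\<bar> * sqrt (6 * C' * \<rho> n)" by (intro main) simp
  qed
  moreover have "(\<lambda>n. (1 - of_real (\<rho> n)) * toeplitz_char c a ((Suc (m n - 1))\<^sup>2) t + of_real (\<rho> n))
      \<longlonglongrightarrow> (1 - of_real 0) * limit_char t + of_real 0"
    by (intro tendsto_intros rho sq)
  ultimately have "(\<lambda>n. (toeplitz_char c a n t - ((1 - of_real (\<rho> n)) * toeplitz_char c a ((Suc (m n - 1))\<^sup>2) t + of_real (\<rho> n)))
      + ((1 - of_real (\<rho> n)) * toeplitz_char c a ((Suc (m n - 1))\<^sup>2) t + of_real (\<rho> n)))
      \<longlonglongrightarrow> 0 + ((1 - of_real 0) * limit_char t + of_real 0)"
    by (rule tendsto_add)
  then show ?thesis unfolding diff_add_cancel by simp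
qed

section \<open>Almost sure convergence\<close>

text \<open>The sum of the squares has finite expectation, so it is finite almost surely and its
  terms tend to 0.\<close>

lemma AE_tendsto_zero_of_summable:
  fixes Z :: "nat \<Rightarrow> 'a \<Rightarrow> real"
  assumes int: "\<And>r. integrable M (\<lambda>\<omega>. (Z r \<omega>)\<^sup>2)"
    and le: "\<And>r. (LINT \<omega>|M. (Z r \<omega>)\<^sup>2) \<le> b r" and b: "summable b"
  shows "AE \<omega> in M. (\<lambda>r. Z r \<omega>) \<longlonglongrightarrow> 0"
proof -
  have [measurable]: "(\<lambda>\<omega>. (Z r \<omega>)\<^sup>2) \<in> borel_measurable M" for r
    by (rule borel_measurable_integrable[OF int])
  have "(\<integral>\<^sup>+\<omega>. (\<Sum>r. ennreal ((Z r \<omega>)\<^sup>2)) \<partial>M) = (\<Sum>r. \<integral>\<^sup>+\<omega>. ennreal ((Z r \<omega>)\<^sup>2) \<partial>M)"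
    by (rule nn_integral_suminf) measurable
  also have "\<dots> = (\<Sum>r. ennreal (LINT \<omega>|M. (Z r \<omega>)\<^sup>2))"
    by (rule suminf_cong, rule nn_integral_eq_integral[OF int]) simp
  also have "\<dots> \<noteq> \<infinity>"
  proof -
    have "summable (\<lambda>r. LINT \<omega>|M. (Z r \<omega>)\<^sup>2)"
    proof (rule summable_comparison_test[OF _ b], intro exI allI impI)
      fix r
      show "norm (LINT \<omega>|M. (Z r \<omega>)\<^sup>2) \<le> b r" using le[of r] by simp
    qed
    then show ?thesis unfolding infinity_ennreal_def by (rule ennreal_suminf_neq_top) simp
  qed
  finally have "AE \<omega> in M. (\<Sum>r. ennreal ((Z r \<omega>)\<^sup>2)) \<noteq> \<infinity>"
    by (rule nn_integral_PInf_AE[rotated]) measurable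
  then show ?thesis
  proof eventually_elim
    case (elim \<omega>)
    then have "summable (\<lambda>r. (Z r \<omega>)\<^sup>2)" by (intro summable_suminf_not_top) auto
    then have "(\<lambda>r. (Z r \<omega>)\<^sup>2) \<longlonglongrightarrow> 0" by (rule summable_LIMSEQ_zero)
    then have "(\<lambda>r. sqrt ((Z r \<omega>)\<^sup>2)) \<longlonglongrightarrow> sqrt 0" by (rule tendsto_real_sqrt)
    then show ?case by (simp add: tendsto_rabs_zero_iff)
  qed
qed

context centered_input
begin

lemma toeplitz_mom_walk_sum:
  assumes "phase c"
  shows "toeplitz_mom c (\<lambda>i. x i \<omega>) n k = walk_sum k (walk_weight c k) n \<omega> / (real n * sqrt (real n) ^ k)"
proof -
  obtain u where "eigenbasis n (scaled_kernel c (\<lambda>i. x i \<omega>) n) u (toeplitz_ev c (\<lambda>i. x i \<omega>) n)"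
    using toeplitz_ev_eigenbasis[OF assms] .
  from power_sum_eigenvalues[OF this, of k] show ?thesis
    by (simp add: toeplitz_mom_def walk_sum_def step_prod_def mult.commute)
qed

lemma expectation_toeplitz_mom_tendsto:
  assumes c: "phase c" and k: "k > 0"
  shows "(\<lambda>n. expectation (walk_sum k (walk_weight c k) n) / (real n * sqrt (real n) ^ k)) \<longlonglongrightarrow> toeplitz_moment k"
proof -
  let ?d = "\<lambda>n. real n * sqrt (real n) ^ k"
  let ?E = "\<lambda>n. expectation (walk_sum k (walk_weight c k) n)"
  let ?W = "\<lambda>n. real (\<Sum>p\<in>pairings k. walk_count k p n)"
  define r where "r = (k - 1) div 2"
  obtain C where C: "C \<ge> 0" "\<And>n. \<bar>?E n - ?W n\<bar> \<le> C * (real n * (real n + 1) ^ r)"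
  proof -
    have "1 \<le> k" using k by simp
    from expectation_walk_sum_approx[OF this] obtain C where "C \<ge> 0"
      and "\<And>w n. (\<And>s. \<bar>w s\<bar> \<le> 1) \<Longrightarrow> (\<And>s. opposite_paired {..<k} s \<Longrightarrow> w s = 1) \<Longrightarrow>
        \<bar>expectation (walk_sum k w n) - real (\<Sum>p\<in>pairings k. walk_count k p n)\<bar>
          \<le> C * (real n * (real n + 1) ^ ((k - 1) div 2))" by blast
    with that[of C] walk_weight_le_1[OF c] walk_weight_paired[OF c] show ?thesis unfolding r_def by blast
  qed
  have bound: "\<bar>(?E n - ?W n) / ?d n\<bar> \<le> C * 2 ^ r / sqrt (real n)" if n: "n \<ge> 1" for n
  proof -
    have s: "sqrt (real n) \<ge> 1" using n by simp
    \<comment> \<open>Since \<open>2 * r + 1 <= k\<close>, the count of bad walks is smaller than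
      the normalisation by at least a factor of order \<open>sqrt n\<close>.\<close>
    have "real n ^ r * sqrt (real n) = sqrt (real n) ^ (2 * r + 1)" by (simp add: power_mult)
    also have "\<dots> \<le> sqrt (real n) ^ k" using s k by (intro power_increasing) (auto simp: r_def)
    finally have le: "real n ^ r * sqrt (real n) \<le> sqrt (real n) ^ k" .
    have "(real n + 1) ^ r \<le> (2 * real n) ^ r" using n by (intro power_mono) auto
    then have "(real n + 1) ^ r \<le> 2 ^ r * real n ^ r" by (simp add: power_mult_distrib)
    then have "C * (real n * (real n + 1) ^ r) \<le> C * (real n * (2 ^ r * real n ^ r))"
      using C(1) by (intro mult_left_mono) auto
    then have "\<bar>?E n - ?W n\<bar> \<le> C * (real n * (2 ^ r * real n ^ r))" using C(2)[of n] by linarith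
    moreover have "real n * (real n ^ r * sqrt (real n)) \<le> ?d n" using le by (intro mult_left_mono) auto
    ultimately have "\<bar>?E n - ?W n\<bar> / ?d n \<le> C * (real n * (2 ^ r * real n ^ r)) / (real n * (real n ^ r * sqrt (real n)))"
      using n C(1) by (intro frac_le) auto
    also have "\<dots> = C * 2 ^ r / sqrt (real n)" using n by simp
    finally show ?thesis using n by (simp add: abs_mult)
  qed
  have "(\<lambda>n. C * 2 ^ r / sqrt (real n)) \<longlonglongrightarrow> 0"
    by (intro tendsto_divide_0[OF tendsto_const] filterlim_at_top_imp_at_infinity
        filterlim_compose[OF sqrt_at_top] filterlim_real_sequentially)
  then have 1: "(\<lambda>n. (?E n - ?W n) / ?d n) \<longlonglongrightarrow> 0"
    by (rule Lim_null_comparison[rotated]) (use bound in \<open>auto intro!: eventually_sequentiallyI[of 1]\<close>)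
  have 2: "(\<lambda>n. ?W n / ?d n) \<longlonglongrightarrow> toeplitz_moment k"
  proof (cases "even k")
    case True
    have "sqrt (real n) ^ k = real n ^ (k div 2)" for n
    proof -
      have "sqrt (real n) ^ (2 * (k div 2)) = real n ^ (k div 2)" unfolding power_mult by simp
      then show ?thesis using True by simp
    qed
    then have "?W n / ?d n = (\<Sum>p\<in>pairings k. real (walk_count k p n) / real n ^ (k div 2 + 1))" for n
      by (simp add: sum_divide_distrib)
    then show ?thesis unfolding toeplitz_moment_def by (simp only:) (intro tendsto_sum walk_count_limit(1))
  next
    case False
    have "pairings k = {}"
    proof (rule ccontr)
      assume "pairings k \<noteq> {}"
      then obtain p where p: "p \<in> pairings k" by blast
      have "even k" by (subst pairings_openers(4)[OF p]) simp
      then show False using False by simp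
    qed
    then show ?thesis using toeplitz_moment_odd[OF False] by simp
  qed
  have "(\<lambda>n. (?E n - ?W n) / ?d n + ?W n / ?d n) \<longlonglongrightarrow> 0 + toeplitz_moment k"
    using 1 2 by (rule tendsto_add)
  moreover have "(e - w) / d + w / d = e / d" for e w d :: real by (simp add: diff_divide_distrib)
  ultimately show ?thesis by (simp only: add_0)
qed

lemma AE_toeplitz_mom_tendsto:
  assumes c: "phase c" and k: "k > 0"
  shows "AE \<omega> in M. (\<lambda>r. toeplitz_mom c (\<lambda>i. x i \<omega>) ((Suc r)\<^sup>2) k) \<longlonglongrightarrow> toeplitz_moment k"
proof -
  let ?d = "\<lambda>n. real n * sqrt (real n) ^ k"
  let ?Y = "walk_sum k (walk_weight c k)"
  let ?n = "\<lambda>r. (Suc r)\<^sup>2"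
  obtain C where C: "C \<ge> 0"
    "\<And>n. integrable M (\<lambda>\<omega>. (?Y n \<omega> - expectation (?Y n))\<^sup>2)
      \<and> expectation (\<lambda>\<omega>. (?Y n \<omega> - expectation (?Y n))\<^sup>2) \<le> C * ((real n)\<^sup>2 * (real n + 1) ^ (k - 1))"
  proof -
    have "1 \<le> k" using k by simp
    from variance_walk_sum_bound[OF this] obtain C where "C \<ge> 0"
      and "\<And>w n. (\<And>s. \<bar>w s\<bar> \<le> 1) \<Longrightarrow> integrable M (\<lambda>\<omega>. (walk_sum k w n \<omega> - expectation (walk_sum k w n))\<^sup>2)
        \<and> expectation (\<lambda>\<omega>. (walk_sum k w n \<omega> - expectation (walk_sum k w n))\<^sup>2) \<le> C * ((real n)\<^sup>2 * (real n + 1) ^ (k - 1))"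
      by blast
    with that[of C] walk_weight_le_1[OF c] show ?thesis by blast
  qed
  define Z where "Z r \<omega> = (?Y (?n r) \<omega> - expectation (?Y (?n r))) / ?d (?n r)" for r \<omega>
  have Zsq: "(Z r \<omega>)\<^sup>2 = (?Y (?n r) \<omega> - expectation (?Y (?n r)))\<^sup>2 / (?d (?n r))\<^sup>2" for r \<omega>
    by (simp add: Z_def power_divide)
  have "AE \<omega> in M. (\<lambda>r. Z r \<omega>) \<longlonglongrightarrow> 0"
  proof (rule AE_tendsto_zero_of_summable)
    show "integrable M (\<lambda>\<omega>. (Z r \<omega>)\<^sup>2)" for r unfolding Zsq using C(2) by (intro integrable_divide) blast
    \<comment> \<open>The factor \<open>2 ^ (k - 1)\<close> stems from
      \<open>n + 1 <= 2 * n\<close>; the normalised variance bound of order \<open>1 / n\<close>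
      becomes an inverse square at \<open>n = (Suc r)^2\<close>.\<close>
    show "summable (\<lambda>r. C * 2 ^ (k - 1) * inverse ((real (Suc r))\<^sup>2))"
    proof (intro summable_mult)
      show "summable (\<lambda>r. inverse ((real (Suc r))\<^sup>2))"
        using inverse_power_summable[of 2, where 'a = real] by (subst summable_Suc_iff[of "\<lambda>r. inverse ((real r)\<^sup>2)"]) simp
    qed
    show "expectation (\<lambda>\<omega>. (Z r \<omega>)\<^sup>2) \<le> C * 2 ^ (k - 1) * inverse ((real (Suc r))\<^sup>2)" for r
    proof -
      define n where "n = (Suc r)\<^sup>2"
      have n: "n \<ge> 1" by (simp add: n_def)
      have dsq: "(?d n)\<^sup>2 = (real n)\<^sup>2 * real n ^ k"
      proof -
        have "(sqrt (real n) ^ k)\<^sup>2 = ((sqrt (real n))\<^sup>2) ^ k" by (simp only: power_mult[symmetric] mult.commute)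
        then have "(sqrt (real n) ^ k)\<^sup>2 = real n ^ k" by simp
        then show ?thesis by (simp add: power_mult_distrib)
      qed
      have "expectation (\<lambda>\<omega>. (Z r \<omega>)\<^sup>2) = expectation (\<lambda>\<omega>. (?Y n \<omega> - expectation (?Y n))\<^sup>2) / (?d n)\<^sup>2"
        unfolding Zsq n_def by simp
      also have "\<dots> \<le> C * ((real n)\<^sup>2 * (2 ^ (k - 1) * real n ^ (k - 1))) / ((real n)\<^sup>2 * real n ^ k)"
        unfolding dsq
      proof (rule divide_right_mono)
        have "(real n + 1) ^ (k - 1) \<le> (2 * real n) ^ (k - 1)" using n by (intro power_mono) auto
        then have "C * ((real n)\<^sup>2 * (real n + 1) ^ (k - 1)) \<le> C * ((real n)\<^sup>2 * (2 ^ (k - 1) * real n ^ (k - 1)))"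
          using C(1) by (intro mult_left_mono) (auto simp: power_mult_distrib)
        then show "expectation (\<lambda>\<omega>. (?Y n \<omega> - expectation (?Y n))\<^sup>2) \<le> C * ((real n)\<^sup>2 * (2 ^ (k - 1) * real n ^ (k - 1)))"
          using C(2)[of n] by linarith
      qed simp
      also have "\<dots> = C * 2 ^ (k - 1) * inverse (real n)"
      proof -
        have nk: "real n ^ k = real n * real n ^ (k - 1)" using k by (cases k) auto
        have cancel: "C * (a * (b * p)) / (a * (N * p)) = C * b * inverse N" if "a \<noteq> 0" "p \<noteq> 0" for a b p N :: real
          using that by (cases "N = 0") (simp_all add: field_simps)
        show ?thesis unfolding nk by (rule cancel) (use n in simp_all)
      qed
      finally show ?thesis by (simp add: n_def)
    qed
  qed
  then show ?thesis
  proof eventually_elim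
    case (elim \<omega>)
    have "filterlim ?n sequentially sequentially"
      by (rule filterlim_subseq) (auto simp: strict_mono_def intro!: power_strict_mono)
    then have "(\<lambda>r. expectation (?Y (?n r)) / ?d (?n r)) \<longlonglongrightarrow> toeplitz_moment k"
      by (rule filterlim_compose[OF expectation_toeplitz_mom_tendsto[OF c k]])
    with elim have "(\<lambda>r. Z r \<omega> + expectation (?Y (?n r)) / ?d (?n r)) \<longlonglongrightarrow> 0 + toeplitz_moment k"
      by (rule tendsto_add)
    moreover have "Z r \<omega> + expectation (?Y (?n r)) / ?d (?n r) = toeplitz_mom c (\<lambda>i. x i \<omega>) (?n r) k" for r
      unfolding toeplitz_mom_walk_sum[OF c] Z_def by (simp add: diff_divide_distrib)
    ultimately show ?case by simp
  qed
qed

text \<open>Only countably many exceptional sets arise, one for each moment; the passage from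
  moments to all real \<open>t\<close> is deterministic.\<close>

theorem AE_toeplitz_char_tendsto:
  assumes c: "phase c"
  shows "AE \<omega> in M. \<forall>t. (\<lambda>n. toeplitz_char c (\<lambda>i. x i \<omega>) n t) \<longlonglongrightarrow> limit_char t"
proof -
  have "AE \<omega> in M. \<forall>k. (\<lambda>r. toeplitz_mom c (\<lambda>i. x i \<omega>) ((Suc r)\<^sup>2) (Suc k)) \<longlonglongrightarrow> toeplitz_moment (Suc k)"
    unfolding AE_all_countable using AE_toeplitz_mom_tendsto[OF c] by blast
  then show ?thesis
  proof eventually_elim
    case (elim \<omega>)
    have "(\<lambda>r. toeplitz_mom c (\<lambda>i. x i \<omega>) ((Suc r)\<^sup>2) k) \<longlonglongrightarrow> toeplitz_moment k" if "k > 0" for k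
      using elim that by (cases k) auto
    then show ?case using toeplitz_char_limit[OF c] by blast
  qed
qed

end

section \<open>Reduction of (A1) and (A3) to uniformly bounded moments\<close>

lemma mean0_var1D:
  assumes "prob_space M" "mean0_var1 M X"
  shows "integrable M X" "integrable M (\<lambda>\<omega>. (X \<omega>)\<^sup>2)" "(LINT \<omega>|M. X \<omega>) = 0" "(LINT \<omega>|M. (X \<omega>)\<^sup>2) = 1"
proof -
  show m: "integrable M X" "integrable M (\<lambda>\<omega>. (X \<omega>)\<^sup>2)" "(LINT \<omega>|M. X \<omega>) = 0"
    using assms(2) by (simp_all add: mean0_var1_def)
  have "(LINT \<omega>|M. (X \<omega> - (LINT \<omega>|M. X \<omega>))\<^sup>2) = 1" using assms(2) unfolding mean0_var1_def by blast
  then show "(LINT \<omega>|M. (X \<omega>)\<^sup>2) = 1" unfolding m(3) by simp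
qed

lemma centered_input_A3:
  assumes "prob_space M" "input_A3 M x"
  shows "centered_input M x"
proof -
  interpret prob_space M by fact
  show ?thesis
    using assms(2) mean0_var1D[OF assms(1)] unfolding input_A3_def by unfold_locales auto
qed

lemma centered_input_A1:
  assumes "prob_space M" "input_A1 M x"
  shows "centered_input M x"
proof -
  interpret prob_space M by fact
  obtain C where C: "\<And>i. AE \<omega> in M. \<bar>x i \<omega>\<bar> \<le> C" using assms(2) by (auto simp: input_A1_def)
  have ind: "indep_vars (\<lambda>_. borel) x UNIV" using assms(2) by (simp add: input_A1_def)
  have [measurable]: "x i \<in> borel_measurable M" for i using ind by (simp add: indep_vars_def)
  have int: "integrable M (\<lambda>\<omega>. \<bar>x i \<omega>\<bar> ^ k)" and le: "expectation (\<lambda>\<omega>. \<bar>x i \<omega>\<bar> ^ k) \<le> \<bar>C\<bar> ^ k" for i k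
  proof -
    have ae: "AE \<omega> in M. \<bar>x i \<omega>\<bar> ^ k \<le> \<bar>C\<bar> ^ k"
      using C[of i] by eventually_elim (intro power_mono, auto)
    then show int: "integrable M (\<lambda>\<omega>. \<bar>x i \<omega>\<bar> ^ k)"
      by (intro integrable_const_bound[where B = "\<bar>C\<bar> ^ k"]) auto
    show "expectation (\<lambda>\<omega>. \<bar>x i \<omega>\<bar> ^ k) \<le> \<bar>C\<bar> ^ k"
      using integral_mono_AE[OF int _ ae] by (simp add: prob_space)
  qed
  show ?thesis
  proof unfold_locales
    show "indep_vars (\<lambda>_. borel) x UNIV" by (rule ind)
    show "expectation (x i) = 0" "expectation (\<lambda>\<omega>. (x i \<omega>)\<^sup>2) = 1" for i
      using assms(2) mean0_var1D[OF assms(1), of "x i"] by (auto simp: input_A1_def)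
    show "\<exists>C. \<forall>i. integrable M (\<lambda>\<omega>. \<bar>x i \<omega>\<bar> ^ k) \<and> expectation (\<lambda>\<omega>. \<bar>x i \<omega>\<bar> ^ k) \<le> C" for k
      using int le by blast
  qed
qed

section \<open>Independent identically distributed inputs with finite variance\<close>

locale iid_input = prob_space M for M :: "'a measure" +
  fixes x :: "nat \<Rightarrow> 'a \<Rightarrow> real"
  assumes indep: "indep_vars (\<lambda>_. borel) x UNIV"
    and ident: "\<And>i. distr M borel (x i) = distr M borel (x 0)"
    and mean: "expectation (x 0) = 0" and int_x: "integrable M (x 0)"
    and int_sq: "integrable M (\<lambda>\<omega>. (x 0 \<omega>)\<^sup>2)" and var: "expectation (\<lambda>\<omega>. (x 0 \<omega>)\<^sup>2) = 1"
begin

lemma x_measurable [measurable]: "x i \<in> borel_measurable M"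
  using indep unfolding indep_vars_def by auto

lemma
  fixes h :: "real \<Rightarrow> real"
  assumes [measurable]: "h \<in> borel_measurable borel"
  shows expectation_ident: "expectation (\<lambda>\<omega>. h (x i \<omega>)) = expectation (\<lambda>\<omega>. h (x 0 \<omega>))"
    and integrable_ident: "integrable M (\<lambda>\<omega>. h (x i \<omega>)) \<longleftrightarrow> integrable M (\<lambda>\<omega>. h (x 0 \<omega>))"
proof -
  have "expectation (\<lambda>\<omega>. h (x i \<omega>)) = integral\<^sup>L (distr M borel (x i)) h" for i
    by (rule integral_distr[symmetric]) measurable
  then show "expectation (\<lambda>\<omega>. h (x i \<omega>)) = expectation (\<lambda>\<omega>. h (x 0 \<omega>))" by (simp only: ident[of i])
  have "integrable M (\<lambda>\<omega>. h (x i \<omega>)) \<longleftrightarrow> integrable (distr M borel (x i)) h" for i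
    by (rule integrable_distr_eq[symmetric]) measurable
  then show "integrable M (\<lambda>\<omega>. h (x i \<omega>)) \<longleftrightarrow> integrable M (\<lambda>\<omega>. h (x 0 \<omega>))" by (simp only: ident[of i])
qed

text \<open>The joint law is a power of one law, which reindexing along the injection
  \<open>Suc\<close> preserves. This stationarity is what the maximal inequality needs.\<close>

lemma expectation_shift:
  fixes F :: "(nat \<Rightarrow> real) \<Rightarrow> real"
  assumes F: "F \<in> borel_measurable (PiM UNIV (\<lambda>_. borel))"
  shows "expectation (\<lambda>\<omega>. F (\<lambda>i. x (Suc i) \<omega>)) = expectation (\<lambda>\<omega>. F (\<lambda>i. x i \<omega>))"
proof -
  define \<nu> where "\<nu> = distr M borel (x 0)"
  let ?P = "PiM UNIV (\<lambda>_ :: nat. \<nu>)"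
  let ?B = "PiM UNIV (\<lambda>_ :: nat. borel :: real measure)"
  have nu: "prob_space \<nu>" unfolding \<nu>_def by (rule prob_space_distr) simp
  have sets: "sets ?P = sets ?B" by (intro sets_PiM_cong) (simp_all add: \<nu>_def)
  have [measurable]: "F \<in> borel_measurable ?P" using F by (simp add: measurable_cong_sets[OF sets refl])
  have law: "distr M ?B (\<lambda>\<omega> i. x i \<omega>) = ?P"
  proof -
    have "distr M ?B (\<lambda>\<omega>. \<lambda>i\<in>UNIV. x i \<omega>) = PiM UNIV (\<lambda>i. distr M borel (x i))"
      using indep_vars_iff_distr_eq_PiM[of UNIV x "\<lambda>_. borel"] indep by simp
    moreover have "(\<lambda>i. distr M borel (x i)) = (\<lambda>_. \<nu>)" unfolding \<nu>_def by (rule ext) (rule ident)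
    ultimately show ?thesis by (simp only: restrict_UNIV)
  qed
  have meas: "(\<lambda>\<omega> i. x i \<omega>) \<in> measurable M ?B" by (rule measurable_PiM_single') (auto simp: space_PiM)
  have shift: "(\<lambda>y :: nat \<Rightarrow> real. \<lambda>i. y (Suc i)) \<in> measurable ?B ?B"
    by (rule measurable_PiM_single') (auto simp: space_PiM)
  have shiftP: "(\<lambda>y :: nat \<Rightarrow> real. \<lambda>i. y (Suc i)) \<in> measurable ?P ?P"
    using shift by (simp add: measurable_cong_sets[OF sets sets])
  have inv: "distr ?P ?P (\<lambda>y i. y (Suc i)) = ?P"
    using distr_PiM_reindex[of UNIV "\<lambda>_. \<nu>" Suc UNIV] nu unfolding restrict_UNIV by simp
  have "expectation (\<lambda>\<omega>. F (\<lambda>i. x i \<omega>)) = integral\<^sup>L ?P F"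
    unfolding law[symmetric] by (rule integral_distr[symmetric, OF meas F])
  moreover have "expectation (\<lambda>\<omega>. F (\<lambda>i. x (Suc i) \<omega>)) = integral\<^sup>L ?P (\<lambda>y. F (\<lambda>i. y (Suc i)))"
    unfolding law[symmetric] by (rule integral_distr[symmetric, OF meas measurable_compose[OF shift F]])
  moreover have "\<dots> = integral\<^sup>L (distr ?P ?P (\<lambda>y i. y (Suc i))) F"
    by (rule integral_distr[symmetric, OF shiftP]) measurable
  ultimately show ?thesis by (simp only: inv)
qed

text \<open>Hopf's maximal inequality, by Garsia's argument.\<close>

lemma maximal_inequality:
  fixes h :: "real \<Rightarrow> real"
  assumes h [measurable]: "h \<in> borel_measurable borel" and h0: "\<And>y. h y \<ge> 0"
    and int: "integrable M (\<lambda>\<omega>. h (x 0 \<omega>))" and r: "r > 0"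
  shows "measure M {\<omega> \<in> space M. \<exists>n. (\<Sum>i<n. h (x i \<omega>)) > r * real n} \<le> expectation (\<lambda>\<omega>. h (x 0 \<omega>)) / r"
proof -
  \<comment> \<open>Subtracting \<open>r\<close> from every term turns the event into the positivity
    of some partial sum.\<close>
  define S where "S y n = (\<Sum>i<n. h (y i) - r)" for y :: "nat \<Rightarrow> real" and n
  define Mx where "Mx N y = Max ((\<lambda>n. S y n) ` {..N})" for N and y :: "nat \<Rightarrow> real"
  have S0: "S y 0 = 0" for y by (simp add: S_def)
  have Mx_ge: "S y n \<le> Mx N y" if "n \<le> N" for y n N unfolding Mx_def using that by (intro Max_ge) auto
  have Mx0: "0 \<le> Mx N y" for N y using Mx_ge[of 0 N y] by (simp add: S0)
  have Mx_ex: "\<exists>n\<le>N. Mx N y = S y n" for N y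
  proof -
    have "Mx N y \<in> (\<lambda>n. S y n) ` {..N}" unfolding Mx_def by (rule Max_in) auto
    then show ?thesis by auto
  qed
  have S_abs: "\<bar>S y n\<bar> \<le> (\<Sum>i<N. h (y i) + r)" if "n \<le> N" for y n N
  proof -
    have "\<bar>S y n\<bar> \<le> (\<Sum>i<n. \<bar>h (y i) - r\<bar>)" unfolding S_def by (rule sum_abs)
    also have "\<dots> \<le> (\<Sum>i<n. h (y i) + r)"
    proof (rule sum_mono)
      fix i show "\<bar>h (y i) - r\<bar> \<le> h (y i) + r" using h0[of "y i"] r by simp
    qed
    also have "\<dots> \<le> (\<Sum>i<N. h (y i) + r)"
    proof (rule sum_mono2)
      show "0 \<le> h (y b) + r" for b using h0[of "y b"] r by simp
    qed (use that in auto)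
    finally show ?thesis .
  qed
  \<comment> \<open>A positive maximum is attained at some \<open>n >= 1\<close>. Splitting off the
    first term leaves a partial sum of the shifted sequence, which is bounded by the shifted
    maximum.\<close>
  have step: "Mx N y - Mx N (\<lambda>i. y (Suc i)) \<le> (h (y 0) - r) * of_bool (Mx N y > 0)" for N y
  proof (cases "Mx N y > 0")
    case True
    obtain n where n: "n \<le> N" "Mx N y = S y n" using Mx_ex by blast
    then obtain n' where n': "n = Suc n'" using True S0 by (cases n) auto
    have "S y (Suc n') = (h (y 0) - r) + S (\<lambda>i. y (Suc i)) n'"
      unfolding S_def by (rule sum.lessThan_Suc_shift)
    moreover have "S (\<lambda>i. y (Suc i)) n' \<le> Mx N (\<lambda>i. y (Suc i))" using n n' by (intro Mx_ge) simp
    ultimately show ?thesis using True n n' by simp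
  next
    case False
    then show ?thesis using Mx0[of N y] Mx0[of N "\<lambda>i. y (Suc i)"] by simp
  qed
  have Mx_meas: "Mx N \<in> borel_measurable (PiM UNIV (\<lambda>_. borel))" for N
    unfolding Mx_def[abs_def] S_def by (intro borel_measurable_Max) measurable
  have S_meas [measurable]: "(\<lambda>\<omega>. S (\<lambda>i. x (i + l) \<omega>) n) \<in> borel_measurable M" for n l
    unfolding S_def by measurable
  have Mx_meas' [measurable]: "(\<lambda>\<omega>. Mx N (\<lambda>i. x (i + l) \<omega>)) \<in> borel_measurable M" for N l
    unfolding Mx_def by (intro borel_measurable_Max) measurable
  have int_h: "integrable M (\<lambda>\<omega>. h (x i \<omega>))" for i using integrable_ident[OF h] int by simp
  have Mx_int: "integrable M (\<lambda>\<omega>. Mx N (\<lambda>i. x (i + l) \<omega>))" for N l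
  proof (rule Bochner_Integration.integrable_bound)
    show "integrable M (\<lambda>\<omega>. \<Sum>i<N. h (x (i + l) \<omega>) + r)"
      by (intro Bochner_Integration.integrable_sum Bochner_Integration.integrable_add int_h integrable_const)
    show "AE \<omega> in M. norm (Mx N (\<lambda>i. x (i + l) \<omega>)) \<le> norm (\<Sum>i<N. h (x (i + l) \<omega>) + r)"
    proof (rule AE_I2)
      fix \<omega>
      obtain n where n: "n \<le> N" "Mx N (\<lambda>i. x (i + l) \<omega>) = S (\<lambda>i. x (i + l) \<omega>) n" using Mx_ex by blast
      show "norm (Mx N (\<lambda>i. x (i + l) \<omega>)) \<le> norm (\<Sum>i<N. h (x (i + l) \<omega>) + r)"
        using S_abs[OF n(1), of "\<lambda>i. x (i + l) \<omega>"] unfolding n(2) by simp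
    qed
  qed measurable
  define A where "A N = {\<omega> \<in> space M. Mx N (\<lambda>i. x i \<omega>) > 0}" for N
  have A_sets: "A N \<in> sets M" for N unfolding A_def using Mx_meas'[of N 0] by simp
  have A_le: "measure M (A N) \<le> expectation (\<lambda>\<omega>. h (x 0 \<omega>)) / r" for N
  proof -
    have intA: "integrable M (\<lambda>\<omega>. h (x 0 \<omega>) * indicator (A N) \<omega>)"
      using int A_sets[of N] by (intro integrable_real_mult_indicator) auto
    have intA': "integrable M (\<lambda>\<omega>. r * indicator (A N) \<omega>)"
      by (intro integrable_real_mult_indicator A_sets integrable_const)
    \<comment> \<open>By stationarity both maxima have the same expectation, so \<open>step\<close>
      integrates to a nonnegative integral of \<open>h - r\<close> over \<open>A N\<close>.\<close>
    have "0 = expectation (\<lambda>\<omega>. Mx N (\<lambda>i. x i \<omega>)) - expectation (\<lambda>\<omega>. Mx N (\<lambda>i. x (Suc i) \<omega>))"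
      using expectation_shift[OF Mx_meas] by simp
    also have "\<dots> = expectation (\<lambda>\<omega>. Mx N (\<lambda>i. x i \<omega>) - Mx N (\<lambda>i. x (Suc i) \<omega>))"
      using Mx_int[of N 0] Mx_int[of N 1] by (subst Bochner_Integration.integral_diff) simp_all
    also have "\<dots> \<le> expectation (\<lambda>\<omega>. h (x 0 \<omega>) * indicator (A N) \<omega> - r * indicator (A N) \<omega>)"
    proof (rule integral_mono)
      show "integrable M (\<lambda>\<omega>. Mx N (\<lambda>i. x i \<omega>) - Mx N (\<lambda>i. x (Suc i) \<omega>))"
        using Mx_int[of N 0] Mx_int[of N 1] by (intro Bochner_Integration.integrable_diff) simp_all
      show "integrable M (\<lambda>\<omega>. h (x 0 \<omega>) * indicator (A N) \<omega> - r * indicator (A N) \<omega>)"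
        by (intro Bochner_Integration.integrable_diff intA intA')
      fix \<omega> assume "\<omega> \<in> space M"
      then have ind: "indicator (A N) \<omega> = (of_bool (Mx N (\<lambda>i. x i \<omega>) > 0) :: real)" by (simp add: A_def)
      show "Mx N (\<lambda>i. x i \<omega>) - Mx N (\<lambda>i. x (Suc i) \<omega>) \<le> h (x 0 \<omega>) * indicator (A N) \<omega> - r * indicator (A N) \<omega>"
        unfolding ind using step[of N "\<lambda>i. x i \<omega>"] by (simp only: left_diff_distrib)
    qed
    also have "\<dots> = expectation (\<lambda>\<omega>. h (x 0 \<omega>) * indicator (A N) \<omega>) - r * measure M (A N)"
      using intA intA' A_sets[of N] by (subst Bochner_Integration.integral_diff) simp_all
    also have "expectation (\<lambda>\<omega>. h (x 0 \<omega>) * indicator (A N) \<omega>) \<le> expectation (\<lambda>\<omega>. h (x 0 \<omega>))"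
      by (intro integral_mono intA int) (auto simp: indicator_def h0)
    finally show ?thesis using r by (simp add: le_divide_eq mult.commute)
  qed
  have "{\<omega> \<in> space M. \<exists>n. (\<Sum>i<n. h (x i \<omega>)) > r * real n} = (\<Union>N. A N)"
  proof (intro equalityI subsetI)
    fix \<omega> assume "\<omega> \<in> {\<omega> \<in> space M. \<exists>n. (\<Sum>i<n. h (x i \<omega>)) > r * real n}"
    then obtain n where w: "\<omega> \<in> space M" and "(\<Sum>i<n. h (x i \<omega>)) > r * real n" by blast
    then have "S (\<lambda>i. x i \<omega>) n > 0" by (simp add: S_def sum_subtractf mult.commute)
    then have "Mx n (\<lambda>i. x i \<omega>) > 0" using Mx_ge[of n n "\<lambda>i. x i \<omega>"] by simp
    then show "\<omega> \<in> (\<Union>N. A N)" using w by (auto simp: A_def)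
  next
    fix \<omega> assume "\<omega> \<in> (\<Union>N. A N)"
    then obtain N where w: "\<omega> \<in> space M" and pos: "Mx N (\<lambda>i. x i \<omega>) > 0" by (auto simp: A_def)
    obtain n where "Mx N (\<lambda>i. x i \<omega>) = S (\<lambda>i. x i \<omega>) n" using Mx_ex by blast
    then have "(\<Sum>i<n. h (x i \<omega>)) > r * real n" using pos by (simp add: S_def sum_subtractf mult.commute)
    then show "\<omega> \<in> {\<omega> \<in> space M. \<exists>n. (\<Sum>i<n. h (x i \<omega>)) > r * real n}" using w by blast
  qed
  moreover have "(\<lambda>N. measure M (A N)) \<longlonglongrightarrow> measure M (\<Union>N. A N)"
  proof (rule finite_Lim_measure_incseq)
    show "incseq A"
    proof (rule incseq_SucI)
      fix N
      have "Mx N y \<le> Mx (Suc N) y" for y unfolding Mx_def by (intro Max_mono) auto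
      then show "A N \<subseteq> A (Suc N)" unfolding A_def by (auto intro: less_le_trans)
    qed
  qed (use A_sets in auto)
  ultimately show ?thesis using A_le by (auto intro: LIMSEQ_le_const2)
qed

text \<open>Cutting off at height \<open>m\<close> disturbs mean and variance slightly; recentring
  and rescaling restore them exactly, so that the approximating input satisfies (A1).\<close>

lemma truncation:
  assumes "\<epsilon> > 0"
  obtains f :: "real \<Rightarrow> real" and C where "f \<in> borel_measurable borel" "\<And>y. \<bar>f y\<bar> \<le> C"
    "expectation (\<lambda>\<omega>. f (x 0 \<omega>)) = 0" "expectation (\<lambda>\<omega>. (f (x 0 \<omega>))\<^sup>2) = 1"
    "expectation (\<lambda>\<omega>. (x 0 \<omega> - f (x 0 \<omega>))\<^sup>2) < \<epsilon>"
proof -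
  define T where "T m y = y * indicator {- real m..real m} y" for m :: nat and y :: real
  have T_meas [measurable]: "T m \<in> borel_measurable borel" for m unfolding T_def[abs_def] by measurable
  have T_abs: "\<bar>T m y\<bar> \<le> \<bar>y\<bar>" "\<bar>T m y\<bar> \<le> real m" "(T m y)\<^sup>2 \<le> y\<^sup>2" for m y
    by (auto simp: T_def indicator_def)
  have T_lim: "(\<lambda>m. T m y) \<longlonglongrightarrow> y" for y
  proof (rule tendsto_eventually)
    obtain N where N: "\<bar>y\<bar> \<le> real N" using real_arch_simple by blast
    show "eventually (\<lambda>m. T m y = y) sequentially"
      by (rule eventually_sequentiallyI[of N]) (use N in \<open>auto simp: T_def indicator_def\<close>)
  qed
  define a where "a m = expectation (\<lambda>\<omega>. T m (x 0 \<omega>))" for m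
  define b where "b m = expectation (\<lambda>\<omega>. (T m (x 0 \<omega>))\<^sup>2)" for m
  have "(\<lambda>m. expectation (\<lambda>\<omega>. T m (x 0 \<omega>))) \<longlonglongrightarrow> expectation (x 0)"
    by (rule integral_dominated_convergence[where w = "\<lambda>\<omega>. \<bar>x 0 \<omega>\<bar>"])
      (use int_x T_lim T_abs(1) in \<open>auto intro: integrable_abs\<close>)
  then have a: "a \<longlonglongrightarrow> 0" by (simp add: a_def[abs_def] mean)
  have "(\<lambda>m. expectation (\<lambda>\<omega>. (T m (x 0 \<omega>))\<^sup>2)) \<longlonglongrightarrow> expectation (\<lambda>\<omega>. (x 0 \<omega>)\<^sup>2)"
  proof (rule integral_dominated_convergence[where w = "\<lambda>\<omega>. (x 0 \<omega>)\<^sup>2"])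
    show "AE \<omega> in M. (\<lambda>m. (T m (x 0 \<omega>))\<^sup>2) \<longlonglongrightarrow> (x 0 \<omega>)\<^sup>2" by (intro AE_I2 tendsto_power T_lim)
    show "AE \<omega> in M. norm ((T m (x 0 \<omega>))\<^sup>2) \<le> (x 0 \<omega>)\<^sup>2" for m using T_abs(3) by (intro AE_I2) simp
  qed (use int_sq in measurable)
  then have b: "b \<longlonglongrightarrow> 1" by (simp add: b_def[abs_def] var)
  have s2: "(\<lambda>m. b m - (a m)\<^sup>2) \<longlonglongrightarrow> 1 - 0\<^sup>2" by (intro tendsto_intros a b)
  \<comment> \<open>This is the exact squared distance: both variables have second moment 1, and
    their mixed moment is \<open>b m / s\<close> because \<open>y * T m y = (T m y)^2\<close> and
    the input has mean 0.\<close>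
  have "(\<lambda>m. 2 - 2 * (b m / sqrt (b m - (a m)\<^sup>2))) \<longlonglongrightarrow> 2 - 2 * (1 / sqrt (1 - 0\<^sup>2))"
    by (intro tendsto_intros a b) simp
  then have "(\<lambda>m. 2 - 2 * (b m / sqrt (b m - (a m)\<^sup>2))) \<longlonglongrightarrow> 0" by simp
  then have "eventually (\<lambda>m. 2 - 2 * (b m / sqrt (b m - (a m)\<^sup>2)) < \<epsilon>) sequentially"
    using assms by (rule order_tendstoD(2))
  moreover have "eventually (\<lambda>m. 0 < b m - (a m)\<^sup>2) sequentially" using s2 by (rule order_tendstoD(1)) simp
  ultimately have "eventually (\<lambda>m. 2 - 2 * (b m / sqrt (b m - (a m)\<^sup>2)) < \<epsilon> \<and> 0 < b m - (a m)\<^sup>2) sequentially"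
    by (rule eventually_conj)
  then obtain m where m: "2 - 2 * (b m / sqrt (b m - (a m)\<^sup>2)) < \<epsilon>" "0 < b m - (a m)\<^sup>2"
    using eventually_happens'[OF sequentially_bot] by blast
  define s where "s = sqrt (b m - (a m)\<^sup>2)"
  have s: "s > 0" "s\<^sup>2 = b m - (a m)\<^sup>2" using m(2) by (simp_all add: s_def)
  define f where "f y = (T m y - a m) / s" for y
  have iT: "integrable M (\<lambda>\<omega>. T m (x 0 \<omega>))"
    by (rule integrable_const_bound[where B = "real m"]) (use T_abs(2) in auto)
  have iT2: "integrable M (\<lambda>\<omega>. (T m (x 0 \<omega>))\<^sup>2)"
    by (rule Bochner_Integration.integrable_bound[OF int_sq]) (use T_abs(3) in auto)
  have xT: "y * T m y = (T m y)\<^sup>2" for y by (simp add: T_def indicator_def power2_eq_square)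
  show ?thesis
  proof (rule that[of f "(real m + \<bar>a m\<bar>) / s"])
    show "f \<in> borel_measurable borel" unfolding f_def[abs_def] by measurable
    show "\<bar>f y\<bar> \<le> (real m + \<bar>a m\<bar>) / s" for y
    proof -
      have "\<bar>T m y - a m\<bar> \<le> real m + \<bar>a m\<bar>" using T_abs(2)[of m y] by linarith
      then show ?thesis using s(1) by (simp add: f_def divide_right_mono)
    qed
    show "expectation (\<lambda>\<omega>. f (x 0 \<omega>)) = 0"
      unfolding f_def using iT by (simp add: prob_space a_def)
    have f2: "(f y)\<^sup>2 = ((T m y)\<^sup>2 - 2 * a m * T m y + (a m)\<^sup>2) / s\<^sup>2" for y
      by (simp add: f_def power_divide power2_diff algebra_simps)
    have if2: "integrable M (\<lambda>\<omega>. (f (x 0 \<omega>))\<^sup>2)" unfolding f2 using iT iT2 by simp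
    have "expectation (\<lambda>\<omega>. (f (x 0 \<omega>))\<^sup>2) = (b m - 2 * a m * a m + (a m)\<^sup>2) / s\<^sup>2"
      unfolding f2 using iT iT2 by (simp add: prob_space a_def b_def)
    also have "\<dots> = 1" using s m(2) by (simp add: power2_eq_square)
    finally show ef2: "expectation (\<lambda>\<omega>. (f (x 0 \<omega>))\<^sup>2) = 1" .
    have xf: "y * f y = ((T m y)\<^sup>2 - a m * y) / s" for y
      by (simp add: f_def xT[symmetric] right_diff_distrib mult.commute)
    have ixf: "integrable M (\<lambda>\<omega>. x 0 \<omega> * f (x 0 \<omega>))" unfolding xf using iT2 int_x by simp
    have exf: "expectation (\<lambda>\<omega>. x 0 \<omega> * f (x 0 \<omega>)) = b m / s"
      unfolding xf using iT2 int_x by (simp add: mean b_def)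
    have sq: "(y - f y)\<^sup>2 = y\<^sup>2 - 2 * (y * f y) + (f y)\<^sup>2" for y by (simp add: power2_diff mult.assoc)
    have "expectation (\<lambda>\<omega>. (x 0 \<omega> - f (x 0 \<omega>))\<^sup>2) = 1 - 2 * (b m / s) + 1"
      unfolding sq using int_sq ixf if2 by (simp add: var ef2 exf)
    then show "expectation (\<lambda>\<omega>. (x 0 \<omega> - f (x 0 \<omega>))\<^sup>2) < \<epsilon>" using m(1) by (simp add: s_def)
  qed
qed

lemma input_A1_bounded_function:
  assumes f [measurable]: "f \<in> borel_measurable borel" and C: "\<And>y. \<bar>f y\<bar> \<le> C"
    and m: "expectation (\<lambda>\<omega>. f (x 0 \<omega>)) = 0" and v: "expectation (\<lambda>\<omega>. (f (x 0 \<omega>))\<^sup>2) = 1"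
  shows "input_A1 M (\<lambda>i \<omega>. f (x i \<omega>))"
proof -
  have C0: "0 \<le> C" using C[of 0] by simp
  have "mean0_var1 M (\<lambda>\<omega>. f (x i \<omega>))" for i
  proof -
    have e: "expectation (\<lambda>\<omega>. f (x i \<omega>)) = 0" "expectation (\<lambda>\<omega>. (f (x i \<omega>))\<^sup>2) = 1"
      using expectation_ident[of f i] expectation_ident[of "\<lambda>y. (f y)\<^sup>2" i] m v by simp_all
    have "integrable M (\<lambda>\<omega>. f (x i \<omega>))"
      by (rule integrable_const_bound[where B = C]) (use C in auto)
    moreover have "integrable M (\<lambda>\<omega>. (f (x i \<omega>))\<^sup>2)"
    proof (rule integrable_const_bound[where B = "C\<^sup>2"])
      have "(f y)\<^sup>2 \<le> C\<^sup>2" for y using C[of y] by (intro abs_le_square_iff[THEN iffD1]) (use C0 in simp)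
      then show "AE \<omega> in M. norm ((f (x i \<omega>))\<^sup>2) \<le> C\<^sup>2" by simp
    qed measurable
    ultimately show ?thesis unfolding mean0_var1_def e by (simp add: e)
  qed
  moreover have "indep_vars (\<lambda>_. borel) (\<lambda>i \<omega>. f (x i \<omega>)) UNIV"
    by (rule indep_vars_compose2[OF indep]) measurable
  ultimately show ?thesis unfolding input_A1_def using C by (auto intro!: exI[of _ C])
qed

text \<open>For almost every sample, all late levels \<open>m\<close> approximate the input well for
  all \<open>n\<close> simultaneously. So \<open>m\<close> can be fixed from the tolerance before
  \<open>n\<close> tends to infinity.\<close>

theorem AE_toeplitz_char_tendsto_iid:
  assumes c: "phase c"
  shows "AE \<omega> in M. \<forall>t. (\<lambda>n. toeplitz_char c (\<lambda>i. x i \<omega>) n t) \<longlonglongrightarrow> limit_char t"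
proof -
  define good where "good m f \<longleftrightarrow> f \<in> borel_measurable borel \<and> (\<exists>C. \<forall>y. \<bar>f y\<bar> \<le> C) \<and> expectation (\<lambda>\<omega>. f (x 0 \<omega>)) = 0
      \<and> expectation (\<lambda>\<omega>. (f (x 0 \<omega>))\<^sup>2) = 1 \<and> expectation (\<lambda>\<omega>. (x 0 \<omega> - f (x 0 \<omega>))\<^sup>2) < (1 / 4) ^ m"
    for m :: nat and f :: "real \<Rightarrow> real"
  have "\<exists>f. good m f" for m
  proof -
    have "(0 :: real) < (1 / 4) ^ m" by simp
    then obtain f C where "f \<in> borel_measurable borel" "\<And>y. \<bar>f y\<bar> \<le> C"
      "expectation (\<lambda>\<omega>. f (x 0 \<omega>)) = 0" "expectation (\<lambda>\<omega>. (f (x 0 \<omega>))\<^sup>2) = 1"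
      "expectation (\<lambda>\<omega>. (x 0 \<omega> - f (x 0 \<omega>))\<^sup>2) < (1 / 4) ^ m"
      using truncation[of "(1 / 4) ^ m"] by blast
    then have "good m f" unfolding good_def by blast
    then show ?thesis by blast
  qed
  then have "\<exists>f. \<forall>m. good m (f m)" by (intro choice allI)
  then obtain f where good: "\<And>m. good m (f m)" by blast
  have f_meas [measurable]: "f m \<in> borel_measurable borel" and f_bd: "\<exists>C. \<forall>y. \<bar>f m y\<bar> \<le> C"
    and f_mean: "expectation (\<lambda>\<omega>. f m (x 0 \<omega>)) = 0" and f_var: "expectation (\<lambda>\<omega>. (f m (x 0 \<omega>))\<^sup>2) = 1"
    and f_close: "expectation (\<lambda>\<omega>. (x 0 \<omega> - f m (x 0 \<omega>))\<^sup>2) < (1 / 4) ^ m" for m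
    using good[of m] unfolding good_def by blast+
  have A1: "input_A1 M (\<lambda>i \<omega>. f m (x i \<omega>))" for m
  proof -
    obtain C where "\<And>y. \<bar>f m y\<bar> \<le> C" using f_bd[of m] by blast
    then show ?thesis by (rule input_A1_bounded_function[OF f_meas _ f_mean f_var])
  qed
  have conv: "AE \<omega> in M. \<forall>m t. (\<lambda>n. toeplitz_char c (\<lambda>i. f m (x i \<omega>)) n t) \<longlonglongrightarrow> limit_char t"
    unfolding AE_all_countable
    using centered_input.AE_toeplitz_char_tendsto[OF centered_input_A1[OF prob_space_axioms A1] c] by blast
  define h where "h m y = (y - f m y)\<^sup>2" for m y
  have h_meas [measurable]: "h m \<in> borel_measurable borel" for m unfolding h_def[abs_def] by measurable
  have h_int: "integrable M (\<lambda>\<omega>. h m (x 0 \<omega>))" for m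
  proof -
    obtain C where C: "\<And>y. \<bar>f m y\<bar> \<le> C" using f_bd[of m] by blast
    have "integrable M (\<lambda>\<omega>. 2 * (x 0 \<omega>)\<^sup>2 + 2 * C\<^sup>2)" using int_sq by simp
    then show ?thesis
    proof (rule Bochner_Integration.integrable_bound)
      have "h m y \<le> 2 * y\<^sup>2 + 2 * C\<^sup>2" for y
      proof -
        have "h m y \<le> 2 * y\<^sup>2 + 2 * (f m y)\<^sup>2"
          using zero_le_power2[of "y + f m y"] by (simp add: h_def power2_eq_square algebra_simps)
        moreover have "(f m y)\<^sup>2 \<le> C\<^sup>2" using C[of y] by (intro abs_le_square_iff[THEN iffD1]) simp
        ultimately show ?thesis by linarith
      qed
      moreover have "0 \<le> h m y" for y by (simp add: h_def)
      ultimately show "AE \<omega> in M. norm (h m (x 0 \<omega>)) \<le> norm (2 * (x 0 \<omega>)\<^sup>2 + 2 * C\<^sup>2)" by (intro AE_I2) (simp add: order.trans)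
    qed measurable
  qed
  \<comment> \<open>The accuracy \<open>(1 / 4) ^ m\<close> of the truncation against the threshold
    \<open>(1 / 2) ^ m\<close> leaves probability at most \<open>(1 / 2) ^ m\<close>, which is
    summable.\<close>
  define B where "B m = {\<omega> \<in> space M. \<exists>n. (\<Sum>i<n. h m (x i \<omega>)) > (1 / 2) ^ m * real n}" for m
  have B_sets: "B m \<in> sets M" for m unfolding B_def by measurable
  have B_le: "measure M (B m) \<le> (1 / 2) ^ m" for m
  proof -
    have "measure M (B m) \<le> expectation (\<lambda>\<omega>. h m (x 0 \<omega>)) / (1 / 2) ^ m"
      unfolding B_def by (rule maximal_inequality[OF h_meas _ h_int]) (simp_all add: h_def)
    also have "\<dots> \<le> (1 / 4) ^ m / (1 / 2) ^ m"
      using f_close[of m] by (intro divide_right_mono) (simp_all add: h_def)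
    also have "\<dots> = (1 / 2) ^ m" by (simp add: power_divide[symmetric])
    finally show ?thesis .
  qed
  have "AE \<omega> in M. eventually (\<lambda>m. \<omega> \<in> space M - B m) sequentially"
  proof (rule borel_cantelli_AE1[OF B_sets])
    show "summable (\<lambda>m. measure M (B m))"
      by (rule summable_comparison_test[of _ "\<lambda>m. (1 / 2) ^ m"]) (use B_le in \<open>auto intro!: exI[of _ 0] summable_geometric\<close>)
  qed (simp add: less_top[symmetric])
  with conv show ?thesis
  proof eventually_elim
    case (elim \<omega>)
    show ?case
    proof (intro allI tendstoI)
      fix t \<epsilon> :: real assume e: "\<epsilon> > 0"
      have "(\<lambda>m. \<bar>t\<bar> * sqrt (2 * (1 / 2) ^ m)) \<longlonglongrightarrow> \<bar>t\<bar> * sqrt (2 * 0)"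
        by (intro tendsto_intros LIMSEQ_power_zero) simp
      then have "eventually (\<lambda>m. \<bar>t\<bar> * sqrt (2 * (1 / 2) ^ m) < \<epsilon> / 2) sequentially"
        by (rule order_tendstoD(2)) (use e in simp)
      from eventually_conj[OF this elim(2)] obtain m where m: "\<bar>t\<bar> * sqrt (2 * (1 / 2) ^ m) < \<epsilon> / 2" "\<omega> \<in> space M - B m"
        using eventually_happens'[OF sequentially_bot] by blast
      have close: "cmod (toeplitz_char c (\<lambda>i. x i \<omega>) n t - toeplitz_char c (\<lambda>i. f m (x i \<omega>)) n t) < \<epsilon> / 2" if n: "n > 0" for n
      proof -
        have "(\<Sum>i<n. h m (x i \<omega>)) \<le> (1 / 2) ^ m * real n" using m(2) by (auto simp: B_def not_less)
        then have "(\<Sum>i<n. (x i \<omega> - f m (x i \<omega>))\<^sup>2) \<le> (1 / 2) ^ m * real n" by (simp only: h_def)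
        then have "2 * (\<Sum>i<n. (x i \<omega> - f m (x i \<omega>))\<^sup>2) / real n \<le> 2 * (1 / 2) ^ m"
          using n by (simp add: divide_le_eq)
        then have "\<bar>t\<bar> * sqrt (2 * (\<Sum>i<n. (x i \<omega> - f m (x i \<omega>))\<^sup>2) / real n) \<le> \<bar>t\<bar> * sqrt (2 * (1 / 2) ^ m)"
          by (intro mult_left_mono real_sqrt_le_mono) auto
        then show ?thesis using toeplitz_char_diff_input[OF c n, of "\<lambda>i. x i \<omega>" t "\<lambda>i. f m (x i \<omega>)"] m(1) by linarith
      qed
      have "eventually (\<lambda>n. dist (toeplitz_char c (\<lambda>i. f m (x i \<omega>)) n t) (limit_char t) < \<epsilon> / 2) sequentially"
        using elim(1) e by (intro tendstoD) auto
      then show "eventually (\<lambda>n. dist (toeplitz_char c (\<lambda>i. x i \<omega>) n t) (limit_char t) < \<epsilon>) sequentially"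
        using eventually_gt_at_top[of 0]
      proof eventually_elim
        case (elim n)
        have "dist (toeplitz_char c (\<lambda>i. x i \<omega>) n t) (limit_char t)
          \<le> dist (toeplitz_char c (\<lambda>i. x i \<omega>) n t) (toeplitz_char c (\<lambda>i. f m (x i \<omega>)) n t)
            + dist (toeplitz_char c (\<lambda>i. f m (x i \<omega>)) n t) (limit_char t)" by (rule dist_triangle)
        then show ?case using elim(1) close[OF elim(2)] unfolding dist_norm by linarith
      qed
    qed
  qed
qed

end

lemma iid_input_A2:
  assumes "prob_space M" "input_A2 M x"
  shows "iid_input M x"
proof -
  interpret prob_space M by fact
  show ?thesis
    using assms(2) mean0_var1D[OF assms(1), of "x 0"] unfolding input_A2_def by unfold_locales blast+
qed

section \<open>The limiting spectral distribution\<close>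

definition toeplitz_cdf :: "(int \<Rightarrow> complex) \<Rightarrow> (nat \<Rightarrow> real) \<Rightarrow> nat \<Rightarrow> real \<Rightarrow> real" where
  "toeplitz_cdf c a n y = real (card {j. j < n \<and> toeplitz_ev c a n j \<le> y}) / real n"

text \<open>For \<open>n = 0\<close> there are no eigenvalues and \<open>toeplitz_cdf\<close> is not a distribution function, so an
  arbitrary distribution is used there.\<close>

definition toeplitz_distr :: "(int \<Rightarrow> complex) \<Rightarrow> (nat \<Rightarrow> real) \<Rightarrow> nat \<Rightarrow> real measure" where
  "toeplitz_distr c a n = (if n = 0 then counting_distr 1 (\<lambda>_. 0) else counting_distr n (toeplitz_ev c a n))"

lemma real_distribution_toeplitz_distr: "real_distribution (toeplitz_distr c a n)"
  by (simp add: toeplitz_distr_def real_distribution_counting_distr)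

lemma char_toeplitz_distr: "n > 0 \<Longrightarrow> char (toeplitz_distr c a n) t = toeplitz_char c a n t"
  by (simp add: toeplitz_distr_def char_counting_distr toeplitz_char_def)

lemma weak_conv_toeplitz_cdf:
  "weak_conv (toeplitz_cdf c a) (cdf \<mu>) \<longleftrightarrow> weak_conv_m (toeplitz_distr c a) \<mu>"
proof -
  have "(\<lambda>n. toeplitz_cdf c a n y) \<longlonglongrightarrow> l \<longleftrightarrow> (\<lambda>n. cdf (toeplitz_distr c a n) y) \<longlonglongrightarrow> l" for y l
  proof (rule tendsto_cong)
    show "eventually (\<lambda>n. toeplitz_cdf c a n y = cdf (toeplitz_distr c a n) y) sequentially"
    proof (rule eventually_sequentiallyI[of 1])
      fix n :: nat assume "1 \<le> n"
      then show "toeplitz_cdf c a n y = cdf (toeplitz_distr c a n) y"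
        by (simp add: toeplitz_cdf_def toeplitz_distr_def cdf_counting_distr)
    qed
  qed
  then show ?thesis by (simp add: weak_conv_def weak_conv_m_def)
qed

lemma char_toeplitz_distr_tendsto:
  assumes "(\<lambda>n. toeplitz_char c a n t) \<longlonglongrightarrow> l"
  shows "(\<lambda>n. char (toeplitz_distr c a n) t) \<longlonglongrightarrow> l"
  by (rule Lim_transform_eventually[OF assms], rule eventually_sequentiallyI[of 1]) (simp add: char_toeplitz_distr)

lemma weak_conv_toeplitz:
  assumes "real_distribution \<mu>" "char \<mu> = limit_char"
    and "\<And>t. (\<lambda>n. toeplitz_char c a n t) \<longlonglongrightarrow> limit_char t"
  shows "weak_conv (toeplitz_cdf c a) (cdf \<mu>)"
  unfolding weak_conv_toeplitz_cdf
  by (rule levy_continuity[OF real_distribution_toeplitz_distr assms(1)])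
    (use char_toeplitz_distr_tendsto[OF assms(3)] assms(2) in simp)

lemma char_eq_limit_char:
  assumes "real_distribution \<mu>" "weak_conv (toeplitz_cdf c a) (cdf \<mu>)"
    and "\<And>t. (\<lambda>n. toeplitz_char c a n t) \<longlonglongrightarrow> limit_char t"
  shows "char \<mu> = limit_char"
proof
  fix t
  have "(\<lambda>n. char (toeplitz_distr c a n) t) \<longlonglongrightarrow> char \<mu> t"
    by (rule levy_continuity1[OF real_distribution_toeplitz_distr assms(1)])
      (use assms(2) in \<open>simp add: weak_conv_toeplitz_cdf\<close>)
  then show "char \<mu> t = limit_char t"
    using char_toeplitz_distr_tendsto[OF assms(3)] by (rule LIMSEQ_unique)
qed

text \<open>One deterministic input with convergent moments suffices: bounded second moments give
  tightness, and every subsequential limit law has characteristic function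
  \<open>limit_char\<close>.\<close>

lemma limit_distribution_exists:
  assumes "\<And>k. k > 0 \<Longrightarrow> (\<lambda>r. toeplitz_mom c a ((Suc r)\<^sup>2) k) \<longlonglongrightarrow> toeplitz_moment k"
  obtains \<mu> where "real_distribution \<mu>" "char \<mu> = limit_char"
proof -
  let ?N = "\<lambda>r :: nat. (Suc r)\<^sup>2"
  define \<mu> where "\<mu> r = counting_distr (?N r) (toeplitz_ev c a (?N r))" for r
  have rd: "real_distribution (\<mu> r)" for r unfolding \<mu>_def by (rule real_distribution_counting_distr)
  have "Bseq (\<lambda>r. toeplitz_mom c a (?N r) 2)"
    using assms[of 2] by (intro convergent_imp_Bseq convergentI) auto
  then obtain C where C: "C > 0" "\<And>r. \<bar>toeplitz_mom c a (?N r) 2\<bar> \<le> C" unfolding Bseq_def by auto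
  have "tight \<mu>"
    unfolding tight_def
  proof (intro conjI allI impI rd)
    fix \<epsilon> :: real assume e: "\<epsilon> > 0"
    \<comment> \<open>Chosen so that Chebyshev's bound \<open>C / b^2\<close> equals half of the
      tolerance.\<close>
    define b where "b = sqrt (2 * C / \<epsilon>)"
    have b: "b > 0" "b\<^sup>2 = 2 * C / \<epsilon>" using C e by (simp_all add: b_def)
    have "1 - \<epsilon> < measure (\<mu> r) {- b<..b}" for r
    proof -
      interpret real_distribution "\<mu> r" by (rule rd)
      have i: "integral\<^sup>L (\<mu> r) (\<lambda>y. y\<^sup>2) = toeplitz_mom c a (?N r) 2" "integrable (\<mu> r) (\<lambda>y. y\<^sup>2)"
        unfolding \<mu>_def toeplitz_mom_def
        by (subst integral_counting_distr(1), simp, simp, simp only: real_scaleR_def divide_inverse mult.commute)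
          (rule integral_counting_distr(2); simp)
      have "measure (\<mu> r) {y \<in> space (\<mu> r). b \<le> \<bar>y\<bar>} \<le> toeplitz_mom c a (?N r) 2 / b\<^sup>2"
        unfolding i(1)[symmetric] by (rule second_moment_method[OF _ i(2) b(1)]) simp
      also have "\<dots> \<le> C / b\<^sup>2" using C(2)[of r] by (intro divide_right_mono) auto
      also have "\<dots> = \<epsilon> / 2" unfolding b(2) using C(1) by simp
      finally have "measure (\<mu> r) {y. b \<le> \<bar>y\<bar>} \<le> \<epsilon> / 2" by simp
      moreover have "1 - measure (\<mu> r) {y. b \<le> \<bar>y\<bar>} = measure (\<mu> r) (space (\<mu> r) - {y. b \<le> \<bar>y\<bar>})"
        by (rule prob_compl[symmetric]) simp
      moreover have "measure (\<mu> r) (space (\<mu> r) - {y. b \<le> \<bar>y\<bar>}) \<le> measure (\<mu> r) {- b<..b}"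
        by (rule finite_measure_mono) auto
      ultimately show ?thesis using e by linarith
    qed
    then show "\<exists>a b. a < b \<and> (\<forall>r. 1 - \<epsilon> < measure (\<mu> r) {a<..b})"
      using b(1) by (intro exI[of _ "- b"] exI[of _ b]) auto
  qed
  then obtain q \<nu> where q: "strict_mono (q :: nat \<Rightarrow> nat)" and nu: "real_distribution \<nu>" and w: "weak_conv_m (\<mu> \<circ> id \<circ> q) \<nu>"
    using tight_imp_convergent_subsubsequence[of \<mu> id] by (auto simp: strict_mono_id)
  have "char \<nu> t = limit_char t" for t
  proof -
    have "(\<lambda>n. char ((\<mu> \<circ> id \<circ> q) n) t) \<longlonglongrightarrow> char \<nu> t"
      by (rule levy_continuity1[OF _ nu w]) (simp add: rd)
    moreover have "(\<lambda>r. char (\<mu> r) t) \<longlonglongrightarrow> limit_char t"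
      using toeplitz_char_limit_of_moments[of ?N c a t] assms
      by (simp add: \<mu>_def char_counting_distr toeplitz_char_def)
    then have "((\<lambda>r. char (\<mu> r) t) \<circ> q) \<longlonglongrightarrow> limit_char t" using q by (rule LIMSEQ_subseq_LIMSEQ)
    ultimately show ?thesis by (intro LIMSEQ_unique) (auto simp: o_def)
  qed
  then show ?thesis using that[OF nu] by blast
qed

lemma AE_toeplitz_char_input:
  assumes "prob_space M" "input_A1 M x \<or> input_A2 M x \<or> input_A3 M x" "phase c"
  shows "AE \<omega> in M. \<forall>t. (\<lambda>n. toeplitz_char c (\<lambda>i. x i \<omega>) n t) \<longlonglongrightarrow> limit_char t"
  using assms(2)
proof (elim disjE)
  assume "input_A1 M x"
  from centered_input.AE_toeplitz_char_tendsto[OF centered_input_A1[OF assms(1) this] assms(3)] show ?thesis .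
next
  assume "input_A2 M x"
  from iid_input.AE_toeplitz_char_tendsto_iid[OF iid_input_A2[OF assms(1) this] assms(3)] show ?thesis .
next
  assume "input_A3 M x"
  from centered_input.AE_toeplitz_char_tendsto[OF centered_input_A3[OF assms(1) this] assms(3)] show ?thesis .
qed

section \<open>Identification with the symmetric and skew-symmetric Toeplitz matrices\<close>

lemma eigenbasis_cong:
  assumes "eigenbasis n a u lam" "\<And>i l. i < n \<Longrightarrow> l < n \<Longrightarrow> b i l = a i l"
  shows "eigenbasis n b u lam"
  using assms unfolding eigenbasis_def by simp

text \<open>The sign of the displacement is +1 above the diagonal, as in the sign matrix, and
  \<open>sgn 0 = 0\<close> produces the zero diagonal.\<close>

definition skew_phase :: "int \<Rightarrow> complex" where
  "skew_phase s = \<i> * of_int (sgn s)"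

lemma phase_one: "phase (\<lambda>_. 1)"
  by (simp add: phase_def)

lemma phase_skew: "phase skew_phase"
  by (auto simp: phase_def skew_phase_def norm_mult sgn_if)

lemma toeplitz_esd_eq: "toeplitz_esd x n \<omega> = toeplitz_cdf (\<lambda>_. 1) (\<lambda>i. x i \<omega>) n"
proof
  fix y
  let ?A = "(1 / sqrt (real n)) \<cdot>\<^sub>m toeplitz_mat (\<lambda>i. x i \<omega>) n"
  have A: "?A \<in> carrier_mat n n" by (simp add: toeplitz_mat_def)
  obtain u where u: "eigenbasis n (scaled_kernel (\<lambda>_. 1) (\<lambda>i. x i \<omega>) n) u (toeplitz_ev (\<lambda>_. 1) (\<lambda>i. x i \<omega>) n)"
    using toeplitz_ev_eigenbasis[OF phase_one] .
  have "eigenbasis n (\<lambda>i l. complex_of_real (?A $$ (i, l))) u (toeplitz_ev (\<lambda>_. 1) (\<lambda>i. x i \<omega>) n)"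
    by (rule eigenbasis_cong[OF u])
      (simp add: toeplitz_mat_def scaled_kernel_def toeplitz_kernel_def abs_minus_commute)
  then show "toeplitz_esd x n \<omega> y = toeplitz_cdf (\<lambda>_. 1) (\<lambda>i. x i \<omega>) n y"
    unfolding toeplitz_esd_def toeplitz_cdf_def by (rule esd_symmetric_eigenbasis[OF A])
qed

lemma skew_toeplitz_esd_eq: "skew_toeplitz_esd x n \<omega> = toeplitz_cdf skew_phase (\<lambda>i. x i \<omega>) n"
proof
  fix y
  let ?A = "(1 / sqrt (real n)) \<cdot>\<^sub>m skew_toeplitz_mat (\<lambda>i. x i \<omega>) n"
  have A: "?A \<in> carrier_mat n n" by (simp add: skew_toeplitz_mat_def schur_prod_def skew_sign_mat_def)
  obtain u where u: "eigenbasis n (scaled_kernel skew_phase (\<lambda>i. x i \<omega>) n) u (toeplitz_ev skew_phase (\<lambda>i. x i \<omega>) n)"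
    using toeplitz_ev_eigenbasis[OF phase_skew] .
  have "eigenbasis n (\<lambda>i l. \<i> * complex_of_real (?A $$ (i, l))) u (toeplitz_ev skew_phase (\<lambda>i. x i \<omega>) n)"
  proof (rule eigenbasis_cong[OF u])
    fix i l assume "i < n" "l < n"
    then show "\<i> * complex_of_real (?A $$ (i, l)) = scaled_kernel skew_phase (\<lambda>i. x i \<omega>) n i l"
      by (simp add: skew_toeplitz_mat_def schur_prod_def skew_sign_mat_def toeplitz_mat_def
          scaled_kernel_def toeplitz_kernel_def skew_phase_def abs_minus_commute sgn_if)
  qed
  then show "skew_toeplitz_esd x n \<omega> y = toeplitz_cdf skew_phase (\<lambda>i. x i \<omega>) n y"
    unfolding skew_toeplitz_esd_def toeplitz_cdf_def by (rule esd_skew_eigenbasis[OF A])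
qed

text \<open>The definition of \<open>L_T\<close> by unique existence requires some admissible input on sample points of type
  \<^typ>\<open>nat \<Rightarrow> real\<close>; independent fair signs are one.\<close>

definition sign_distr :: "real measure" where
  "sign_distr = counting_distr 2 (\<lambda>j. if j = 0 then - 1 else 1)"

definition sign_space :: "(nat \<Rightarrow> real) measure" where
  "sign_space = PiM UNIV (\<lambda>_. sign_distr)"

lemma prob_space_sign_distr: "prob_space sign_distr"
  using real_distribution_counting_distr[of 2] unfolding sign_distr_def real_distribution_def by blast

lemma sets_sign_distr [measurable_cong, simp]: "sets sign_distr = sets borel"
  by (simp add: sign_distr_def counting_distr_def)

lemma prob_space_sign_space: "prob_space sign_space"
  unfolding sign_space_def by (rule prob_space_PiM) (rule prob_space_sign_distr)

lemma distr_sign_space: "distr sign_space borel (\<lambda>\<omega>. \<omega> i) = sign_distr"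
proof -
  have "distr sign_space borel (\<lambda>\<omega>. \<omega> i) = distr sign_space sign_distr (\<lambda>\<omega>. \<omega> i)"
    by (rule distr_cong) simp_all
  also have "\<dots> = sign_distr"
    unfolding sign_space_def by (rule distr_PiM_component) (simp_all add: prob_space_sign_distr)
  finally show ?thesis .
qed

lemma sign_space_measurable [measurable]: "(\<lambda>\<omega>. \<omega> i) \<in> borel_measurable sign_space"
  unfolding sign_space_def by measurable

lemma
  fixes g :: "real \<Rightarrow> real"
  assumes [measurable]: "g \<in> borel_measurable borel"
  shows integrable_sign_space: "integrable sign_space (\<lambda>\<omega>. g (\<omega> i))"
    and integral_sign_space: "integral\<^sup>L sign_space (\<lambda>\<omega>. g (\<omega> i)) = (g (- 1) + g 1) / 2"
proof -
  have "integrable (distr sign_space borel (\<lambda>\<omega>. \<omega> i)) g"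
    unfolding distr_sign_space sign_distr_def by (rule integral_counting_distr(2)) simp_all
  then show "integrable sign_space (\<lambda>\<omega>. g (\<omega> i))" by (subst (asm) integrable_distr_eq) simp_all
  have "integral\<^sup>L sign_space (\<lambda>\<omega>. g (\<omega> i)) = integral\<^sup>L (distr sign_space borel (\<lambda>\<omega>. \<omega> i)) g"
    by (rule integral_distr[symmetric]) simp_all
  also have "\<dots> = (g (- 1) + g 1) / 2"
    unfolding distr_sign_space sign_distr_def
    by (subst integral_counting_distr(1)) (simp_all add: lessThan_nat_numeral lessThan_Suc field_simps)
  finally show "integral\<^sup>L sign_space (\<lambda>\<omega>. g (\<omega> i)) = (g (- 1) + g 1) / 2" .
qed

text \<open>Independence amounts to the joint law being the product of the marginals, and here the
  joint law of the coordinates is the product space itself.\<close>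

lemma input_A1_sign_space: "input_A1 sign_space (\<lambda>i \<omega>. \<omega> i)"
proof -
  interpret prob_space sign_space by (rule prob_space_sign_space)
  have "indep_vars (\<lambda>_. borel) (\<lambda>i \<omega>. \<omega> i) (UNIV :: nat set)"
  proof (subst indep_vars_iff_distr_eq_PiM)
    have "distr sign_space (PiM UNIV (\<lambda>_. borel)) (\<lambda>\<omega>. \<lambda>i\<in>UNIV. \<omega> i) = distr sign_space sign_space (\<lambda>\<omega>. \<omega>)"
    proof (rule distr_cong)
      show "sets (PiM UNIV (\<lambda>_ :: nat. borel :: real measure)) = sets sign_space"
        unfolding sign_space_def by (rule sets_PiM_cong) simp_all
    qed (simp_all add: restrict_UNIV)
    then show "distr sign_space (PiM UNIV (\<lambda>_. borel)) (\<lambda>\<omega>. \<lambda>i\<in>UNIV. \<omega> i) = PiM UNIV (\<lambda>i. distr sign_space borel (\<lambda>\<omega>. \<omega> i))"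
      unfolding distr_sign_space distr_id by (rule trans) (rule sign_space_def)
  qed simp_all
  moreover have "AE \<omega> in sign_space. \<bar>\<omega> i\<bar> \<le> 1" for i
  proof -
    have "AE y in sign_distr. \<bar>y\<bar> \<le> 1"
      unfolding sign_distr_def counting_distr_def by (subst AE_distr_iff) (auto simp: AE_measure_pmf_iff)
    then show ?thesis unfolding distr_sign_space[of i, symmetric] by (subst (asm) AE_distr_iff) simp_all
  qed
  moreover have "mean0_var1 sign_space (\<lambda>\<omega>. \<omega> i)" for i
    using integrable_sign_space[of "\<lambda>y. y" i] integrable_sign_space[of "\<lambda>y. y\<^sup>2" i]
      integral_sign_space[of "\<lambda>y. y" i] integral_sign_space[of "\<lambda>y. y\<^sup>2" i]
    by (simp add: mean0_var1_def)
  ultimately show ?thesis unfolding input_A1_def by blast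
qed

text \<open>An almost sure event in a probability space is nonempty, so random signs yield one
  concrete sequence whose moments converge.\<close>

lemma limit_distribution:
  obtains \<mu> where "real_distribution \<mu>" "char \<mu> = limit_char"
proof -
  interpret centered_input sign_space "\<lambda>i \<omega>. \<omega> i"
    by (rule centered_input_A1[OF prob_space_sign_space input_A1_sign_space])
  have "AE \<omega> in sign_space. \<forall>k. (\<lambda>r. toeplitz_mom (\<lambda>_. 1) (\<lambda>i. \<omega> i) ((Suc r)\<^sup>2) (Suc k)) \<longlonglongrightarrow> toeplitz_moment (Suc k)"
    unfolding AE_all_countable using AE_toeplitz_mom_tendsto[OF phase_one] by blast
  from eventually_happens'[OF ae_filter_bot this]
  obtain \<omega> where \<omega>: "\<And>k. (\<lambda>r. toeplitz_mom (\<lambda>_. 1) (\<lambda>i. \<omega> i) ((Suc r)\<^sup>2) (Suc k)) \<longlonglongrightarrow> toeplitz_moment (Suc k)" by blast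
  have "(\<lambda>r. toeplitz_mom (\<lambda>_. 1) (\<lambda>i. \<omega> i) ((Suc r)\<^sup>2) k) \<longlonglongrightarrow> toeplitz_moment k" if k: "k > 0" for k
    using \<omega>[of "k - 1"] k by simp
  then show ?thesis using limit_distribution_exists that by blast
qed

lemma is_LSD_toeplitz_cdf:
  assumes "prob_space M" "input_A1 M x \<or> input_A2 M x \<or> input_A3 M x" "phase c"
    and \<mu>: "real_distribution \<mu>" "char \<mu> = limit_char"
  shows "is_LSD M (\<lambda>n \<omega>. toeplitz_cdf c (\<lambda>i. x i \<omega>) n) (cdf \<mu>)"
  unfolding is_LSD_def
proof
  show "distribution_function (cdf \<mu>)" using \<mu>(1) unfolding distribution_function_def by blast
  show "AE \<omega> in M. weak_conv (\<lambda>n. toeplitz_cdf c (\<lambda>i. x i \<omega>) n) (cdf \<mu>)"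
    using AE_toeplitz_char_input[OF assms(1-3)]
    by eventually_elim (rule weak_conv_toeplitz[OF \<mu>], blast)
qed

text \<open>For uniqueness a competing limit is tested on the sign input. On a single sample path
  its weak convergence and the convergence to \<open>limit_char\<close> hold together, so Levy's
  theorems identify the two laws.\<close>

lemma L_T_eq:
  assumes \<mu>: "real_distribution \<mu>" "char \<mu> = limit_char"
  shows "L_T = cdf \<mu>"
  unfolding L_T_def
proof (rule the_equality)
  have esd: "toeplitz_esd x = (\<lambda>n \<omega>. toeplitz_cdf (\<lambda>_. 1) (\<lambda>i. x i \<omega>) n)" for x :: "nat \<Rightarrow> (nat \<Rightarrow> real) \<Rightarrow> real"
    by (intro ext) (simp add: toeplitz_esd_eq)
  show "\<forall>(M :: (nat \<Rightarrow> real) measure) x. prob_space M \<longrightarrow> input_A1 M x \<or> input_A2 M x \<or> input_A3 M x \<longrightarrow>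
      is_LSD M (toeplitz_esd x) (cdf \<mu>)"
    unfolding esd
  proof (intro allI impI)
    fix M :: "(nat \<Rightarrow> real) measure" and x
    assume "prob_space M" "input_A1 M x \<or> input_A2 M x \<or> input_A3 M x"
    then show "is_LSD M (\<lambda>n \<omega>. toeplitz_cdf (\<lambda>_. 1) (\<lambda>i. x i \<omega>) n) (cdf \<mu>)"
      by (rule is_LSD_toeplitz_cdf[OF _ _ phase_one \<mu>])
  qed
  fix F
  assume "\<forall>(M :: (nat \<Rightarrow> real) measure) x. prob_space M \<longrightarrow> input_A1 M x \<or> input_A2 M x \<or> input_A3 M x \<longrightarrow>
      is_LSD M (toeplitz_esd x) F"
  then have F: "is_LSD sign_space (toeplitz_esd (\<lambda>i \<omega>. \<omega> i)) F"
    using prob_space_sign_space input_A1_sign_space by blast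
  then obtain \<nu> where \<nu>: "real_distribution \<nu>" "F = cdf \<nu>"
    unfolding is_LSD_def distribution_function_def by blast
  interpret prob_space sign_space by (rule prob_space_sign_space)
  have "AE \<omega> in sign_space. weak_conv (toeplitz_cdf (\<lambda>_. 1) \<omega>) (cdf \<nu>)"
    using F unfolding is_LSD_def \<nu>(2) toeplitz_esd_eq by simp
  moreover have "AE \<omega> in sign_space. \<forall>t. (\<lambda>n. toeplitz_char (\<lambda>_. 1) \<omega> n t) \<longlonglongrightarrow> limit_char t"
    using AE_toeplitz_char_input[OF prob_space_sign_space disjI1[OF input_A1_sign_space] phase_one] by simp
  ultimately have "AE \<omega> in sign_space. weak_conv (toeplitz_cdf (\<lambda>_. 1) \<omega>) (cdf \<nu>)
      \<and> (\<forall>t. (\<lambda>n. toeplitz_char (\<lambda>_. 1) \<omega> n t) \<longlonglongrightarrow> limit_char t)"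
    by (rule eventually_conj)
  from eventually_happens'[OF ae_filter_bot this] obtain \<omega> where
    "weak_conv (toeplitz_cdf (\<lambda>_. 1) \<omega>) (cdf \<nu>)" "\<And>t. (\<lambda>n. toeplitz_char (\<lambda>_. 1) \<omega> n t) \<longlonglongrightarrow> limit_char t" by blast
  then have "char \<nu> = limit_char" by (rule char_eq_limit_char[OF \<nu>(1)])
  then have "\<nu> = \<mu>" using Levy_uniqueness[OF \<nu>(1) \<mu>(1)] \<mu>(2) by simp
  then show "F = cdf \<mu>" using \<nu>(2) by simp
qed

theorem theorem4p2:
  fixes M :: "'a measure" and x :: "nat \<Rightarrow> 'a \<Rightarrow> real"
  assumes "prob_space M"
    and "input_A1 M x \<or> input_A2 M x \<or> input_A3 M x"
  shows "is_LSD M (toeplitz_esd x) L_T \<and> is_LSD M (skew_toeplitz_esd x) L_T"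
proof -
  \<comment> \<open>The limit law is fixed independently of the input and of the phase; the two
    claims are then the instances of one theorem for the phases 1 and
    \<open>skew_phase\<close>.\<close>
  obtain \<mu> where \<mu>: "real_distribution \<mu>" "char \<mu> = limit_char" using limit_distribution .
  have "toeplitz_esd x = (\<lambda>n \<omega>. toeplitz_cdf (\<lambda>_. 1) (\<lambda>i. x i \<omega>) n)"
    "skew_toeplitz_esd x = (\<lambda>n \<omega>. toeplitz_cdf skew_phase (\<lambda>i. x i \<omega>) n)"
    by (intro ext; simp add: toeplitz_esd_eq skew_toeplitz_esd_eq)+
  then show ?thesis
    using is_LSD_toeplitz_cdf[OF assms phase_one \<mu>] is_LSD_toeplitz_cdf[OF assms phase_skew \<mu>]
    by (simp add: L_T_eq[OF \<mu>])
qed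

end
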